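(* Let $d\ge 1$, $p\in(1,\infty)$, $s\in(0,1)$, and $q\in[1,p_s^* )$. (i) (Strict Faber-Krahn type inequality) Let $H$ be a polarizer in $\mathbb{R}^d$, and let $\Omega\subset\mathbb{R}^d$ be a bounded open set with $\mathcal{C}^{1,1}$-boundary. Then $$\lambda^s_{p,q}(P_H(\Omega))\le \lambda^s_{p,q}(\Omega).$$ Further, if $\Omega\ne P_H(\Omega)$ and $P_H(\Omega)\neq\sigma_H(\Omega)$, then $$\lambda^s_{p,q}(P_H(\Omega))<\lambda^s_{p,q}(\Omega).$$ (ii) (Strict monotonicity) Let $0<r<R$, and let $e_1=(1,0,\dots,0)\in\mathbb{R}^d$. Then the function $t\mapsto \lambda^s_{p,q}\left(B_R(0)\setminus\overline{B}_r(te_1)\right)$ is strictly decreasing for $0\le t<R-r$. In particular, $$\lambda^s_{p,q}\left(B_R(0)\setminus\overline{B}_r(0)\right)=\max_{0\le t<R-r}\lambda^s_{p,q}\left(B_R(0)\setminus\overline{B}_r(te_1)\right).$$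
   Context: $p_s^*=\frac{dp}{d-sp}$ if $sp<d$ and $p_s^*=\infty$ if $sp\ge d$. The Gagliardo seminorm is $$[u]_{s,p}=\left(\int_{\mathbb{R}^d}\int_{\mathbb{R}^d}\frac{|u(x)-u(y)|^p}{|x-y|^{d+sp}}\,dy\,dx\right)^{1/p}.$$ For an open set $\Omega\subset\mathbb{R}^d$, $W^{s,p}_0(\Omega)=\{u\in L^p(\mathbb{R}^d): [u]_{s,p}<\infty,\ u=0 \text{ in }\mathbb{R}^d\setminus\Omega\}$. For a bounded open set $\Omega\subset \mathbb{R}^d$, the first $q$-eigenvalue of the fractional $p$-Laplace operator is $$\lambda^s_{p,q}(\Omega)=\inf\left\{[u]_{s,p}^p : u\in W^{s,p}_0(\Omega),\ \|u\|_{L^q(\Omega)}=1\right\}.$$ A polarizer is an open affine half-space $H=\{x\in\mathbb{R}^d: x\cdot h<a\}$ with $h\in\mathbb{S}^{d-1}$, $a\in\mathbb{R}$; $\sigma_H(x)=x-2(x\cdot h-a)h$ is the reflection with respect to $\partial H$, and $\sigma_H(\Omega)=\{\sigma_H(x):x\in\Omega\}$. The polarization of $\Omega\subseteq\mathbb{R}^d$ with respect to $H$ is $$P_H(\Omega)=\left[(\Omega\cup\sigma_H(\Omega))\cap H\right]\cup\left[\Omega\cap\sigma_H(\Omega)\right].$$ $B_r(z)$ is the open ball of radius $r$ centered at $z$, and $\overline{B}_r(z)$ is its closure. *)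

theory Defs
  imports "HOL-Analysis.Analysis"
begin

text \<open>Real powers on the extended half-line, used with positive exponents only.\<close>

definition ennreal_rpow :: "ennreal \<Rightarrow> real \<Rightarrow> ennreal" where
  "ennreal_rpow x a = (if x = top then top else ennreal (enn2real x powr a))"

definition critical_exponent :: "nat \<Rightarrow> real \<Rightarrow> real \<Rightarrow> ereal" where
  "critical_exponent d s p =
     (if s * p < real d then ereal (real d * p / (real d - s * p)) else \<infinity>)"

definition Lnorm :: "real \<Rightarrow> ('a::euclidean_space) set \<Rightarrow> ('a \<Rightarrow> real) \<Rightarrow> ennreal" where
  "Lnorm p A u =
     ennreal_rpow (\<integral>\<^sup>+x\<in>A. ennreal (\<bar>u x\<bar> powr p) \<partial>lebesgue) (1 / p)"

text \<open>On the diagonal the integrand below is \<open>0 / 0 = 0\<close>; the diagonal is a null set.\<close>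

definition gagliardo_seminorm ::
    "real \<Rightarrow> real \<Rightarrow> ('a::euclidean_space \<Rightarrow> real) \<Rightarrow> ennreal" where
  "gagliardo_seminorm s p u =
     ennreal_rpow
       (\<integral>\<^sup>+x. (\<integral>\<^sup>+y.
          ennreal (\<bar>u x - u y\<bar> powr p / norm (x - y) powr (real DIM('a) + s * p))
        \<partial>lebesgue) \<partial>lebesgue)
       (1 / p)"

text \<open>Functions stand for their almost-everywhere classes, so vanishing outside \<open>\<Omega>\<close>
  is required almost everywhere.\<close>

definition W0 :: "real \<Rightarrow> real \<Rightarrow> ('a::euclidean_space) set \<Rightarrow> ('a \<Rightarrow> real) set" where
  "W0 s p \<Omega> =
     {u. u \<in> borel_measurable lebesgue \<and> Lnorm p UNIV u < top \<and>
         gagliardo_seminorm s p u < top \<and>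
         (AE x in lebesgue. x \<notin> \<Omega> \<longrightarrow> u x = 0)}"

text \<open>The infimum is taken in the extended half-line, so that it is \<open>top\<close> if there is no
  admissible function (as for \<open>\<Omega> = {}\<close>).\<close>

definition eigenvalue ::
    "real \<Rightarrow> real \<Rightarrow> real \<Rightarrow> ('a::euclidean_space) set \<Rightarrow> ennreal" where
  "eigenvalue s p q \<Omega> =
     (INF u\<in>{u \<in> W0 s p \<Omega>. Lnorm q \<Omega> u = 1}. ennreal_rpow (gagliardo_seminorm s p u) p)"

definition polarizer :: "'a::euclidean_space \<Rightarrow> real \<Rightarrow> 'a set" where
  "polarizer h a = {x. x \<bullet> h < a}"

definition reflection :: "'a::euclidean_space \<Rightarrow> real \<Rightarrow> 'a \<Rightarrow> 'a" where
  "reflection h a x = x - (2 * (x \<bullet> h - a)) *\<^sub>R h"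

definition polarization :: "'a::euclidean_space \<Rightarrow> real \<Rightarrow> 'a set \<Rightarrow> 'a set" where
  "polarization h a \<Omega> =
     ((\<Omega> \<union> reflection h a ` \<Omega>) \<inter> polarizer h a) \<union> (\<Omega> \<inter> reflection h a ` \<Omega>)"

definition C11_function :: "('a::euclidean_space \<Rightarrow> real) \<Rightarrow> bool" where
  "C11_function g \<longleftrightarrow>
     (\<exists>G L. (\<forall>x. (g has_derivative (\<lambda>v. G x \<bullet> v)) (at x)) \<and> L-lipschitz_on UNIV G)"

text \<open>Near each boundary point, in suitable orthonormal coordinates, \<open>\<Omega>\<close> is the set above
  the graph of a \<open>C\<^sup>1\<^sup>,\<^sup>1\<close> function of the first \<open>d - 1\<close> coordinates. The last coordinate
  axis is spanned by the unit vector \<open>n\<close>, and \<open>x - (x \<bullet> n) *\<^sub>R n\<close> is the projection of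
  \<open>x\<close> to the hyperplane orthogonal to \<open>n\<close>. Only the values of \<open>g\<close> on that hyperplane
  matter; a \<open>C\<^sup>1\<^sup>,\<^sup>1\<close> function on the hyperplane extends to the whole space by composition
  with the projection.\<close>

definition C11_boundary :: "('a::euclidean_space) set \<Rightarrow> bool" where
  "C11_boundary \<Omega> \<longleftrightarrow>
     (\<forall>z\<in>frontier \<Omega>. \<exists>\<rho>>0. \<exists>n g. norm n = 1 \<and> C11_function g \<and>
        \<Omega> \<inter> ball z \<rho> = {x \<in> ball z \<rho>. x \<bullet> n > g (x - (x \<bullet> n) *\<^sub>R n)})"

end

theory Submission
  imports Defs "HOL-Complex_Analysis.Great_Picard"
begin

text \<open>Polarizing a nonnegative \<open>u\<close> does not change its norms, and grouping the four pairs
  \<open>(x, y)\<close>, \<open>(\<sigma>x, y)\<close>, \<open>(x, \<sigma>y)\<close>, \<open>(\<sigma>x, \<sigma>y)\<close> shows by convexity of \<open>\<bar>t\<bar>\<^sup>p\<close> that its energy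
  does not increase; it drops strictly unless one of \<open>u \<ge> u \<circ> \<sigma>\<close>, \<open>u \<le> u \<circ> \<sigma>\<close> holds a.e. in \<open>H\<close>.
  For the strict inequality this is applied to a nonnegative minimizer. It exists because
  averaging over dyadic cubes of side \<open>2\<^bsup>-k\<^esup>\<close> approximates functions of bounded energy uniformly,
  and it vanishes on no ball in \<open>\<Omega>\<close>, because a small bump there would pay off to first order.
  Of the boundary regularity only \<open>int (cl \<Omega>) = \<Omega>\<close> is used, which turns \<open>\<Omega> \<noteq> P\<^sub>H(\<Omega>) \<noteq> \<sigma>\<^sub>H(\<Omega>)\<close> into
  balls where the minimizer and its reflection are strictly ordered in opposite ways.
  For the annuli, polarization about the hyperplane halfway between two centres moves the hole.\<close>

section \<open>Reduction to Borel functions\<close>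

text \<open>An infimum over strictly smaller numbers need not be strictly smaller, so strictness has
  to come from a function that attains the eigenvalue. Attainment needs compactness in L^q for every
  subcritical q. Neither a Sobolev embedding nor interpolation enters: bounded energy lets dyadic
  means at scale 2^-k grow at most like 2^(\<beta> k), while the deviations from them shrink in L^p
  like 2^(-s k). For subcritical q some \<beta> makes the combined bounds summable over the layers
  of u, and the L^q tails become small uniformly in u. The minimizer is not shown to be positive
  almost everywhere, which would call for a strong maximum principle; not vanishing on any ball is
  enough. Here nonlocality helps: a bump placed on a ball of zeros interacts with the distant region
  where the minimizer is large. This interaction is linear in the height of the bump, whereas the
  bump's own energy scales with the power p > 1 of that height.\<close>

definition energy :: "real \<Rightarrow> real \<Rightarrow> ('a::euclidean_space \<Rightarrow> real) \<Rightarrow> ennreal" where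
  "energy s p u =
     (\<integral>\<^sup>+x. (\<integral>\<^sup>+y. ennreal (\<bar>u x - u y\<bar> powr p / norm (x - y) powr (real DIM('a) + s * p))
        \<partial>lborel) \<partial>lborel)"

text \<open>Borel representatives that vanish at every point outside \<open>\<Omega>\<close>. With
  them reflections and product measures stay within Borel measurability, and the L^q normalization
  can be taken over the whole space.\<close>

definition admissible ::
    "real \<Rightarrow> real \<Rightarrow> real \<Rightarrow> ('a::euclidean_space) set \<Rightarrow> ('a \<Rightarrow> real) set" where
  "admissible s p q \<Omega> =
     {u \<in> borel_measurable borel. (\<forall>x. x \<notin> \<Omega> \<longrightarrow> u x = 0) \<and>
        (\<integral>\<^sup>+x. ennreal (\<bar>u x\<bar> powr p) \<partial>lborel) < top \<and> energy s p u < top \<and>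
        (\<integral>\<^sup>+x. ennreal (\<bar>u x\<bar> powr q) \<partial>lborel) = 1}"

lemma ennreal_rpow_inverse: "0 < p \<Longrightarrow> ennreal_rpow (ennreal_rpow x (1 / p)) p = x"
  by (cases x) (auto simp: ennreal_rpow_def powr_powr)

lemma ennreal_rpow_less_top: "ennreal_rpow x a < top \<longleftrightarrow> x < top"
  by (auto simp: ennreal_rpow_def top.not_eq_extremum)

lemma ennreal_rpow_eq_1_iff:
  assumes "0 < q" shows "ennreal_rpow x (1 / q) = 1 \<longleftrightarrow> x = 1"
proof
  assume "ennreal_rpow x (1 / q) = 1"
  then have "ennreal_rpow (ennreal_rpow x (1 / q)) q = ennreal_rpow 1 q" by simp
  then show "x = 1" using assms by (simp add: ennreal_rpow_inverse) (simp add: ennreal_rpow_def)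
qed (simp add: ennreal_rpow_def)

lemma energy_cong_AE:
  assumes "AE x in lborel. u x = v x"
  shows "energy s p u = energy s p v"
  unfolding energy_def
proof (rule nn_integral_cong_AE)
  show "AE x in lborel.
      (\<integral>\<^sup>+y. ennreal (\<bar>u x - u y\<bar> powr p / norm (x - y) powr (real DIM('a) + s * p)) \<partial>lborel) =
      (\<integral>\<^sup>+y. ennreal (\<bar>v x - v y\<bar> powr p / norm (x - y) powr (real DIM('a) + s * p)) \<partial>lborel)"
    using assms
  proof eventually_elim
    case (elim x)
    show ?case by (rule nn_integral_cong_AE) (use assms in eventually_elim, use elim in simp)
  qed
qed

lemma gagliardo_rpow: "0 < p \<Longrightarrow> ennreal_rpow (gagliardo_seminorm s p u) p = energy s p u"
  by (simp add: gagliardo_seminorm_def ennreal_rpow_inverse energy_def nn_integral_completion)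

lemma gagliardo_less_top: "gagliardo_seminorm s p u < top \<longleftrightarrow> energy s p u < top"
  by (simp add: gagliardo_seminorm_def ennreal_rpow_less_top energy_def nn_integral_completion)

lemma nn_integral_restrict_support:
  assumes "\<And>x. x \<notin> \<Omega> \<Longrightarrow> u x = 0"
  shows "(\<integral>\<^sup>+x\<in>\<Omega>. ennreal (\<bar>u x\<bar> powr q) \<partial>lborel) = (\<integral>\<^sup>+x. ennreal (\<bar>u x\<bar> powr q) \<partial>lborel)"
  by (intro nn_integral_cong) (use assms in \<open>auto simp: indicator_def\<close>)

lemma eigenvalue_eq_INF_energy:
  fixes \<Omega> :: "('a::euclidean_space) set"
  assumes p: "0 < p" and q: "0 < q" and \<Omega>: "\<Omega> \<in> sets borel"
  shows "eigenvalue s p q \<Omega> = (INF u\<in>admissible s p q \<Omega>. energy s p u)"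
proof (rule antisym)
  show "eigenvalue s p q \<Omega> \<le> (INF u\<in>admissible s p q \<Omega>. energy s p u)"
    unfolding eigenvalue_def gagliardo_rpow[OF p]
  proof (rule INF_superset_mono[OF _ order_refl], intro subsetI)
    fix u assume u: "u \<in> admissible s p q \<Omega>"
    then have m: "u \<in> borel_measurable borel" and "\<And>x. x \<notin> \<Omega> \<Longrightarrow> u x = 0"
      by (auto simp: admissible_def)
    then show "u \<in> {u \<in> W0 s p \<Omega>. Lnorm q \<Omega> u = 1}"
      using u nn_integral_restrict_support[of \<Omega> u q]
      by (auto simp: admissible_def W0_def Lnorm_def ennreal_rpow_less_top gagliardo_less_top
          ennreal_rpow_eq_1_iff[OF q] nn_integral_completion intro: measurable_completion)
  qed
next
  show "(INF u\<in>admissible s p q \<Omega>. energy s p u) \<le> eigenvalue s p q \<Omega>"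
    unfolding eigenvalue_def gagliardo_rpow[OF p]
  proof (rule INF_mono)
    fix u assume u: "u \<in> {u \<in> W0 s p \<Omega>. Lnorm q \<Omega> u = 1}"
    then have "u \<in> borel_measurable lebesgue" by (auto simp: W0_def)
    from completion_ex_borel_measurable_real[OF this]
    obtain v where v: "v \<in> borel_measurable lborel" "AE x in lborel. u x = v x" by auto
    \<comment> \<open>The Borel representative \<open>v\<close> vanishes outside
      \<open>\<Omega>\<close> only almost everywhere; cutting it off, which stays measurable because
      \<open>\<Omega>\<close> is Borel, makes this pointwise.\<close>
    define w where "w x = (if x \<in> \<Omega> then v x else 0)" for x
    have "AE x in lborel. x \<notin> \<Omega> \<longrightarrow> u x = 0"
      using u by (auto simp: W0_def AE_completion_iff)
    then have uw: "AE x in lborel. u x = w x"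
      using v(2) by eventually_elim (auto simp: w_def)
    have [measurable]: "w \<in> borel_measurable borel"
      using v(1) \<Omega> unfolding w_def by (intro measurable_If_set) auto
    have e: "energy s p u = energy s p w" by (rule energy_cong_AE[OF uw])
    have n: "(\<integral>\<^sup>+x. ennreal (\<bar>u x\<bar> powr r) \<partial>lborel) = (\<integral>\<^sup>+x. ennreal (\<bar>w x\<bar> powr r) \<partial>lborel)" for r
      by (rule nn_integral_cong_AE) (use uw in eventually_elim, simp)
    have n': "(\<integral>\<^sup>+x\<in>\<Omega>. ennreal (\<bar>u x\<bar> powr r) \<partial>lborel) = (\<integral>\<^sup>+x\<in>\<Omega>. ennreal (\<bar>w x\<bar> powr r) \<partial>lborel)" for r
      by (rule nn_integral_cong_AE) (use uw in eventually_elim, simp)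
    have "w \<in> admissible s p q \<Omega>"
      using u nn_integral_restrict_support[of \<Omega> w q]
      by (auto simp: admissible_def W0_def Lnorm_def ennreal_rpow_less_top gagliardo_less_top
          ennreal_rpow_eq_1_iff[OF q] nn_integral_completion n n' e) (auto simp: w_def)
    then show "\<exists>m\<in>admissible s p q \<Omega>. energy s p m \<le> energy s p u"
      using e by (intro bexI[of _ w]) auto
  qed
qed

section \<open>Convexity of powers and reflections\<close>

text \<open>Strict Bernoulli inequality: the derivative of \<open>x powr p - p * x\<close> changes
  sign only at 1. The endpoint 0 is checked by hand, since the monotonicity arguments run on
  intervals away from 0.\<close>

lemma powr_above_tangent:
  fixes p x :: real
  assumes p: "1 < p" and x: "0 \<le> x" "x \<noteq> 1"
  shows "1 + p * (x - 1) < x powr p"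
proof -
  have d: "((\<lambda>x. x powr p - p * x) has_real_derivative p * (y powr (p - 1) - 1)) (at y)" if "0 < y" for y
    using that by (auto intro!: derivative_eq_intros simp: algebra_simps)
  have c: "continuous_on {a..b} (\<lambda>x. x powr p - p * x)" if "0 < a" for a b :: real
    using that by (intro continuous_intros) auto
  consider "x = 0" | "0 < x" "x < 1" | "1 < x" using x by linarith
  then show ?thesis
  proof cases
    case 2
    have "1 powr p - p * 1 < x powr p - p * x"
    proof (rule DERIV_neg_imp_decreasing_open[OF 2(2) _ c[OF 2(1)]])
      fix y assume y: "x < y" "y < 1"
      then have "y powr (p - 1) < 1 powr (p - 1)" using p 2 by (intro powr_less_mono2) auto
      then show "\<exists>z. ((\<lambda>x. x powr p - p * x) has_real_derivative z) (at y) \<and> z < 0"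
        using d[of y] y 2 p by (intro exI[of _ "p * (y powr (p - 1) - 1)"]) (auto simp: mult_less_0_iff)
    qed
    then show ?thesis by (simp add: algebra_simps)
  next
    case 3
    have "1 powr p - p * 1 < x powr p - p * x"
    proof (rule DERIV_pos_imp_increasing_open[OF 3 _ c])
      fix y assume y: "1 < y" "y < x"
      then have "1 powr (p - 1) < y powr (p - 1)" using p by (intro powr_less_mono2) auto
      then show "\<exists>z. ((\<lambda>x. x powr p - p * x) has_real_derivative z) (at y) \<and> 0 < z"
        using d[of y] y p by (intro exI[of _ "p * (y powr (p - 1) - 1)"]) auto
    qed auto
    then show ?thesis by (simp add: algebra_simps)
  qed (use p in auto)
qed

lemma powr_above_tangent_scaled:
  fixes p x m :: real
  assumes p: "1 < p" and x: "0 \<le> x" "x \<noteq> m" and m: "0 < m"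
  shows "m powr p + p * m powr (p - 1) * (x - m) < x powr p"
proof -
  have "m powr p * (1 + p * (x / m - 1)) < m powr p * (x / m) powr p"
    using powr_above_tangent[of p "x / m"] assms by simp
  moreover have "m powr p * (x / m) powr p = x powr p"
    using x m by (simp flip: powr_mult)
  moreover have "m powr p = m powr (p - 1) * m"
    using m by (simp add: powr_diff)
  then have "m powr p * (1 + p * (x / m - 1)) = m powr p + p * m powr (p - 1) * (x - m)"
    using m by (simp add: field_simps)
  ultimately show ?thesis by simp
qed

text \<open>The slope is the derivative of |t|^p at \<open>m\<close>. Convexity and Jensen's
  inequality below need only that some slope works, so its value stays hidden.\<close>

lemma abs_powr_support_line:
  fixes p m :: real
  assumes p: "1 < p"
  obtains c where "\<And>t. t \<noteq> m \<Longrightarrow> \<bar>m\<bar> powr p + c * (t - m) < \<bar>t\<bar> powr p"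
proof -
  have pos: "m powr p + p * m powr (p - 1) * (t - m) < \<bar>t\<bar> powr p" if m: "0 < m" and t: "t \<noteq> m" for t m :: real
  proof (cases "\<bar>t\<bar> = m")
    case True
    then have "t - m < 0" using t by auto
    then have "p * m powr (p - 1) * (t - m) < 0" using p m by (intro mult_pos_neg) auto
    then show ?thesis using True m by simp
  next
    case False
    have "p * m powr (p - 1) * (t - m) \<le> p * m powr (p - 1) * (\<bar>t\<bar> - m)"
      using p by (intro mult_left_mono) auto
    with powr_above_tangent_scaled[OF p _ False m] show ?thesis by simp
  qed
  consider "m = 0" | "0 < m" | "m < 0" by linarith
  then show ?thesis
  proof cases
    case 1 then show ?thesis by (intro that[of 0]) auto
  next
    case 2 then show ?thesis using pos[OF 2] by (intro that[of "p * m powr (p - 1)"]) auto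
  next
    case 3
    show ?thesis
    proof (rule that[of "- (p * (- m) powr (p - 1))"])
      fix t assume "t \<noteq> m"
      then show "\<bar>m\<bar> powr p + - (p * (- m) powr (p - 1)) * (t - m) < \<bar>t\<bar> powr p"
        using pos[of "- m" "- t"] 3 by (simp add: algebra_simps)
    qed
  qed
qed

text \<open>Weighting the support line at \<open>m\<close>, evaluated at \<open>l\<close> and
  \<open>u\<close>, by \<open>u - m\<close> and \<open>m - l\<close> cancels the slope. Clearing the
  denominator \<open>u - l\<close> avoids divisions.\<close>

lemma abs_powr_strict_convex:
  fixes p m l u :: real
  assumes p: "1 < p" and lm: "l < m" and mu: "m < u"
  shows "(u - l) * \<bar>m\<bar> powr p < (u - m) * \<bar>l\<bar> powr p + (m - l) * \<bar>u\<bar> powr p"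
proof -
  obtain c where c: "\<And>t. t \<noteq> m \<Longrightarrow> \<bar>m\<bar> powr p + c * (t - m) < \<bar>t\<bar> powr p"
    using abs_powr_support_line[OF p] by metis
  have "(u - m) * (\<bar>m\<bar> powr p + c * (l - m)) < (u - m) * \<bar>l\<bar> powr p"
       "(m - l) * (\<bar>m\<bar> powr p + c * (u - m)) < (m - l) * \<bar>u\<bar> powr p"
    using c[of l] c[of u] lm mu by auto
  then show ?thesis by (simp add: algebra_simps)
qed

text \<open>\<open>A - D\<close> and \<open>B - C\<close> lie strictly between \<open>B - D\<close>
  and \<open>A - C\<close> and have the same sum as these two, so passing to the outer pair
  increases a strictly convex function.\<close>

lemma abs_powr_swap_less:
  fixes A B C D p :: real
  assumes p: "1 < p" and "B < A" "C < D"
  shows "\<bar>A - D\<bar> powr p + \<bar>B - C\<bar> powr p < \<bar>A - C\<bar> powr p + \<bar>B - D\<bar> powr p"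
proof -
  let ?l = "B - D" and ?u = "A - C"
  have "(?u - ?l) * \<bar>A - D\<bar> powr p < (?u - (A - D)) * \<bar>?l\<bar> powr p + ((A - D) - ?l) * \<bar>?u\<bar> powr p"
       "(?u - ?l) * \<bar>B - C\<bar> powr p < (?u - (B - C)) * \<bar>?l\<bar> powr p + ((B - C) - ?l) * \<bar>?u\<bar> powr p"
    using assms by (intro abs_powr_strict_convex; simp)+
  then have "(?u - ?l) * (\<bar>A - D\<bar> powr p + \<bar>B - C\<bar> powr p) < (?u - ?l) * (\<bar>?u\<bar> powr p + \<bar>?l\<bar> powr p)"
    by (simp add: algebra_simps)
  then show ?thesis using assms by simp
qed

lemma abs_powr_swap_le:
  fixes A B C D p :: real
  assumes p: "1 < p" and "B \<le> A" "C \<le> D"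
  shows "\<bar>A - D\<bar> powr p + \<bar>B - C\<bar> powr p \<le> \<bar>A - C\<bar> powr p + \<bar>B - D\<bar> powr p"
  using abs_powr_swap_less[OF p, of B A C D] assms by (cases "A = B"; cases "C = D") auto

text \<open>Applied with \<open>A\<close>, \<open>B\<close> the values of u at x and at its mirror
  image, \<open>C\<close>, \<open>D\<close> those at y, and \<open>k\<close>, \<open>l\<close> the
  kernel at the near and at the far pair. Sorting both pairs puts the smaller differences on the
  heavier weight. The second alternative of the hypothesis covers x = y, where \<open>k\<close> is
  1/0 = 0.\<close>

lemma max_min_pairing_le:
  fixes A B C D p k l :: real
  assumes p: "1 < p" and kl: "l \<le> k \<or> (A = C \<and> B = D)"
  shows "k * (\<bar>max A B - max C D\<bar> powr p + \<bar>min A B - min C D\<bar> powr p)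
       + l * (\<bar>min A B - max C D\<bar> powr p + \<bar>max A B - min C D\<bar> powr p)
     \<le> k * (\<bar>A - C\<bar> powr p + \<bar>B - D\<bar> powr p) + l * (\<bar>B - C\<bar> powr p + \<bar>A - D\<bar> powr p)"
proof -
  have sw: "k * X + l * Y \<le> k * Y + l * X" if "X \<le> Y" "l \<le> k" for X Y :: real
  proof -
    have "0 \<le> (k - l) * (Y - X)" using that by simp
    then show ?thesis by (simp add: algebra_simps)
  qed
  consider "B \<le> A" "D \<le> C" | "A \<le> B" "C \<le> D" | "B < A" "C < D" | "A < B" "D < C" by linarith
  then show ?thesis
  proof cases
    case 3
    then have "l \<le> k" using kl by auto
    from sw[OF abs_powr_swap_le[OF p, of B A C D] this] 3 show ?thesis by (simp add: add_ac)
  next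
    case 4
    then have "l \<le> k" using kl by auto
    from sw[OF abs_powr_swap_le[OF p, of A B D C] this] 4 show ?thesis by (simp add: add_ac)
  qed (auto simp: max_def min_def add_ac)
qed

lemma max_min_pairing_less:
  fixes A B C D p k l :: real
  assumes p: "1 < p" and kl: "l < k" and "B < A" "C < D"
  shows "k * (\<bar>max A B - max C D\<bar> powr p + \<bar>min A B - min C D\<bar> powr p)
       + l * (\<bar>min A B - max C D\<bar> powr p + \<bar>max A B - min C D\<bar> powr p)
     < k * (\<bar>A - C\<bar> powr p + \<bar>B - D\<bar> powr p) + l * (\<bar>B - C\<bar> powr p + \<bar>A - D\<bar> powr p)"
proof -
  have "0 < (k - l) * ((\<bar>A - C\<bar> powr p + \<bar>B - D\<bar> powr p) - (\<bar>A - D\<bar> powr p + \<bar>B - C\<bar> powr p))"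
    using abs_powr_swap_less[OF p, of B A C D] assms by simp
  then show ?thesis using assms by (simp add: algebra_simps)
qed

section \<open>Reflections: isometry and invariance of Lebesgue measure\<close>

lemma continuous_on_reflection [continuous_intros]: "continuous_on S (reflection h a)"
  unfolding reflection_def by (intro continuous_intros)

lemma measurable_reflection [measurable]: "reflection h a \<in> borel \<rightarrow>\<^sub>M borel"
  by (intro borel_measurable_continuous_onI continuous_on_reflection)

context
  fixes h :: "'a::euclidean_space" and a :: real
  assumes h: "norm h = 1"
begin

lemma reflection_inner: "reflection h a x \<bullet> h = 2 * a - x \<bullet> h"
  using h by (simp add: reflection_def inner_diff_left norm_eq_1)

lemma reflection_involution [simp]: "reflection h a (reflection h a x) = x"
proof -
  have "reflection h a (reflection h a x) = x - (2 * (x \<bullet> h - a) + 2 * (reflection h a x \<bullet> h - a)) *\<^sub>R h"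
    unfolding scaleR_left_distrib diff_diff_eq[symmetric] reflection_def ..
  then show ?thesis by (simp add: reflection_inner)
qed

text \<open>Reflecting y changes x - y only along \<open>h\<close>. The correction is governed by
  the product of the signed distances to the hyperplane, so x is nearer to y than to the mirror
  image of y when both lie on one side.\<close>

lemma norm_diff_reflection_square:
  "(norm (x - reflection h a y))\<^sup>2 = (norm (x - y))\<^sup>2 + 4 * (x \<bullet> h - a) * (y \<bullet> h - a)"
proof -
  have expand: "(norm (v + t *\<^sub>R h))\<^sup>2 = (norm v)\<^sup>2 + 2 * t * (v \<bullet> h) + t\<^sup>2" for v t
    using dot_norm[of v "t *\<^sub>R h"] h by (simp add: power_mult_distrib)
  have "x - reflection h a y = (x - y) + (2 * (y \<bullet> h - a)) *\<^sub>R h" by (simp add: reflection_def)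
  then have "(norm (x - reflection h a y))\<^sup>2 =
      (norm (x - y))\<^sup>2 + 2 * (2 * (y \<bullet> h - a)) * ((x - y) \<bullet> h) + (2 * (y \<bullet> h - a))\<^sup>2"
    by (simp only: expand)
  also have "\<dots> = (norm (x - y))\<^sup>2 + 4 * (x \<bullet> h - a) * (y \<bullet> h - a)"
    by (simp add: inner_diff_left power2_eq_square algebra_simps)
  finally show ?thesis .
qed

lemma norm_reflection_diff_reflection:
  "norm (reflection h a x - reflection h a y) = norm (x - y)"
proof -
  have "(norm (reflection h a x - reflection h a y))\<^sup>2 = (norm (x - y))\<^sup>2"
    using norm_diff_reflection_square[of "reflection h a x" y] norm_diff_reflection_square[of y x]
    by (simp add: reflection_inner norm_minus_commute algebra_simps)
  then show ?thesis by (simp add: power2_eq_iff_nonneg)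
qed

lemma norm_reflection_diff: "norm (reflection h a x - y) = norm (x - reflection h a y)"
  using norm_reflection_diff_reflection[of x "reflection h a y"] by simp

lemma norm_diff_le_reflection:
  assumes "x \<bullet> h \<le> a" "y \<bullet> h \<le> a"
  shows "norm (x - y) \<le> norm (x - reflection h a y)"
proof -
  have "0 \<le> (x \<bullet> h - a) * (y \<bullet> h - a)" using assms by (simp add: mult_nonpos_nonpos)
  then have "(norm (x - y))\<^sup>2 \<le> (norm (x - reflection h a y))\<^sup>2"
    unfolding norm_diff_reflection_square by (simp only: mult.assoc)
  then show ?thesis by (rule power2_le_imp_le) simp
qed

lemma norm_diff_less_reflection:
  assumes "x \<bullet> h < a" "y \<bullet> h < a"
  shows "norm (x - y) < norm (x - reflection h a y)"
proof -
  have "0 < (x \<bullet> h - a) * (y \<bullet> h - a)" using assms by (simp add: mult_neg_neg)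
  then have "(norm (x - y))\<^sup>2 < (norm (x - reflection h a y))\<^sup>2"
    unfolding norm_diff_reflection_square by (simp only: mult.assoc)
  then show ?thesis by (rule power2_less_imp_less) simp
qed

lemma image_reflection_eq_vimage: "reflection h a ` S = reflection h a -` S"
  by (auto simp: image_iff) (metis reflection_involution)

lemma open_reflection_image: "open S \<Longrightarrow> open (reflection h a ` S)"
  unfolding image_reflection_eq_vimage by (intro open_vimage continuous_on_reflection)

lemma reflection_image_ball: "reflection h a ` ball c r = ball (reflection h a c) r"
  unfolding image_reflection_eq_vimage
  by (auto simp: dist_norm norm_reflection_diff norm_minus_commute)
    (metis norm_minus_commute norm_reflection_diff)+

text \<open>Balls go to balls of equal radius, whose volume depends on the radius alone, and
  Vitali's theorem fills \<open>U\<close> by disjoint balls up to a null set. Only one inequality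
  comes out, as the image of the null set is not yet controlled; applying it to the image of
  \<open>U\<close> gives the other.\<close>

lemma emeasure_reflection_open_ge:
  assumes "open U"
  shows "emeasure lborel U \<le> emeasure lborel (reflection h a ` U)"
proof -
  define K where "K = {(c, r). 0 < r \<and> ball c r \<subseteq> U}"
  have cov: "\<exists>i. i \<in> K \<and> x \<in> ball (fst i) (snd i) \<and> snd i < d" if x: "x \<in> U" and d: "0 < d" for x d
  proof -
    obtain e where "0 < e" "ball x e \<subseteq> U" using assms x openE by blast
    then show ?thesis using d
      by (intro exI[of _ "(x, min e (d / 2))"]) (auto simp: K_def)
  qed
  obtain C where C: "countable C" "C \<subseteq> K"
    and dis: "pairwise (\<lambda>i j. disjnt (ball (fst i) (snd i)) (ball (fst j) (snd j))) C"
    and neg: "negligible (U - (\<Union>i\<in>C. ball (fst i) (snd i)))"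
    by (rule Vitali_covering_theorem_balls[OF cov])
  let ?V = "\<Union>i\<in>C. ball (fst i) (snd i)"
  have V: "open ?V" by auto
  then have [measurable]: "U \<in> sets borel" "?V \<in> sets borel" using assms by auto
  have "U - ?V \<in> null_sets lborel"
    using neg by (simp add: negligible_iff_null_sets null_sets_completion_iff)
  then have "emeasure lborel U \<le> emeasure lborel ?V"
    by (intro emeasure_mono_AE AE_I'[of "U - ?V"]) auto
  also have "\<dots> = (\<integral>\<^sup>+i. emeasure lborel (ball (fst i) (snd i)) \<partial>count_space C)"
    using C dis by (intro emeasure_UN_countable) (auto simp: disjoint_family_on_def pairwise_def disjnt_def)
  also have "\<dots> = (\<integral>\<^sup>+i. emeasure lborel (reflection h a ` ball (fst i) (snd i)) \<partial>count_space C)"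
    using C by (intro nn_integral_cong) (auto simp: reflection_image_ball emeasure_ball K_def)
  also have "\<dots> = emeasure lborel (\<Union>i\<in>C. reflection h a ` ball (fst i) (snd i))"
  proof (rule emeasure_UN_countable[symmetric])
    show "disjoint_family_on (\<lambda>i. reflection h a ` ball (fst i) (snd i)) C"
      using dis unfolding image_reflection_eq_vimage
      by (auto simp: disjoint_family_on_def pairwise_def disjnt_def simp flip: vimage_Int)
  qed (use C in \<open>auto intro!: borel_open open_reflection_image\<close>)
  also have "\<dots> \<le> emeasure lborel (reflection h a ` U)"
  proof (rule emeasure_mono)
    show "(\<Union>i\<in>C. reflection h a ` ball (fst i) (snd i)) \<subseteq> reflection h a ` U"
      using C(2) by (intro UN_least image_mono) (fastforce simp: K_def)
    show "reflection h a ` U \<in> sets lborel"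
      using open_reflection_image[OF assms] by simp
  qed
  finally show ?thesis .
qed

lemma emeasure_reflection_open:
  assumes "open U"
  shows "emeasure lborel (reflection h a ` U) = emeasure lborel U"
proof (rule antisym)
  have "reflection h a ` reflection h a ` U = U" by (simp add: image_image)
  then show "emeasure lborel (reflection h a ` U) \<le> emeasure lborel U"
    using emeasure_reflection_open_ge[OF open_reflection_image[OF assms]] by simp
qed (rule emeasure_reflection_open_ge[OF assms])

lemma distr_lborel_reflection: "distr lborel borel (reflection h a) = lborel"
proof (rule lborel_eqI[symmetric])
  fix l u :: 'a assume "\<And>b. b \<in> Basis \<Longrightarrow> l \<bullet> b \<le> u \<bullet> b"
  then show "emeasure (distr lborel borel (reflection h a)) (box l u) = ennreal (\<Prod>b\<in>Basis. (u - l) \<bullet> b)"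
    using emeasure_reflection_open[OF open_box, of l u]
    by (simp add: emeasure_distr image_reflection_eq_vimage)
qed simp

lemma nn_integral_reflection:
  assumes "f \<in> borel_measurable borel"
  shows "(\<integral>\<^sup>+x. f (reflection h a x) \<partial>lborel) = (\<integral>\<^sup>+x. f x \<partial>lborel)"
  using nn_integral_distr[of "reflection h a" lborel borel f] assms by (simp add: distr_lborel_reflection)

end

section \<open>Polarization and the Gagliardo energy\<close>

text \<open>The two-point rearrangement. Points of the hyperplane are fixed by the reflection, so
  maximum and minimum agree there and either branch may treat them.\<close>

definition polarize :: "'a::euclidean_space \<Rightarrow> real \<Rightarrow> ('a \<Rightarrow> real) \<Rightarrow> 'a \<Rightarrow> real" where
  "polarize h a u x =
     (if x \<bullet> h < a then max (u x) (u (reflection h a x)) else min (u x) (u (reflection h a x)))"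

definition gagliardo_quotient :: "real \<Rightarrow> real \<Rightarrow> ('a::euclidean_space \<Rightarrow> real) \<Rightarrow> 'a \<Rightarrow> 'a \<Rightarrow> real" where
  "gagliardo_quotient s p u x y = \<bar>u x - u y\<bar> powr p / norm (x - y) powr (real DIM('a) + s * p)"

lemma energy_eq_quotient:
  "energy s p u = (\<integral>\<^sup>+x. (\<integral>\<^sup>+y. ennreal (gagliardo_quotient s p u x y) \<partial>lborel) \<partial>lborel)"
  by (simp add: energy_def gagliardo_quotient_def)

lemma gagliardo_quotient_nonneg [simp]: "0 \<le> gagliardo_quotient s p u x y"
  by (simp add: gagliardo_quotient_def)

lemma measurable_gagliardo_quotient [measurable]:
  fixes u :: "'a::euclidean_space \<Rightarrow> real"
  assumes [measurable]: "u \<in> borel_measurable borel" "f \<in> M \<rightarrow>\<^sub>M borel" "g \<in> M \<rightarrow>\<^sub>M borel"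
  shows "(\<lambda>x. gagliardo_quotient s p u (f x) (g x)) \<in> borel_measurable M"
  unfolding gagliardo_quotient_def by measurable

context
  fixes h :: "'a::euclidean_space" and a :: real
  assumes h: "norm h = 1"
begin

lemma measurable_polarize [measurable]:
  assumes [measurable]: "u \<in> borel_measurable borel"
  shows "polarize h a u \<in> borel_measurable borel"
  unfolding polarize_def[abs_def] by measurable

text \<open>The four terms carry only two kernel values: one shared by (x, y) and its mirror pair,
  the other by the two mixed pairs.\<close>

definition symmetrized_quotient :: "real \<Rightarrow> real \<Rightarrow> ('a \<Rightarrow> real) \<Rightarrow> 'a \<Rightarrow> 'a \<Rightarrow> real" where
  "symmetrized_quotient s p u x y =
     gagliardo_quotient s p u x y + gagliardo_quotient s p u (reflection h a x) (reflection h a y)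
     + (gagliardo_quotient s p u (reflection h a x) y + gagliardo_quotient s p u x (reflection h a y))"

lemma symmetrized_quotient_nonneg [simp]: "0 \<le> symmetrized_quotient s p u x y"
  by (simp add: symmetrized_quotient_def)

lemma measurable_symmetrized_quotient [measurable]:
  assumes [measurable]: "u \<in> borel_measurable borel" "f \<in> M \<rightarrow>\<^sub>M borel" "g \<in> M \<rightarrow>\<^sub>M borel"
  shows "(\<lambda>x. symmetrized_quotient s p u (f x) (g x)) \<in> borel_measurable M"
  unfolding symmetrized_quotient_def by measurable

lemma nn_integral_symmetrized_quotient:
  assumes [measurable]: "u \<in> borel_measurable borel"
  shows "(\<integral>\<^sup>+x. (\<integral>\<^sup>+y. ennreal (symmetrized_quotient s p u x y) \<partial>lborel) \<partial>lborel) = 4 * energy s p u"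
proof -
  let ?r = "reflection h a" and ?Q = "\<lambda>x y. ennreal (gagliardo_quotient s p u x y)"
  have y: "(\<integral>\<^sup>+y. ?Q x (?r y) \<partial>lborel) = (\<integral>\<^sup>+y. ?Q x y \<partial>lborel)" for x
    by (rule nn_integral_reflection[OF h]) measurable
  have x: "(\<integral>\<^sup>+x. (\<integral>\<^sup>+y. ?Q (?r x) y \<partial>lborel) \<partial>lborel) = energy s p u"
    unfolding energy_eq_quotient by (rule nn_integral_reflection[OF h]) measurable
  have "(\<integral>\<^sup>+x. (\<integral>\<^sup>+y. ennreal (symmetrized_quotient s p u x y) \<partial>lborel) \<partial>lborel)
      = (\<integral>\<^sup>+x. (\<integral>\<^sup>+y. ?Q x y \<partial>lborel) + (\<integral>\<^sup>+y. ?Q (?r x) (?r y) \<partial>lborel)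
         + ((\<integral>\<^sup>+y. ?Q (?r x) y \<partial>lborel) + (\<integral>\<^sup>+y. ?Q x (?r y) \<partial>lborel)) \<partial>lborel)"
    by (simp add: symmetrized_quotient_def nn_integral_add)
  also have "\<dots> = energy s p u + energy s p u + (energy s p u + energy s p u)"
    unfolding y by (simp add: nn_integral_add x energy_eq_quotient)
  also have "\<dots> = 4 * energy s p u"
    by (metis add.assoc mult_2 numeral_Bit0 distrib_right)
  finally show ?thesis .
qed

text \<open>\<open>symmetrized_quotient\<close> does not change when either argument is reflected,
  so pointwise inequalities have to be checked only at folded points, where the two kernel values
  are ordered.\<close>

definition fold_half_space :: "'a \<Rightarrow> 'a" where
  "fold_half_space x = (if x \<bullet> h < a then x else reflection h a x)"

lemma symmetrized_quotient_fold:
  "symmetrized_quotient s p u (fold_half_space x) (fold_half_space y) = symmetrized_quotient s p u x y"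
  using h by (auto simp: symmetrized_quotient_def fold_half_space_def)

lemma fold_half_space_inner: "fold_half_space x \<bullet> h \<le> a"
  using h by (auto simp: fold_half_space_def reflection_inner)

lemma symmetrized_quotient_eq:
  "symmetrized_quotient s p u x y =
    1 / norm (x - y) powr (real DIM('a) + s * p) *
      (\<bar>u x - u y\<bar> powr p + \<bar>u (reflection h a x) - u (reflection h a y)\<bar> powr p)
    + 1 / norm (x - reflection h a y) powr (real DIM('a) + s * p) *
      (\<bar>u (reflection h a x) - u y\<bar> powr p + \<bar>u x - u (reflection h a y)\<bar> powr p)"
  by (simp add: symmetrized_quotient_def gagliardo_quotient_def norm_reflection_diff[OF h]
      norm_reflection_diff_reflection[OF h] add_divide_distrib h)

lemma polarize_half_space:
  assumes "x \<bullet> h \<le> a"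
  shows "polarize h a u x = max (u x) (u (reflection h a x))"
    and "polarize h a u (reflection h a x) = min (u x) (u (reflection h a x))"
proof -
  have "x \<bullet> h = a \<Longrightarrow> reflection h a x = x" by (simp add: reflection_def)
  then show "polarize h a u x = max (u x) (u (reflection h a x))"
    and "polarize h a u (reflection h a x) = min (u x) (u (reflection h a x))"
    using assms h by (auto simp: polarize_def reflection_inner min.commute less_le)
qed

lemma symmetrized_quotient_polarize_le:
  assumes p: "1 < p" and s: "0 < s"
  shows "symmetrized_quotient s p (polarize h a u) x y \<le> symmetrized_quotient s p u x y"
proof -
  have *: "symmetrized_quotient s p (polarize h a u) x y \<le> symmetrized_quotient s p u x y"
    if xy: "x \<bullet> h \<le> a" "y \<bullet> h \<le> a" for x y
    unfolding symmetrized_quotient_eq polarize_half_space[OF xy(1)] polarize_half_space[OF xy(2)]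
  proof (rule max_min_pairing_le[OF p])
    show "1 / norm (x - reflection h a y) powr (real DIM('a) + s * p) \<le> 1 / norm (x - y) powr (real DIM('a) + s * p)
      \<or> u x = u y \<and> u (reflection h a x) = u (reflection h a y)"
    proof (cases "x = y")
      case False
      then show ?thesis
        using norm_diff_le_reflection[OF h xy] p s
        by (intro disjI1 divide_left_mono powr_mono2 mult_pos_pos) (auto intro: order.strict_trans2)
    qed simp
  qed
  show ?thesis
    using *[OF fold_half_space_inner fold_half_space_inner, of x y] by (simp add: symmetrized_quotient_fold)
qed

lemma symmetrized_quotient_polarize_less:
  assumes p: "1 < p" and s: "0 < s" and xy: "x \<bullet> h < a" "y \<bullet> h < a"
    and u: "u (reflection h a x) < u x" "u y < u (reflection h a y)"
  shows "symmetrized_quotient s p (polarize h a u) x y < symmetrized_quotient s p u x y"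
proof -
  have le: "x \<bullet> h \<le> a" "y \<bullet> h \<le> a" using xy by auto
  have "x \<noteq> y" using u by auto
  then show ?thesis
    unfolding symmetrized_quotient_eq polarize_half_space[OF le(1)] polarize_half_space[OF le(2)]
    using norm_diff_less_reflection[OF h xy] p s u
    by (intro max_min_pairing_less[OF p] divide_strict_left_mono powr_less_mono2 mult_pos_pos)
      (auto intro: order.strict_trans2 add_pos_pos)
qed

lemma energy_polarize_le:
  assumes p: "1 < p" and s: "0 < s" and u [measurable]: "u \<in> borel_measurable borel"
  shows "energy s p (polarize h a u) \<le> energy s p u"
proof -
  have "4 * energy s p (polarize h a u) \<le> 4 * energy s p u"
    unfolding nn_integral_symmetrized_quotient[OF u, symmetric]
      nn_integral_symmetrized_quotient[OF measurable_polarize[OF u], symmetric]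
    by (intro nn_integral_mono ennreal_leI symmetrized_quotient_polarize_le[OF p s])
  then show ?thesis by (simp add: ennreal_mult_le_mult_iff)
qed

text \<open>Hypotheses \<open>A\<close> and \<open>B\<close> say that two sets have positive
  measure. On their product the symmetrized quotient drops strictly; Fubini's theorem turns this
  into a strict inequality of integrals, the polarized one being finite.\<close>

lemma energy_polarize_less:
  assumes p: "1 < p" and s: "0 < s" and u [measurable]: "u \<in> borel_measurable borel"
    and fin: "energy s p u < top"
    and A: "\<not> (AE x in lborel. \<not> (x \<bullet> h < a \<and> u (reflection h a x) < u x))"
    and B: "\<not> (AE x in lborel. \<not> (x \<bullet> h < a \<and> u x < u (reflection h a x)))"
  shows "energy s p (polarize h a u) < energy s p u"
proof -
  let ?S = "\<lambda>u z. ennreal (symmetrized_quotient s p u (fst z) (snd z))"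
  note measurable_polarize[OF u, measurable]
  have four: "(\<integral>\<^sup>+z. ?S u z \<partial>(lborel \<Otimes>\<^sub>M lborel)) = 4 * energy s p u"
    if [measurable]: "u \<in> borel_measurable borel" for u
    unfolding nn_integral_symmetrized_quotient[OF that, symmetric]
    by (subst lborel.nn_integral_fst[symmetric]) auto
  have "(\<integral>\<^sup>+z. ?S (polarize h a u) z \<partial>(lborel \<Otimes>\<^sub>M lborel)) < (\<integral>\<^sup>+z. ?S u z \<partial>(lborel \<Otimes>\<^sub>M lborel))"
  proof (rule nn_integral_less)
    have "4 * energy s p (polarize h a u) \<le> 4 * energy s p u"
      by (intro mult_left_mono energy_polarize_le p s u) auto
    also have "\<dots> < top" using fin by (simp add: ennreal_mult_less_top)
    finally show "(\<integral>\<^sup>+z. ?S (polarize h a u) z \<partial>(lborel \<Otimes>\<^sub>M lborel)) \<noteq> \<infinity>"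
      by (simp add: four)
    show "AE z in lborel \<Otimes>\<^sub>M lborel. ?S (polarize h a u) z \<le> ?S u z"
      by (intro AE_I2 ennreal_leI symmetrized_quotient_polarize_le[OF p s])
    show "\<not> (AE z in lborel \<Otimes>\<^sub>M lborel. ?S u z \<le> ?S (polarize h a u) z)"
    proof
      assume "AE z in lborel \<Otimes>\<^sub>M lborel. ?S u z \<le> ?S (polarize h a u) z"
      then have "AE x in lborel. AE y in lborel. ?S u (x, y) \<le> ?S (polarize h a u) (x, y)"
        by (rule lborel_pair.AE_pair)
      then have "AE x in lborel. \<not> (x \<bullet> h < a \<and> u (reflection h a x) < u x)"
      proof eventually_elim
        case (elim x)
        show ?case
        proof
          assume x: "x \<bullet> h < a \<and> u (reflection h a x) < u x"
          have "AE y in lborel. \<not> (y \<bullet> h < a \<and> u y < u (reflection h a y))"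
            using elim
          proof eventually_elim
            case (elim y)
            then show ?case
              using symmetrized_quotient_polarize_less[OF p s, of x y u] x
              by (auto simp: ennreal_le_iff not_le[symmetric])
          qed
          then show False using B by simp
        qed
      qed
      then show False using A by simp
    qed
  qed simp_all
  then show ?thesis
    unfolding four[OF u] four[OF measurable_polarize[OF u]] using mult_left_mono[of "energy s p u" "energy s p (polarize h a u)" 4]
    by (auto simp: not_le[symmetric])
qed

end

section \<open>Dyadic means\<close>

text \<open>Equality of floors makes lying in one cell an equivalence relation, yields half-open
  cubes that tile the space at every level, and is measurable jointly in both points.\<close>

definition dyadic_cell :: "nat \<Rightarrow> 'a::euclidean_space \<Rightarrow> 'a set" where
  "dyadic_cell k x = {y. \<forall>i\<in>Basis. \<lfloor>2 ^ k * (y \<bullet> i)\<rfloor> = \<lfloor>2 ^ k * (x \<bullet> i)\<rfloor>}"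

text \<open>The leading factor is the reciprocal volume of a cell. The Bochner integral would be 0
  by default for a function not integrable on the cell; a finite p-th moment excludes this.\<close>

definition dyadic_mean :: "nat \<Rightarrow> ('a::euclidean_space \<Rightarrow> real) \<Rightarrow> 'a \<Rightarrow> real" where
  "dyadic_mean k u x =
     2 powr (real k * DIM('a)) * (\<integral>y. indicator (dyadic_cell k x) y * u y \<partial>lborel)"

lemma dyadic_cell_self [simp]: "x \<in> dyadic_cell k x"
  by (simp add: dyadic_cell_def)

lemma dyadic_cell_eq: "y \<in> dyadic_cell k x \<Longrightarrow> dyadic_cell k y = dyadic_cell k x"
  by (auto simp: dyadic_cell_def)

lemma dyadic_mean_eq: "y \<in> dyadic_cell k x \<Longrightarrow> dyadic_mean k u y = dyadic_mean k u x"
  by (simp add: dyadic_mean_def dyadic_cell_eq)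

lemma dyadic_cell_Suc_subset: "dyadic_cell (Suc k) x \<subseteq> dyadic_cell k x"
proof -
  have "\<lfloor>2 ^ k * t\<rfloor> = \<lfloor>2 ^ Suc k * t\<rfloor> div 2" for t :: real
    using floor_divide_real_eq_div[of 2 "2 ^ Suc k * t"] by simp
  then show ?thesis by (auto simp: dyadic_cell_def)
qed

lemma measurable_dyadic_cell [measurable]:
  assumes [measurable]: "f \<in> M \<rightarrow>\<^sub>M borel" "g \<in> M \<rightarrow>\<^sub>M borel"
  shows "Measurable.pred M (\<lambda>z. f z \<in> dyadic_cell k (g z :: 'a::euclidean_space))"
  unfolding dyadic_cell_def by measurable

lemma sets_dyadic_cell [measurable]: "dyadic_cell k x \<in> sets borel"
  using measurable_dyadic_cell[of "\<lambda>y. y" borel "\<lambda>_. x"] by (simp add: pred_def)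

lemma norm_diff_dyadic_cell:
  fixes x :: "'a::euclidean_space"
  assumes "y \<in> dyadic_cell k x"
  shows "norm (x - y) \<le> real DIM('a) / 2 ^ k"
proof -
  have "norm (x - y) \<le> (\<Sum>i\<in>Basis. \<bar>(x - y) \<bullet> i\<bar>)" by (rule norm_le_l1)
  also have "\<dots> \<le> (\<Sum>i\<in>(Basis::'a set). 1 / 2 ^ k)"
  proof (rule sum_mono)
    fix i :: 'a assume "i \<in> Basis"
    then have "\<lfloor>2 ^ k * (y \<bullet> i)\<rfloor> = \<lfloor>2 ^ k * (x \<bullet> i)\<rfloor>" using assms by (simp add: dyadic_cell_def)
    then have "\<bar>2 ^ k * (x \<bullet> i) - 2 ^ k * (y \<bullet> i)\<bar> \<le> 1"
      using floor_correct[of "2 ^ k * (x \<bullet> i)"] floor_correct[of "2 ^ k * (y \<bullet> i)"] by linarith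
    moreover have "2 ^ k * (x \<bullet> i) - 2 ^ k * (y \<bullet> i) = 2 ^ k * ((x - y) \<bullet> i)"
      by (simp only: inner_diff_left right_diff_distrib)
    ultimately have "2 ^ k * \<bar>(x - y) \<bullet> i\<bar> \<le> 1"
      by (simp only: abs_mult) simp
    then show "\<bar>(x - y) \<bullet> i\<bar> \<le> 1 / 2 ^ k" by (simp add: field_simps)
  qed
  finally show ?thesis by simp
qed

text \<open>The two boxes pin down the volume of a cell, and the open one later supplies a point of
  a countable dense set in each cell.\<close>

lemma dyadic_cell_box:
  fixes x :: "'a::euclidean_space"
  obtains l u where "box l u \<subseteq> dyadic_cell k x" "dyadic_cell k x \<subseteq> cbox l u"
    and "\<And>i. i \<in> Basis \<Longrightarrow> u \<bullet> i - l \<bullet> i = 1 / 2 ^ k"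
proof
  let ?l = "\<Sum>i\<in>Basis. (of_int \<lfloor>2 ^ k * (x \<bullet> i)\<rfloor> / 2 ^ k) *\<^sub>R i :: 'a"
  let ?u = "\<Sum>i\<in>Basis. ((of_int \<lfloor>2 ^ k * (x \<bullet> i)\<rfloor> + 1) / 2 ^ k) *\<^sub>R i :: 'a"
  have mem: "y \<in> dyadic_cell k x \<longleftrightarrow> (\<forall>i\<in>Basis. ?l \<bullet> i \<le> y \<bullet> i \<and> y \<bullet> i < ?u \<bullet> i)" for y
    by (auto simp: dyadic_cell_def floor_eq_iff field_simps)
  show "?u \<bullet> i - ?l \<bullet> i = 1 / 2 ^ k" if "i \<in> Basis" for i
    using that by (simp add: field_simps)
  show "box ?l ?u \<subseteq> dyadic_cell k x" "dyadic_cell k x \<subseteq> cbox ?l ?u"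
    by (auto simp: mem box_def cbox_def less_imp_le)
qed

lemma emeasure_dyadic_cell:
  "emeasure lborel (dyadic_cell k x) = ennreal (2 powr - (real k * DIM('a)))"
  for x :: "'a::euclidean_space"
proof -
  obtain l u where lu: "box l u \<subseteq> dyadic_cell k x" "dyadic_cell k x \<subseteq> cbox l u"
    and side: "\<And>i. i \<in> Basis \<Longrightarrow> u \<bullet> i - l \<bullet> i = 1 / 2 ^ k"
    using dyadic_cell_box[of k x] by metis
  have le: "l \<bullet> i \<le> u \<bullet> i" if "i \<in> Basis" for i
  proof -
    have "0 \<le> u \<bullet> i - l \<bullet> i" unfolding side[OF that] by simp
    then show ?thesis by simp
  qed
  have "(\<Prod>i\<in>Basis. (u - l) \<bullet> i) = (1 / 2 ^ k) ^ DIM('a)"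
    using side by (simp add: inner_diff_left)
  also have "\<dots> = 2 powr - (real k * DIM('a))"
    by (simp add: powr_minus powr_realpow[symmetric] powr_powr divide_inverse power_inverse)
  finally have vol: "(\<Prod>i\<in>Basis. (u - l) \<bullet> i) = 2 powr - (real k * DIM('a))" .
  have "emeasure lborel (box l u) \<le> emeasure lborel (dyadic_cell k x)"
    "emeasure lborel (dyadic_cell k x) \<le> emeasure lborel (cbox l u)"
    using lu by (auto intro!: emeasure_mono)
  then show ?thesis
    using emeasure_lborel_box[of l u] emeasure_lborel_cbox[of l u] le vol by simp
qed

lemma measurable_dyadic_mean [measurable]:
  assumes [measurable]: "u \<in> borel_measurable borel"
  shows "dyadic_mean k u \<in> borel_measurable borel"
proof -
  have [measurable]: "(\<lambda>z. indicator (dyadic_cell k (fst z)) (snd z) * u (snd z)) \<in> borel_measurable (borel \<Otimes>\<^sub>M lborel)"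
    unfolding indicator_def by measurable
  show ?thesis
    unfolding dyadic_mean_def[abs_def]
    using lborel.borel_measurable_lebesgue_integral[of "\<lambda>x y. indicator (dyadic_cell k x) y * u y" borel]
    by (simp add: case_prod_beta')
qed

section \<open>Jensen's inequality for means over sets of finite measure\<close>

lemma integrable_indicator_mult:
  fixes u :: "'a \<Rightarrow> real"
  assumes p: "1 \<le> p" and [measurable]: "u \<in> borel_measurable M" "A \<in> sets M"
    and A: "emeasure M A < top" and fin: "(\<integral>\<^sup>+x. ennreal (\<bar>u x\<bar> powr p) \<partial>M) < top"
  shows "integrable M (\<lambda>y. indicator A y * u y)"
proof (rule integrableI_bounded)
  have le: "\<bar>t\<bar> \<le> 1 + \<bar>t\<bar> powr p" for t :: real
  proof (cases "\<bar>t\<bar> \<le> 1")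
    case False
    then have "\<bar>t\<bar> powr 1 \<le> \<bar>t\<bar> powr p" using p by (intro powr_mono) auto
    then show ?thesis using False by simp
  qed (simp add: add_increasing2)
  have "(\<integral>\<^sup>+y. ennreal (norm (indicator A y * u y)) \<partial>M)
      \<le> (\<integral>\<^sup>+y. indicator A y + ennreal (\<bar>u y\<bar> powr p) \<partial>M)"
    using le by (intro nn_integral_mono) (auto simp: indicator_def abs_mult simp flip: ennreal_1 ennreal_plus)
  also have "\<dots> < \<infinity>" using A fin by (subst nn_integral_add) (auto simp: less_top)
  finally show "(\<integral>\<^sup>+y. ennreal (norm (indicator A y * u y)) \<partial>M) < \<infinity>" .
qed measurable

text \<open>Jensen's inequality: integrate the support line of |t|^p at the shifted mean, whose
  linear term averages to zero. An infinite right-hand side is treated first, because the comparison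
  runs between real integrals.\<close>

lemma abs_mean_powr_le:
  fixes u :: "'a \<Rightarrow> real"
  assumes p: "1 < p" and [measurable]: "u \<in> borel_measurable M" "A \<in> sets M"
    and A: "emeasure M A = ennreal m" "0 < m" and int: "integrable M (\<lambda>y. indicator A y * u y)"
  shows "ennreal (\<bar>1 / m * (\<integral>y. indicator A y * u y \<partial>M) - c\<bar> powr p)
    \<le> ennreal (1 / m) * (\<integral>\<^sup>+y. indicator A y * ennreal (\<bar>u y - c\<bar> powr p) \<partial>M)"
proof -
  define I where "I = (\<integral>\<^sup>+y. indicator A y * ennreal (\<bar>u y - c\<bar> powr p) \<partial>M)"
  define a where "a = 1 / m * (\<integral>y. indicator A y * u y \<partial>M) - c"
  obtain d where d: "\<And>t. t \<noteq> a \<Longrightarrow> \<bar>a\<bar> powr p + d * (t - a) < \<bar>t\<bar> powr p"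
    using abs_powr_support_line[OF p] by metis
  have d: "\<bar>a\<bar> powr p + d * (t - a) \<le> \<bar>t\<bar> powr p" for t
    using d[of t] by (cases "t = a") auto
  show ?thesis
  proof (cases "I = top")
    case True
    then show ?thesis using A(2) by (simp add: I_def ennreal_mult_eq_top_iff)
  next
    case False
    let ?g = "\<lambda>y. indicator A y * \<bar>u y - c\<bar> powr p"
    have I: "I = (\<integral>\<^sup>+y. ennreal (?g y) \<partial>M)"
      unfolding I_def by (intro nn_integral_cong) (auto simp: indicator_def)
    have ig: "integrable M ?g"
      by (rule integrableI_nonneg) (use False I in \<open>auto simp: top.not_eq_extremum\<close>)
    have ind: "integrable M (\<lambda>y. indicator A y :: real)" "(\<integral>y. indicator A y \<partial>M) = m"
      using A by (auto simp: measure_def)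
    have "m * \<bar>a\<bar> powr p = (\<integral>y. (\<bar>a\<bar> powr p - d * c - d * a) * indicator A y + d * (indicator A y * u y) \<partial>M)"
      using A(2) int ind by (simp add: a_def field_simps)
    also have "\<dots> \<le> (\<integral>y. ?g y \<partial>M)"
    proof (rule integral_mono)
      show "integrable M (\<lambda>y. (\<bar>a\<bar> powr p - d * c - d * a) * indicator A y + d * (indicator A y * u y))"
        using int ind by auto
      show "(\<bar>a\<bar> powr p - d * c - d * a) * indicator A y + d * (indicator A y * u y) \<le> ?g y" for y
        using d[of "u y - c"] by (auto simp: indicator_def algebra_simps)
    qed (rule ig)
    finally have "\<bar>a\<bar> powr p \<le> 1 / m * (\<integral>y. ?g y \<partial>M)" using A(2) by (simp add: field_simps)
    moreover have "ennreal (1 / m) * I = ennreal (1 / m * (\<integral>y. ?g y \<partial>M))"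
      unfolding I using A(2) ig by (subst nn_integral_eq_integral) (auto simp: ennreal_mult'[symmetric])
    ultimately show ?thesis unfolding I_def[symmetric] a_def[symmetric] by (simp add: ennreal_leI)
  qed
qed

lemma abs_powr_le_imp_le:
  fixes p t c :: real
  assumes "0 < p" "ennreal (\<bar>t\<bar> powr p) \<le> ennreal (c powr p)" "0 \<le> c"
  shows "\<bar>t\<bar> \<le> c"
proof (rule ccontr)
  assume "\<not> \<bar>t\<bar> \<le> c"
  then have "c powr p < \<bar>t\<bar> powr p" using assms by (intro powr_less_mono2) auto
  then show False using assms by (simp add: ennreal_le_iff)
qed

text \<open>In dimension n a cell has diameter at most n 2^-k and volume 2^(-k n). The constant is
  the diameter bound to the power n + s p, divided by the volume.\<close>

definition deviation_const :: "real \<Rightarrow> real \<Rightarrow> nat \<Rightarrow> nat \<Rightarrow> real" where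
  "deviation_const s p n k = real n powr (real n + s * p) * 2 powr - (real k * (s * p))"

lemma deviation_const_nonneg [simp]: "0 \<le> deviation_const s p n k"
  by (simp add: deviation_const_def)

section \<open>Dyadic means of a function with finite p-th moment\<close>

context
  fixes s p :: real and u :: "'a::euclidean_space \<Rightarrow> real"
  assumes p: "1 < p" and s: "0 < s"
    and u [measurable]: "u \<in> borel_measurable borel"
    and up: "(\<integral>\<^sup>+x. ennreal (\<bar>u x\<bar> powr p) \<partial>lborel) < top"
begin

lemma abs_dyadic_mean_powr_le:
  "ennreal (\<bar>dyadic_mean k u x - c\<bar> powr p)
    \<le> ennreal (2 powr (real k * DIM('a))) *
      (\<integral>\<^sup>+y. indicator (dyadic_cell k x) y * ennreal (\<bar>u y - c\<bar> powr p) \<partial>lborel)"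
proof -
  have "integrable lborel (\<lambda>y. indicator (dyadic_cell k x) y * u y)"
    using p up by (intro integrable_indicator_mult[of p]) (auto simp: emeasure_dyadic_cell)
  moreover have "1 / 2 powr - (real k * DIM('a)) = 2 powr (real k * DIM('a))"
    by (simp add: powr_minus_divide)
  ultimately show ?thesis
    using abs_mean_powr_le[OF p _ _ emeasure_dyadic_cell _ , of u k x c]
    unfolding dyadic_mean_def by (simp only:) simp
qed

text \<open>Jensen's inequality bounds the deviation by the average of |u y - u x|^p over the cell.
  There the distance is at most the diameter, so the kernel can be inserted at the price of a
  constant.\<close>

lemma abs_diff_dyadic_mean_powr_le:
  "ennreal (\<bar>u x - dyadic_mean k u x\<bar> powr p)
    \<le> ennreal (deviation_const s p DIM('a) k) * (\<integral>\<^sup>+y. ennreal (gagliardo_quotient s p u x y) \<partial>lborel)"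
proof -
  let ?n = "real DIM('a)" and ?Q = "gagliardo_quotient s p u x"
  define b where "b = (?n / 2 ^ k) powr (?n + s * p)"
  have b: "0 \<le> b" by (simp add: b_def)
  have cell: "\<bar>u y - u x\<bar> powr p \<le> b * ?Q y" if "y \<in> dyadic_cell k x" for y
  proof (cases "x = y")
    case False
    have "norm (x - y) powr (?n + s * p) \<le> b"
      unfolding b_def using norm_diff_dyadic_cell[OF that] p s by (intro powr_mono2) auto
    then have "norm (x - y) powr (?n + s * p) * ?Q y \<le> b * ?Q y" by (intro mult_right_mono) auto
    then show ?thesis using False by (simp add: gagliardo_quotient_def abs_minus_commute)
  qed (use p in \<open>simp add: gagliardo_quotient_def\<close>)
  have "ennreal (\<bar>u x - dyadic_mean k u x\<bar> powr p) \<le> ennreal (2 powr (real k * ?n)) *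
      (\<integral>\<^sup>+y. indicator (dyadic_cell k x) y * ennreal (\<bar>u y - u x\<bar> powr p) \<partial>lborel)"
    using abs_dyadic_mean_powr_le[of k x "u x"] by (simp add: abs_minus_commute)
  also have "\<dots> \<le> ennreal (2 powr (real k * ?n)) * (\<integral>\<^sup>+y. ennreal b * ennreal (?Q y) \<partial>lborel)"
    using cell b
    by (intro mult_left_mono nn_integral_mono) (auto simp: indicator_def ennreal_mult'[symmetric] intro!: ennreal_leI)
  also have "\<dots> = ennreal (2 powr (real k * ?n) * b) * (\<integral>\<^sup>+y. ennreal (?Q y) \<partial>lborel)"
    using b by (simp add: nn_integral_cmult ennreal_mult' mult.assoc)
  also have "2 powr (real k * ?n) * b = deviation_const s p DIM('a) k"
    by (simp add: b_def deviation_const_def powr_divide powr_realpow[symmetric] powr_powr powr_add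
        distrib_left powr_minus field_simps)
  finally show ?thesis .
qed

lemma nn_integral_diff_dyadic_mean_le:
  "(\<integral>\<^sup>+x. ennreal (\<bar>u x - dyadic_mean k u x\<bar> powr p) \<partial>lborel)
    \<le> ennreal (deviation_const s p DIM('a) k) * energy s p u"
proof -
  have "(\<integral>\<^sup>+x. ennreal (\<bar>u x - dyadic_mean k u x\<bar> powr p) \<partial>lborel) \<le>
    (\<integral>\<^sup>+x. ennreal (deviation_const s p DIM('a) k) *
       (\<integral>\<^sup>+y. ennreal (gagliardo_quotient s p u x y) \<partial>lborel) \<partial>lborel)"
    by (intro nn_integral_mono abs_diff_dyadic_mean_powr_le)
  then show ?thesis by (simp add: nn_integral_cmult energy_eq_quotient)
qed

text \<open>From level k to k + 1 the mean moves by at most d 2^(\<beta> k): Jensen's inequality on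
  the smaller cell is combined with the L^p deviation at level k. The last condition on
  \<open>c\<close> makes these increments telescope, as c 2^(\<beta> k) + c (2^\<beta> - 1)
  2^(\<beta> k) = c 2^(\<beta> (k + 1)).\<close>

lemma abs_dyadic_mean_le:
  assumes P: "(\<integral>\<^sup>+x. ennreal (\<bar>u x\<bar> powr p) \<partial>lborel) \<le> ennreal (c powr p)"
    and M: "energy s p u \<le> ennreal M" "0 \<le> M"
    and \<beta>: "0 < \<beta>" "real DIM('a) - s * p \<le> \<beta> * p"
    and c: "0 \<le> c" "(2 powr DIM('a) * deviation_const s p DIM('a) 0 * M) powr (1 / p) \<le> c * (2 powr \<beta> - 1)"
  shows "\<bar>dyadic_mean k u x\<bar> \<le> c * 2 powr (\<beta> * k)"
proof (induction k)
  case 0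
  have "ennreal (\<bar>dyadic_mean 0 u x\<bar> powr p)
      \<le> (\<integral>\<^sup>+y. indicator (dyadic_cell 0 x) y * ennreal (\<bar>u y\<bar> powr p) \<partial>lborel)"
    using abs_dyadic_mean_powr_le[of 0 x 0] by simp
  also have "\<dots> \<le> (\<integral>\<^sup>+y. ennreal (\<bar>u y\<bar> powr p) \<partial>lborel)"
    by (intro nn_integral_mono) (auto simp: indicator_def)
  also note P
  finally have "\<bar>dyadic_mean 0 u x\<bar> \<le> c"
    by (rule abs_powr_le_imp_le[rotated]) (use p c(1) in simp_all)
  then show ?case by simp
next
  case (Suc k)
  let ?n = "real DIM('a)" and ?m = "dyadic_mean k u x"
  \<comment> \<open>The factor 2^n arises because the volume belongs to a cell of level k + 1 and
    the deviation to level k.\<close>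
  define d where "d = (2 powr ?n * deviation_const s p DIM('a) 0 * M) powr (1 / p)"
  have dp: "d powr p = 2 powr ?n * deviation_const s p DIM('a) 0 * M"
    using M p by (simp add: d_def powr_powr)
  have "ennreal (\<bar>dyadic_mean (Suc k) u x - ?m\<bar> powr p)
    \<le> ennreal (2 powr (real (Suc k) * ?n)) *
      (\<integral>\<^sup>+y. indicator (dyadic_cell (Suc k) x) y * ennreal (\<bar>u y - ?m\<bar> powr p) \<partial>lborel)"
    by (rule abs_dyadic_mean_powr_le)
  also have "\<dots> \<le> ennreal (2 powr (real (Suc k) * ?n)) *
      (\<integral>\<^sup>+y. ennreal (\<bar>u y - dyadic_mean k u y\<bar> powr p) \<partial>lborel)"
  proof (intro mult_left_mono nn_integral_mono)
    show "indicator (dyadic_cell (Suc k) x) y * ennreal (\<bar>u y - ?m\<bar> powr p)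
      \<le> ennreal (\<bar>u y - dyadic_mean k u y\<bar> powr p)" for y
    proof (cases "y \<in> dyadic_cell (Suc k) x")
      case True
      then have "dyadic_mean k u y = ?m"
        using dyadic_cell_Suc_subset by (intro dyadic_mean_eq) blast
      then show ?thesis by (simp add: indicator_def)
    qed simp
  qed simp
  also have "\<dots> \<le> ennreal (2 powr (real (Suc k) * ?n)) * (ennreal (deviation_const s p DIM('a) k) * ennreal M)"
    by (intro mult_left_mono order.trans[OF nn_integral_diff_dyadic_mean_le] M) auto
  also have "\<dots> = ennreal (d powr p * 2 powr (real k * (?n - s * p)))"
    using M by (simp add: dp ennreal_mult'[symmetric] deviation_const_def powr_add[symmetric] algebra_simps)
  also have "\<dots> \<le> ennreal (d powr p * 2 powr (real k * (\<beta> * p)))"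
    using \<beta> by (intro ennreal_leI mult_left_mono powr_mono) auto
  also have "\<dots> = ennreal ((d * 2 powr (\<beta> * k)) powr p)"
    by (simp add: powr_mult powr_powr d_def mult_ac)
  finally have "\<bar>dyadic_mean (Suc k) u x - ?m\<bar> \<le> d * 2 powr (\<beta> * k)"
    by (rule abs_powr_le_imp_le[rotated]) (use p in \<open>simp_all add: d_def\<close>)
  also have "\<dots> \<le> c * (2 powr \<beta> - 1) * 2 powr (\<beta> * k)"
    using c(2) by (intro mult_right_mono) (auto simp: d_def)
  finally have "\<bar>dyadic_mean (Suc k) u x\<bar> \<le> c * 2 powr (\<beta> * k) + c * (2 powr \<beta> - 1) * 2 powr (\<beta> * k)"
    using Suc.IH by linarith
  also have "\<dots> = c * 2 powr (\<beta> * Suc k)" by (simp add: powr_add algebra_simps)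
  finally show ?case .
qed

end

section \<open>Subcritical integrability\<close>

text \<open>\<beta> must be at least (n - s p)/p to bound the means and, for q > p, below s p/(q -
  p) to make the tails decay. When s p < n, these two demands are compatible exactly if q is below
  the critical exponent; for q \<le> p the second one holds for every positive \<beta>.\<close>

lemma subcritical_rate:
  fixes s p q :: real and n :: nat
  assumes p: "1 < p" and s: "0 < s" and q: "ereal q < critical_exponent n s p"
  obtains \<beta> where "0 < \<beta>" "real n - s * p \<le> \<beta> * p" "\<beta> * (q - p) < s * p"
proof (cases "q \<le> p")
  case True
  show ?thesis
  proof (rule that[of "max 1 ((real n - s * p) / p)"])
    show "real n - s * p \<le> max 1 ((real n - s * p) / p) * p"
      using p by (simp add: max_mult_distrib_right)
    have "max 1 ((real n - s * p) / p) * (q - p) \<le> 0"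
      using True by (intro mult_nonneg_nonpos) auto
    also have "0 < s * p" using p s by simp
    finally show "max 1 ((real n - s * p) / p) * (q - p) < s * p" .
  qed simp
next
  case False
  define L where "L = max 0 ((real n - s * p) / p)"
  define U where "U = s * p / (q - p)"
  have U: "0 < U" using False p s by (simp add: U_def)
  have "(real n - s * p) / p < U"
  proof (cases "s * p < real n")
    case True
    then have "q < real n * p / (real n - s * p)" using q by (simp add: critical_exponent_def)
    then have "q * (real n - s * p) < real n * p" using True by (simp add: pos_less_divide_eq)
    then have "(real n - s * p) * (q - p) < s * p * p" by (simp add: algebra_simps)
    then show ?thesis using \<open>\<not> q \<le> p\<close> p by (simp add: U_def field_simps)
  next
    case False
    then have "(real n - s * p) / p \<le> 0" using p by (simp add: divide_nonpos_pos)
    then show ?thesis using U by linarith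
  qed
  then have LU: "L < U" using U by (simp add: L_def)
  have L: "0 \<le> L" "(real n - s * p) / p \<le> L" by (auto simp: L_def)
  show ?thesis
  \<comment> \<open>The midpoint stays positive even when the lower bound \<open>L\<close> is 0, and
    strictly below \<open>U\<close>.\<close>
  proof (rule that[of "(L + U) / 2"])
    show "0 < (L + U) / 2" using L(1) LU by (simp add: add_nonneg_pos)
    have "L \<le> (L + U) / 2" using LU by simp
    with L(2) have "(real n - s * p) / p \<le> (L + U) / 2" by (rule order.trans)
    then show "real n - s * p \<le> (L + U) / 2 * p" using p by (simp add: pos_divide_le_eq)
    have "(L + U) / 2 < U" using LU by simp
    then show "(L + U) / 2 * (q - p) < s * p" using False by (simp add: U_def pos_less_divide_eq)
  qed
qed

text \<open>On \<open>{t\<^sub>j < \<bar>u\<bar> \<le> t\<^sub>j\<^sub>+\<^sub>1}\<close> with \<open>t\<^sub>j = 2 c 2\<^bsup>\<beta>j\<^esup>\<close> the dyadic mean at scale \<open>j\<close> is at most \<open>\<bar>u\<bar> / 2\<close>,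
  so there \<open>\<bar>u\<bar>\<^sup>q\<close> is controlled by the deviation from that mean, whose integral decays geometrically.\<close>

lemma uniform_tail_decay:
  fixes s p q c M :: real
  assumes p: "1 < p" and s: "0 < s" and q: "0 \<le> q"
    and M: "0 \<le> M" and c: "0 < c"
    and \<beta>: "0 < \<beta>" "real DIM('a) - s * p \<le> \<beta> * p" "\<beta> * (q - p) < s * p"
    and cM: "(2 powr DIM('a) * deviation_const s p DIM('a) 0 * M) powr (1 / p) \<le> c * (2 powr \<beta> - 1)"
  obtains K r where "0 \<le> K" "0 < r" "r < 1"
    and "\<And>u k. u \<in> borel_measurable borel \<Longrightarrow>
      (\<integral>\<^sup>+x. ennreal (\<bar>u (x::'a::euclidean_space)\<bar> powr p) \<partial>lborel) \<le> ennreal (c powr p) \<Longrightarrow>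
      energy s p u \<le> ennreal M \<Longrightarrow>
      (\<integral>\<^sup>+x. ennreal (\<bar>u x\<bar> powr q) * indicator {x. 2 * c * 2 powr (\<beta> * k) < \<bar>u x\<bar>} x \<partial>lborel)
        \<le> ennreal (K * r ^ k)"
proof -
  define t where "t j = 2 * c * 2 powr (\<beta> * real j)" for j :: nat
  \<comment> \<open>An upper bound for |u|^q on layer j, divided by the p-th power of the least
    deviation from the mean there: the deviation weighted by \<open>a j\<close> dominates
    |u|^q.\<close>
  define a where "a j = (t (Suc j)) powr q / (c * 2 powr (\<beta> * real j)) powr p" for j :: nat
  \<comment> \<open>The weight \<open>a j\<close> grows like 2^(\<beta> j (q - p)), and the integral
    of the deviation decays like 2^(-j s p).\<close>
  define r where "r = 2 powr (- (s * p - \<beta> * (q - p)))"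
  define K where "K = (2 * c * 2 powr \<beta>) powr q / c powr p * deviation_const s p DIM('a) 0 * M"
  have r: "0 < r" "r < 1" using \<beta>(3) by (auto simp: r_def powr_less_one)
  have K: "0 \<le> K" using M by (simp add: K_def)
  have a: "0 \<le> a j" for j by (simp add: a_def)
  have aK: "a j * deviation_const s p DIM('a) j * M = K * r ^ j" for j
  proof -
    have "t (Suc j) = (2 * c * 2 powr \<beta>) * 2 powr (\<beta> * j)"
      by (simp add: t_def powr_add distrib_left mult_ac)
    then have "t (Suc j) powr q = (2 * c * 2 powr \<beta>) powr q * 2 powr (\<beta> * j * q)"
      using c by (simp add: powr_mult powr_powr)
    moreover have "(c * 2 powr (\<beta> * real j)) powr p = c powr p * 2 powr (\<beta> * j * p)"
      using c by (simp add: powr_mult powr_powr)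
    moreover have "r ^ j = 2 powr (\<beta> * j * q) / 2 powr (\<beta> * j * p) * 2 powr - (real j * (s * p))"
      unfolding r_def
      by (simp add: powr_realpow[symmetric] powr_powr powr_diff[symmetric] powr_add[symmetric] algebra_simps)
    moreover have "deviation_const s p DIM('a) j = deviation_const s p DIM('a) 0 * 2 powr - (real j * (s * p))"
      by (simp add: deviation_const_def)
    ultimately show ?thesis by (simp add: a_def K_def)
  qed
  have t_mono: "t i \<le> t j" if "i \<le> j" for i j
    using that \<beta>(1) c by (auto simp: t_def)
  show ?thesis
  proof (rule that[of "K / (1 - r)" r])
    show "0 \<le> K / (1 - r)" using K r by simp
    fix u :: "'a \<Rightarrow> real" and k :: nat
    assume u [measurable]: "u \<in> borel_measurable borel"
      and up: "(\<integral>\<^sup>+x. ennreal (\<bar>u x\<bar> powr p) \<partial>lborel) \<le> ennreal (c powr p)"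
      and uM: "energy s p u \<le> ennreal M"
    have fin: "(\<integral>\<^sup>+x. ennreal (\<bar>u x\<bar> powr p) \<partial>lborel) < top"
      using up by (rule order.strict_trans1) simp
    have mean: "\<bar>dyadic_mean j u x\<bar> \<le> c * 2 powr (\<beta> * j)" for j x
      by (rule abs_dyadic_mean_le[OF p s u fin up uM M \<beta>(1,2) _ cM]) (use c in simp)
    let ?g = "\<lambda>j x. ennreal (a j * \<bar>u x - dyadic_mean j u x\<bar> powr p)"
    have pt: "ennreal (\<bar>u x\<bar> powr q) * indicator {x. t k < \<bar>u x\<bar>} x \<le> (\<Sum>i. ?g (k + i) x)" for x
    proof (cases "t k < \<bar>u x\<bar>")
      case True
      obtain m where "\<bar>u x\<bar> / (2 * c) < (2 powr \<beta>) ^ m"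
        using real_arch_pow[of "2 powr \<beta>"] \<beta>(1) by auto
      then have "\<bar>u x\<bar> \<le> t m"
        using c by (simp add: t_def field_simps powr_realpow[symmetric] powr_powr)
      \<comment> \<open>The least threshold that reaches |u x| locates its layer j = n - 1. As
        \<open>t k\<close> is already exceeded, j \<ge> k, and the layer occurs in the
        series.\<close>
      define n where "n = (LEAST n. \<bar>u x\<bar> \<le> t n)"
      have n: "\<bar>u x\<bar> \<le> t n" unfolding n_def by (rule LeastI[of _ m]) fact
      have "k < n" using n True t_mono[of n k] by (cases "k < n") auto
      then obtain i where i: "n = Suc (k + i)" using less_imp_Suc_add by blast
      let ?j = "k + i"
      have "t ?j < \<bar>u x\<bar>" using not_less_Least[of ?j "\<lambda>n. \<bar>u x\<bar> \<le> t n"] i by (auto simp: n_def)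
      then have "c * 2 powr (\<beta> * ?j) \<le> \<bar>u x - dyadic_mean ?j u x\<bar>"
        using mean[of ?j x] by (simp add: t_def)
      then have low: "(c * 2 powr (\<beta> * ?j)) powr p \<le> \<bar>u x - dyadic_mean ?j u x\<bar> powr p"
        using c p by (intro powr_mono2) auto
      have "\<bar>u x\<bar> powr q \<le> t (Suc ?j) powr q" using n i q by (intro powr_mono2) auto
      also have "\<dots> = a ?j * (c * 2 powr (\<beta> * ?j)) powr p" using c by (simp add: a_def)
      also have "\<dots> \<le> a ?j * \<bar>u x - dyadic_mean ?j u x\<bar> powr p" using low a by (intro mult_left_mono)
      finally have "ennreal (\<bar>u x\<bar> powr q) \<le> ?g ?j x" by (rule ennreal_leI)
      also have "\<dots> = (\<Sum>i'\<in>{i}. ?g (k + i') x)" by simp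
      also have "\<dots> \<le> (\<Sum>i. ?g (k + i) x)" by (intro sum_le_suminf) auto
      finally show ?thesis using True by simp
    qed simp
    have "(\<integral>\<^sup>+x. ennreal (\<bar>u x\<bar> powr q) * indicator {x. t k < \<bar>u x\<bar>} x \<partial>lborel)
        \<le> (\<integral>\<^sup>+x. (\<Sum>i. ?g (k + i) x) \<partial>lborel)"
      by (intro nn_integral_mono pt)
    also have "\<dots> = (\<Sum>i. \<integral>\<^sup>+x. ?g (k + i) x \<partial>lborel)"
      by (rule nn_integral_suminf) measurable
    also have "\<dots> \<le> (\<Sum>i. ennreal (K * r ^ (k + i)))"
    proof (rule suminf_le)
      fix i
      have "(\<integral>\<^sup>+x. ?g (k + i) x \<partial>lborel) =
          ennreal (a (k + i)) * (\<integral>\<^sup>+x. ennreal (\<bar>u x - dyadic_mean (k + i) u x\<bar> powr p) \<partial>lborel)"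
        using a by (simp add: ennreal_mult' nn_integral_cmult)
      also have "\<dots> \<le> ennreal (a (k + i)) * (ennreal (deviation_const s p DIM('a) (k + i)) * ennreal M)"
        using uM by (intro mult_left_mono order.trans[OF nn_integral_diff_dyadic_mean_le[OF p s u fin]]) auto
      also have "\<dots> = ennreal (K * r ^ (k + i))"
        unfolding aK[symmetric] using a M by (simp add: ennreal_mult'[symmetric] mult_ac)
      finally show "(\<integral>\<^sup>+x. ?g (k + i) x \<partial>lborel) \<le> ennreal (K * r ^ (k + i))" .
    qed auto
    also have "\<dots> = ennreal (\<Sum>i. K * r ^ (k + i))"
      using r K by (intro suminf_ennreal2) (auto simp: power_add intro!: summable_mult summable_geometric)
    also have "(\<Sum>i. K * r ^ (k + i)) = K / (1 - r) * r ^ k"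
      using r by (simp add: power_add suminf_mult suminf_geometric summable_geometric mult.assoc[symmetric])
    finally show "(\<integral>\<^sup>+x. ennreal (\<bar>u x\<bar> powr q) * indicator {x. 2 * c * 2 powr (\<beta> * k) < \<bar>u x\<bar>} x \<partial>lborel)
        \<le> ennreal (K / (1 - r) * r ^ k)" by (simp add: t_def)
  qed (use r in auto)
qed

text \<open>Uniform integrability of |u|^q on families with bounded energy: \<open>T\<close> depends
  on the bounds only. This keeps the q-norm of a minimizing sequence from concentrating.\<close>

lemma uniform_tail:
  fixes s p q P M \<epsilon> :: real
  assumes p: "1 < p" and s: "0 < s" and q: "0 \<le> q" "ereal q < critical_exponent DIM('a) s p"
    and M: "0 \<le> M" and \<epsilon>: "0 < \<epsilon>"
  obtains T where "0 \<le> T"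
    and "\<And>u. u \<in> borel_measurable borel \<Longrightarrow>
      (\<integral>\<^sup>+x. ennreal (\<bar>u (x::'a::euclidean_space)\<bar> powr p) \<partial>lborel) \<le> ennreal P \<Longrightarrow>
      energy s p u \<le> ennreal M \<Longrightarrow>
      (\<integral>\<^sup>+x. ennreal (\<bar>u x\<bar> powr q) * indicator {x. T < \<bar>u x\<bar>} x \<partial>lborel) \<le> ennreal \<epsilon>"
proof -
  obtain \<beta> where \<beta>: "0 < \<beta>" "real DIM('a) - s * p \<le> \<beta> * p" "\<beta> * (q - p) < s * p"
    using subcritical_rate[OF p s q(2)] by metis
  define d where "d = (2 powr DIM('a) * deviation_const s p DIM('a) 0 * M) powr (1 / p)"
  have d: "0 \<le> d" by (simp add: d_def)
  have b: "0 < 2 powr \<beta> - 1" using \<beta>(1) by simp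
  \<comment> \<open>The first summand dominates the L^p norm (with a maximum, as no sign of
    \<open>P\<close> is assumed), the second makes the increments of the means telescope, and 1
    keeps \<open>c\<close> positive.\<close>
  define c where "c = max 0 P powr (1 / p) + d / (2 powr \<beta> - 1) + 1"
  have c: "0 < c" using d b by (simp add: c_def add_nonneg_pos)
  have "P \<le> (max 0 P powr (1 / p)) powr p" using p by (simp add: powr_powr)
  also have "\<dots> \<le> c powr p" using d b p by (intro powr_mono2) (auto simp: c_def)
  finally have P: "ennreal P \<le> ennreal (c powr p)" by (rule ennreal_leI)
  have "d = d / (2 powr \<beta> - 1) * (2 powr \<beta> - 1)" using b \<beta>(1) by simp
  also have "\<dots> \<le> c * (2 powr \<beta> - 1)" using b by (intro mult_right_mono) (auto simp: c_def)
  finally have "d \<le> c * (2 powr \<beta> - 1)" .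
  then obtain K r where K: "0 \<le> K" "0 < r" "r < 1"
    and tail: "\<And>u k. u \<in> borel_measurable borel \<Longrightarrow>
      (\<integral>\<^sup>+x. ennreal (\<bar>u (x::'a)\<bar> powr p) \<partial>lborel) \<le> ennreal (c powr p) \<Longrightarrow>
      energy s p u \<le> ennreal M \<Longrightarrow>
      (\<integral>\<^sup>+x. ennreal (\<bar>u x\<bar> powr q) * indicator {x. 2 * c * 2 powr (\<beta> * real k) < \<bar>u x\<bar>} x \<partial>lborel)
        \<le> ennreal (K * r ^ k)"
    using uniform_tail_decay[OF p s q(1) M c \<beta>] unfolding d_def by blast
  have "(\<lambda>k. K * r ^ k) \<longlonglongrightarrow> K * 0"
    using K by (intro tendsto_mult_left LIMSEQ_power_zero) auto
  then have "\<forall>\<^sub>F k in sequentially. K * r ^ k < \<epsilon>" using \<epsilon> by (intro order_tendstoD(2)) auto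
  then obtain k where k: "K * r ^ k < \<epsilon>" by (auto simp: eventually_sequentially)
  show ?thesis
  proof (rule that[of "2 * c * 2 powr (\<beta> * real k)"])
    fix u :: "'a \<Rightarrow> real"
    assume "u \<in> borel_measurable borel" "(\<integral>\<^sup>+x. ennreal (\<bar>u x\<bar> powr p) \<partial>lborel) \<le> ennreal P"
      "energy s p u \<le> ennreal M"
    then have "(\<integral>\<^sup>+x. ennreal (\<bar>u x\<bar> powr q) * indicator {x. 2 * c * 2 powr (\<beta> * real k) < \<bar>u x\<bar>} x \<partial>lborel)
      \<le> ennreal (K * r ^ k)"
      using P by (intro tail) (auto intro: order.trans)
    also have "\<dots> \<le> ennreal \<epsilon>" using k by (intro ennreal_leI) simp
    finally show "(\<integral>\<^sup>+x. ennreal (\<bar>u x\<bar> powr q) * indicator {x. 2 * c * 2 powr (\<beta> * real k) < \<bar>u x\<bar>} x \<partial>lborel)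
      \<le> ennreal \<epsilon>" .
  qed (use c in simp)
qed

text \<open>All functions considered vanish on a ball placed outside \<open>\<Omega>\<close> at
  bounded distance, so the interaction of x with that ball alone already controls |u x|^p.\<close>

lemma nn_integral_powr_le_energy:
  fixes \<Omega> :: "'a::euclidean_space set" and s p :: real
  assumes p: "1 < p" and s: "0 < s" and \<Omega>: "bounded \<Omega>"
  obtains C where "0 \<le> C"
    and "\<And>u. u \<in> borel_measurable borel \<Longrightarrow> (\<And>x. x \<notin> \<Omega> \<Longrightarrow> u x = 0) \<Longrightarrow>
      (\<integral>\<^sup>+x. ennreal (\<bar>u x\<bar> powr p) \<partial>lborel) \<le> ennreal C * energy s p u"
proof -
  obtain R where R: "0 < R" "\<Omega> \<subseteq> ball 0 R" using bounded_subset_ballD[OF \<Omega>, of 0] by auto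
  \<comment> \<open>The unit ball about a point of norm R + 1 misses \<open>ball 0 R\<close>, and
    its points are within R + (R + 1) + 1 of every point of \<open>\<Omega>\<close>; this sum is
    \<open>L\<close> below.\<close>
  obtain b :: 'a where b: "norm b = R + 1" using vector_choose_size[of "R + 1"] R by auto
  let ?A = "ball b 1" and ?\<gamma> = "real DIM('a) + s * p"
  have far: "y \<notin> \<Omega>" if "y \<in> ?A" for y
  proof
    assume "y \<in> \<Omega>"
    then have "norm y < R" using R by auto
    then show False using that b norm_triangle_ineq2[of b y] by (simp add: dist_norm)
  qed
  define L where "L = 2 * R + 2"
  have near: "norm (x - y) \<le> L" if "x \<in> \<Omega>" "y \<in> ?A" for x y
  proof -
    have "norm x < R" "norm (b - y) < 1" using that R by (auto simp: dist_norm)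
    moreover have "norm (x - y) \<le> norm x + norm b + norm (b - y)"
      using norm_triangle_ineq4[of x b] norm_triangle_ineq[of "x - b" "b - y"] by simp
    ultimately show ?thesis using b by (simp add: L_def)
  qed
  define m where "m = measure lborel ?A"
  have "emeasure lborel ?A = ennreal m"
    unfolding m_def using emeasure_lborel_ball_finite[of b 1] by (intro emeasure_eq_ennreal_measure) auto
  moreover have "0 < m" by (simp add: m_def content_ball)
  ultimately have m: "emeasure lborel ?A = ennreal m" "0 < m" .
  show ?thesis
  proof (rule that[of "L powr ?\<gamma> / m"])
    show "0 \<le> L powr ?\<gamma> / m" using m by simp
    fix u :: "'a \<Rightarrow> real" assume [measurable]: "u \<in> borel_measurable borel"
      and z: "\<And>x. x \<notin> \<Omega> \<Longrightarrow> u x = 0"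
    have pt: "ennreal (\<bar>u x\<bar> powr p)
      \<le> ennreal (L powr ?\<gamma> / m) * (\<integral>\<^sup>+y. ennreal (gagliardo_quotient s p u x y) \<partial>lborel)" for x
    proof (cases "x \<in> \<Omega>")
      case True
      have q: "\<bar>u x\<bar> powr p \<le> L powr ?\<gamma> * gagliardo_quotient s p u x y" if "y \<in> ?A" for y
      proof -
        have "x \<noteq> y" using True far that by auto
        then have pos: "0 < norm (x - y) powr ?\<gamma>" by simp
        have "norm (x - y) powr ?\<gamma> \<le> L powr ?\<gamma>"
          using near[OF True that] p s by (intro powr_mono2) auto
        then have "\<bar>u x\<bar> powr p * norm (x - y) powr ?\<gamma> \<le> \<bar>u x\<bar> powr p * L powr ?\<gamma>"
          by (intro mult_left_mono) auto
        then show ?thesis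
          using pos z[OF far[OF that]] by (simp add: gagliardo_quotient_def field_simps)
      qed
      have "ennreal (\<bar>u x\<bar> powr p) = ennreal (1 / m) * (ennreal (\<bar>u x\<bar> powr p) * emeasure lborel ?A)"
        using m by (simp add: ennreal_mult'[symmetric])
      also have "\<dots> = ennreal (1 / m) * (\<integral>\<^sup>+y. ennreal (\<bar>u x\<bar> powr p) * indicator ?A y \<partial>lborel)"
        by (subst nn_integral_cmult_indicator) auto
      also have "\<dots> \<le> ennreal (1 / m) * (\<integral>\<^sup>+y. ennreal (L powr ?\<gamma>) * ennreal (gagliardo_quotient s p u x y) \<partial>lborel)"
        using q by (intro mult_left_mono nn_integral_mono)
          (auto simp: indicator_def ennreal_mult'[symmetric] simp del: mem_ball intro!: ennreal_leI)
      also have "\<dots> = ennreal (L powr ?\<gamma> / m) * (\<integral>\<^sup>+y. ennreal (gagliardo_quotient s p u x y) \<partial>lborel)"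
        using m by (subst nn_integral_cmult) (auto simp: mult.assoc[symmetric] ennreal_mult'[symmetric])
      finally show ?thesis .
    qed (use z p in simp)
    have "(\<integral>\<^sup>+x. ennreal (\<bar>u x\<bar> powr p) \<partial>lborel) \<le>
      (\<integral>\<^sup>+x. ennreal (L powr ?\<gamma> / m) * (\<integral>\<^sup>+y. ennreal (gagliardo_quotient s p u x y) \<partial>lborel) \<partial>lborel)"
      by (intro nn_integral_mono pt)
    then show "(\<integral>\<^sup>+x. ennreal (\<bar>u x\<bar> powr p) \<partial>lborel) \<le> ennreal (L powr ?\<gamma> / m) * energy s p u"
      by (simp add: nn_integral_cmult energy_eq_quotient)
  qed
qed

section \<open>Compactness\<close>

text \<open>The Riesz-Fischer argument: along a subsequence whose increments have L^1 norm at most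
  2^-j, the series of increments converges absolutely almost everywhere.\<close>

lemma L1_Cauchy_AE_convergent_subseq:
  fixes w :: "nat \<Rightarrow> 'a \<Rightarrow> real"
  assumes [measurable]: "\<And>n. w n \<in> borel_measurable M"
    and Cauchy: "\<And>e. 0 < e \<Longrightarrow> \<exists>N. \<forall>m\<ge>N. \<forall>n\<ge>N. (\<integral>\<^sup>+x. ennreal \<bar>w m x - w n x\<bar> \<partial>M) \<le> ennreal e"
  obtains r where "strict_mono r" "AE x in M. convergent (\<lambda>n. w (r n) x)"
proof -
  have "\<exists>N. \<forall>j. \<forall>m\<ge>N j. \<forall>n\<ge>N j. (\<integral>\<^sup>+x. ennreal \<bar>w m x - w n x\<bar> \<partial>M) \<le> ennreal ((1 / 2) ^ j)"
    by (rule choice) (use Cauchy in simp)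
  then obtain N where N: "\<And>j m n. N j \<le> m \<Longrightarrow> N j \<le> n \<Longrightarrow>
      (\<integral>\<^sup>+x. ennreal \<bar>w m x - w n x\<bar> \<partial>M) \<le> ennreal ((1 / 2) ^ j)"
    by blast
  \<comment> \<open>Adding \<open>j\<close> and summing all \<open>N i\<close> up to
    \<open>j\<close> makes \<open>r\<close> strictly increasing and keeps it above
    \<open>N j\<close>.\<close>
  define r where "r j = j + (\<Sum>i\<le>j. N i)" for j
  have r: "strict_mono r" by (rule strict_mono_Suc_iff[THEN iffD2]) (simp add: r_def)
  have Nr: "N j \<le> r j" for j
  proof -
    have "N j \<le> (\<Sum>i\<le>j. N i)" by (rule member_le_sum) auto
    then show ?thesis by (simp add: r_def)
  qed
  have "(\<integral>\<^sup>+x. (\<Sum>j. ennreal \<bar>w (r (Suc j)) x - w (r j) x\<bar>) \<partial>M)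
      = (\<Sum>j. \<integral>\<^sup>+x. ennreal \<bar>w (r (Suc j)) x - w (r j) x\<bar> \<partial>M)"
    by (rule nn_integral_suminf) measurable
  also have "\<dots> \<le> (\<Sum>j. ennreal ((1 / 2) ^ j))"
  proof (rule suminf_le)
    fix j
    have "r j \<le> r (Suc j)" using r by (simp add: strict_mono_less_eq)
    then show "(\<integral>\<^sup>+x. ennreal \<bar>w (r (Suc j)) x - w (r j) x\<bar> \<partial>M) \<le> ennreal ((1 / 2) ^ j)"
      using Nr[of j] by (intro N) auto
  qed auto
  also have "\<dots> = ennreal (\<Sum>j. (1 / 2) ^ j)"
    by (rule suminf_ennreal2) (auto intro: summable_geometric)
  finally have "(\<integral>\<^sup>+x. (\<Sum>j. ennreal \<bar>w (r (Suc j)) x - w (r j) x\<bar>) \<partial>M) \<noteq> \<infinity>"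
    by (auto simp: top_unique)
  then have "AE x in M. (\<Sum>j. ennreal \<bar>w (r (Suc j)) x - w (r j) x\<bar>) \<noteq> \<infinity>"
    by (intro nn_integral_noteq_infinite) auto
  then have "AE x in M. convergent (\<lambda>n. w (r n) x)"
  proof eventually_elim
    case (elim x)
    have "summable (\<lambda>j. \<bar>w (r (Suc j)) x - w (r j) x\<bar>)"
      using elim by (intro summable_suminf_not_top) auto
    then have "summable (\<lambda>j. w (r (Suc j)) x - w (r j) x)" by (rule summable_rabs_cancel)
    from summable_LIMSEQ[OF this]
    have "(\<lambda>n. w (r n) x - w (r 0) x) \<longlonglongrightarrow> (\<Sum>j. w (r (Suc j)) x - w (r j) x)"
      unfolding sum_lessThan_telescope[of "\<lambda>j. w (r j) x"] .
    from tendsto_add[OF this tendsto_const[of "w (r 0) x"]] show ?case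
      by (intro convergentI) simp
  qed
  with r show ?thesis by (rule that)
qed

text \<open>A diagonal argument over the countably many pairs of a level and a point of a dense set.
  Every cell has interior and so contains such a point, and means are constant on cells, so
  convergence spreads to all x.\<close>

lemma dyadic_means_convergent_subseq:
  fixes u :: "nat \<Rightarrow> 'a::euclidean_space \<Rightarrow> real"
  assumes B: "\<And>k n x. \<bar>dyadic_mean k (u n) x\<bar> \<le> B k"
  obtains r where "strict_mono r" "\<And>k x. convergent (\<lambda>n. dyadic_mean k (u (r n)) x)"
proof -
  obtain S :: "'a set" where S: "countable S" "\<And>X. open X \<Longrightarrow> X \<noteq> {} \<Longrightarrow> \<exists>z\<in>S. z \<in> X"
    using countable_dense_setE by metis
  have B0: "0 \<le> B k" for k using B[of k 0 0] by linarith
  \<comment> \<open>Dividing by \<open>B k + 1\<close> turns bounds that depend on the level into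
    the single bound 1 that diagonal extraction requires; adding 1 avoids a division by 0.\<close>
  let ?f = "\<lambda>n (k, z). dyadic_mean k (u n) z / (B k + 1)"
  have cnt: "countable ((UNIV :: nat set) \<times> S)" using S by auto
  have nrm: "norm (?f n x) \<le> 1" for n x
  proof (cases x)
    case (Pair k z)
    have "\<bar>dyadic_mean k (u n) z\<bar> \<le> B k + 1" using B[of k n z] by linarith
    then show ?thesis using B0[of k] by (simp add: Pair abs_divide)
  qed
  obtain r where r: "strict_mono (r::nat\<Rightarrow>nat)"
    and l: "\<And>x. x \<in> (UNIV :: nat set) \<times> S \<Longrightarrow> \<exists>l. (\<lambda>n. ?f (r n) x) \<longlonglongrightarrow> l"
    using function_convergent_subsequence[of "(UNIV :: nat set) \<times> S" ?f 1, OF cnt nrm] by blast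
  show ?thesis
  proof (rule that[OF r])
    fix k and x :: 'a
    obtain a b where lu: "box a b \<subseteq> dyadic_cell k x" and side: "\<And>i. i \<in> Basis \<Longrightarrow> b \<bullet> i - a \<bullet> i = 1 / 2 ^ k"
      using dyadic_cell_box[of k x] by metis
    have "a \<bullet> i < b \<bullet> i" if "i \<in> Basis" for i
    proof -
      have "0 < b \<bullet> i - a \<bullet> i" unfolding side[OF that] by simp
      then show ?thesis by simp
    qed
    then have "box a b \<noteq> {}" by (simp add: box_ne_empty)
    then obtain z where "z \<in> S" "z \<in> box a b" using S(2)[OF open_box] by blast
    then have z: "z \<in> S" "z \<in> dyadic_cell k x" using lu by auto
    obtain c where "(\<lambda>n. ?f (r n) (k, z)) \<longlonglongrightarrow> c" using l[of "(k, z)"] z by auto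
    then have "(\<lambda>n. (B k + 1) * (dyadic_mean k (u (r n)) z / (B k + 1))) \<longlonglongrightarrow> (B k + 1) * c"
      by (intro tendsto_mult_left) simp
    moreover have "B k + 1 \<noteq> 0" using B0[of k] by linarith
    ultimately have "(\<lambda>n. dyadic_mean k (u (r n)) z) \<longlonglongrightarrow> (B k + 1) * c" by simp
    then show "convergent (\<lambda>n. dyadic_mean k (u (r n)) x)"
      unfolding dyadic_mean_eq[OF z(2)] by (rule convergentI)
  qed
qed

text \<open>Splitting at height \<open>\<eta>\<close> stands in for Hoelder's inequality in the
  passage from L^p to L^1 on a bounded set: the first term is small by the choice of
  \<open>\<eta>\<close>, the second through the p-th moment.\<close>

lemma abs_le_add_powr:
  fixes t \<eta> p :: real
  assumes p: "1 < p" and \<eta>: "0 < \<eta>"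
  shows "\<bar>t\<bar> \<le> \<eta> + \<eta> powr (1 - p) * \<bar>t\<bar> powr p"
proof (cases "\<bar>t\<bar> \<le> \<eta>")
  case True
  then show ?thesis by (simp add: add_increasing2)
next
  case False
  then have t: "\<eta> < \<bar>t\<bar>" by simp
  have "\<bar>t\<bar> = \<bar>t\<bar> powr (1 - p) * \<bar>t\<bar> powr p" using t \<eta> by (simp add: powr_add[symmetric])
  also have "\<dots> \<le> \<eta> powr (1 - p) * \<bar>t\<bar> powr p"
    using t \<eta> p by (intro mult_right_mono powr_mono2') auto
  finally show ?thesis using \<eta> by linarith
qed

text \<open>The level \<open>k\<close> is chosen before \<open>u\<close>: this uniform approximation
  by functions constant on cells is what makes families with bounded energy compact.\<close>

lemma L1_deviation_small:
  fixes s p M R e :: real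
  assumes p: "1 < p" and s: "0 < s" and M: "0 \<le> M" and e: "0 < e"
  obtains k where "\<And>u. u \<in> borel_measurable borel \<Longrightarrow>
      (\<integral>\<^sup>+x. ennreal (\<bar>u (x::'a::euclidean_space)\<bar> powr p) \<partial>lborel) < top \<Longrightarrow>
      energy s p u \<le> ennreal M \<Longrightarrow>
      (\<integral>\<^sup>+x\<in>ball 0 R. ennreal \<bar>u x - dyadic_mean k u x\<bar> \<partial>lborel) \<le> ennreal e"
proof -
  have [measurable]: "ball (0::'a) R \<in> sets borel" by simp
  define V where "V = measure lborel (ball (0::'a) R)"
  have V: "emeasure lborel (ball (0::'a) R) = ennreal V" "0 \<le> V"
    unfolding V_def using emeasure_lborel_ball_finite[of "0::'a" R]
    by (auto intro!: emeasure_eq_ennreal_measure)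
  define \<eta> where "\<eta> = e / (2 * (V + 1))"
  have \<eta>: "0 < \<eta>" using e V by (simp add: \<eta>_def)
  have \<eta>V: "\<eta> * V \<le> e / 2" using e V by (simp add: \<eta>_def field_simps)
  define c where "c = \<eta> powr (1 - p) * deviation_const s p DIM('a) 0 * M"
  define r where "r = 2 powr - (s * p)"
  have r: "0 < r" "r < 1" using p s by (auto simp: r_def powr_less_one)
  have dev: "deviation_const s p DIM('a) k = deviation_const s p DIM('a) 0 * r ^ k" for k
    by (simp add: deviation_const_def r_def powr_realpow[symmetric] powr_powr mult_ac)
  have "(\<lambda>k. c * r ^ k) \<longlonglongrightarrow> c * 0"
    using r by (intro tendsto_mult_left LIMSEQ_power_zero) auto
  then have "\<forall>\<^sub>F k in sequentially. c * r ^ k < e / 2" using e by (intro order_tendstoD(2)) auto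
  then obtain k where k: "c * r ^ k < e / 2" by (auto simp: eventually_sequentially)
  show ?thesis
  proof (rule that[of k])
    fix u :: "'a \<Rightarrow> real"
    assume u [measurable]: "u \<in> borel_measurable borel"
      and fin: "(\<integral>\<^sup>+x. ennreal (\<bar>u x\<bar> powr p) \<partial>lborel) < top" and uM: "energy s p u \<le> ennreal M"
    let ?d = "\<lambda>x. \<bar>u x - dyadic_mean k u x\<bar>"
    have "(\<integral>\<^sup>+x\<in>ball 0 R. ennreal (?d x) \<partial>lborel)
      \<le> (\<integral>\<^sup>+x. ennreal \<eta> * indicator (ball 0 R) x + ennreal (\<eta> powr (1 - p)) * ennreal (?d x powr p) \<partial>lborel)"
    proof (rule nn_integral_mono)
      fix x
      have "ennreal (?d x) \<le> ennreal \<eta> + ennreal (\<eta> powr (1 - p)) * ennreal (?d x powr p)"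
        using \<eta> abs_le_add_powr[OF p \<eta>, of "u x - dyadic_mean k u x"]
        by (simp add: ennreal_mult'[symmetric] ennreal_plus[symmetric] ennreal_leI del: ennreal_plus)
      then show "ennreal (?d x) * indicator (ball 0 R) x
        \<le> ennreal \<eta> * indicator (ball 0 R) x + ennreal (\<eta> powr (1 - p)) * ennreal (?d x powr p)"
        by (simp add: indicator_def)
    qed
    also have "\<dots> = ennreal \<eta> * ennreal V + ennreal (\<eta> powr (1 - p)) * (\<integral>\<^sup>+x. ennreal (?d x powr p) \<partial>lborel)"
      using V by (subst nn_integral_add) (auto simp: nn_integral_cmult nn_integral_cmult_indicator)
    also have "\<dots> \<le> ennreal (e / 2) + ennreal (e / 2)"
    proof (rule add_mono)
      show "ennreal \<eta> * ennreal V \<le> ennreal (e / 2)"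
        using \<eta>V \<eta> by (simp add: ennreal_mult'[symmetric] ennreal_leI)
      have "ennreal (\<eta> powr (1 - p)) * (\<integral>\<^sup>+x. ennreal (?d x powr p) \<partial>lborel)
        \<le> ennreal (\<eta> powr (1 - p)) * (ennreal (deviation_const s p DIM('a) k) * ennreal M)"
        using uM by (intro mult_left_mono order.trans[OF nn_integral_diff_dyadic_mean_le[OF p s u fin]]) auto
      also have "\<dots> = ennreal (c * r ^ k)"
        using M by (simp add: ennreal_mult'[symmetric] c_def dev[of k] mult_ac)
      also have "\<dots> \<le> ennreal (e / 2)" using k by (intro ennreal_leI) simp
      finally show "ennreal (\<eta> powr (1 - p)) * (\<integral>\<^sup>+x. ennreal (?d x powr p) \<partial>lborel) \<le> ennreal (e / 2)" .
    qed
    also have "\<dots> = ennreal e" using e by (simp add: ennreal_plus[symmetric] del: ennreal_plus)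
    finally show "(\<integral>\<^sup>+x\<in>ball 0 R. ennreal (?d x) \<partial>lborel) \<le> ennreal e" .
  qed
qed

text \<open>Once all dyadic means converge along a subsequence, closeness of every member to its
  mean at one common level makes the subsequence Cauchy in L^1. Convergence in L^1 is enough, as
  only a limit almost everywhere is wanted.\<close>

lemma bounded_energy_AE_convergent_subseq:
  fixes u :: "nat \<Rightarrow> 'a::euclidean_space \<Rightarrow> real" and s p P M :: real
  assumes p: "1 < p" and s: "0 < s" and \<Omega>: "bounded \<Omega>"
    and u [measurable]: "\<And>n. u n \<in> borel_measurable borel"
    and supp: "\<And>n x. x \<notin> \<Omega> \<Longrightarrow> u n x = 0"
    and up: "\<And>n. (\<integral>\<^sup>+x. ennreal (\<bar>u n x\<bar> powr p) \<partial>lborel) \<le> ennreal P"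
    and uM: "\<And>n. energy s p (u n) \<le> ennreal M" and P: "0 \<le> P" and M: "0 \<le> M"
  obtains r v where "strict_mono r" "v \<in> borel_measurable borel" "\<And>x. x \<notin> \<Omega> \<Longrightarrow> v x = 0"
    and "AE x in lborel. (\<lambda>n. u (r n) x) \<longlonglongrightarrow> v x"
proof -
  have fin: "(\<integral>\<^sup>+x. ennreal (\<bar>u n x\<bar> powr p) \<partial>lborel) < top" for n
    using up[of n] by (rule order.strict_trans1) simp
  define B where "B k = (2 powr (real k * DIM('a)) * P) powr (1 / p)" for k :: nat
  have B: "\<bar>dyadic_mean k (u n) x\<bar> \<le> B k" for k n x
  proof -
    have "ennreal (\<bar>dyadic_mean k (u n) x\<bar> powr p) \<le> ennreal (2 powr (real k * DIM('a))) *
      (\<integral>\<^sup>+y. indicator (dyadic_cell k x) y * ennreal (\<bar>u n y\<bar> powr p) \<partial>lborel)"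
      using abs_dyadic_mean_powr_le[OF p s u[of n] fin, of k x 0] by simp
    also have "\<dots> \<le> ennreal (2 powr (real k * DIM('a))) * ennreal P"
      by (intro mult_left_mono order.trans[OF nn_integral_mono up[of n]]) (auto simp: indicator_def)
    also have "\<dots> = ennreal (B k powr p)"
      using p P by (simp add: B_def powr_powr ennreal_mult'[symmetric])
    finally show ?thesis
      by (rule abs_powr_le_imp_le[rotated]) (use p in \<open>simp_all add: B_def\<close>)
  qed
  from dyadic_means_convergent_subseq[of u B, OF this]
  obtain r1 where r1: "strict_mono r1" and conv: "\<And>k x. convergent (\<lambda>n. dyadic_mean k (u (r1 n)) x)"
    by metis
  define w where "w n = u (r1 n)" for n
  have [measurable]: "w n \<in> borel_measurable borel" for n by (simp add: w_def)
  obtain R where R: "0 < R" "\<Omega> \<subseteq> ball 0 R" using bounded_subset_ballD[OF \<Omega>, of 0] by auto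
  let ?D = "ball (0::'a) R"
  have [measurable]: "?D \<in> sets borel" by simp
  have supp_w: "w n x = 0" if "x \<notin> ?D" for n x using that R supp unfolding w_def by blast
  have "\<exists>N. \<forall>m\<ge>N. \<forall>n\<ge>N. (\<integral>\<^sup>+x. ennreal \<bar>w m x - w n x\<bar> \<partial>lborel) \<le> ennreal e" if e: "0 < e" for e
  proof -
    have e4: "0 < e / 4" using e by simp
    obtain k where dev: "\<And>u :: 'a \<Rightarrow> real. u \<in> borel_measurable borel \<Longrightarrow>
      (\<integral>\<^sup>+x. ennreal (\<bar>u x\<bar> powr p) \<partial>lborel) < top \<Longrightarrow> energy s p u \<le> ennreal M \<Longrightarrow>
      (\<integral>\<^sup>+x\<in>?D. ennreal \<bar>u x - dyadic_mean k u x\<bar> \<partial>lborel) \<le> ennreal (e / 4)"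
      using L1_deviation_small[OF p s M e4, of R] by blast
    have k: "(\<integral>\<^sup>+x\<in>?D. ennreal \<bar>w n x - dyadic_mean k (w n) x\<bar> \<partial>lborel) \<le> ennreal (e / 4)" for n
      unfolding w_def by (intro dev u fin uM)
    define l where "l x = lim (\<lambda>n. dyadic_mean k (w n) x)" for x
    have l: "(\<lambda>n. dyadic_mean k (w n) x) \<longlonglongrightarrow> l x" for x
      using conv[of k x] by (simp add: l_def w_def convergent_LIMSEQ_iff)
    have [measurable]: "l \<in> borel_measurable borel"
      unfolding l_def[abs_def] by measurable
    \<comment> \<open>At a fixed level the means are bounded by \<open>B k\<close>, so dominated
      convergence on the ball upgrades their pointwise limit to an L^1 limit.\<close>
    have "(\<lambda>n. \<integral>\<^sup>+x. norm (indicator ?D x * l x - indicator ?D x * dyadic_mean k (w n) x) \<partial>lborel) \<longlonglongrightarrow> 0"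
    proof (rule nn_integral_dominated_convergence_norm[where w = "\<lambda>x. B k * indicator ?D x"])
      have "B k \<ge> 0" by (simp add: B_def)
      then have "(\<integral>\<^sup>+x. ennreal (B k * indicator ?D x) \<partial>lborel) = ennreal (B k) * emeasure lborel ?D"
        by (simp add: ennreal_mult' ennreal_indicator nn_integral_cmult_indicator)
      also have "\<dots> < \<infinity>" using emeasure_lborel_ball_finite[of "0::'a" R] by (simp add: ennreal_mult_less_top)
      finally show "(\<integral>\<^sup>+x. ennreal (B k * indicator ?D x) \<partial>lborel) < \<infinity>" .
      show "AE x in lborel. norm (indicator ?D x * dyadic_mean k (w n) x) \<le> B k * indicator ?D x" for n
        using B by (intro AE_I2) (auto simp: indicator_def w_def)
      show "AE x in lborel. (\<lambda>n. indicator ?D x * dyadic_mean k (w n) x) \<longlonglongrightarrow> indicator ?D x * l x"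
        by (intro AE_I2 tendsto_mult_left l)
    qed measurable
    then have "\<forall>\<^sub>F n in sequentially. (\<integral>\<^sup>+x. norm (indicator ?D x * l x - indicator ?D x * dyadic_mean k (w n) x) \<partial>lborel) < ennreal (e / 4)"
      using e by (intro order_tendstoD(2)) auto
    then obtain N where N: "\<And>n. N \<le> n \<Longrightarrow>
        (\<integral>\<^sup>+x. norm (indicator ?D x * l x - indicator ?D x * dyadic_mean k (w n) x) \<partial>lborel) < ennreal (e / 4)"
      by (auto simp: eventually_sequentially)
    have near: "(\<integral>\<^sup>+x\<in>?D. ennreal \<bar>dyadic_mean k (w n) x - l x\<bar> \<partial>lborel) \<le> ennreal (e / 4)" if "N \<le> n" for n
    proof -
      have "(\<integral>\<^sup>+x\<in>?D. ennreal \<bar>dyadic_mean k (w n) x - l x\<bar> \<partial>lborel) =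
        (\<integral>\<^sup>+x. norm (indicator ?D x * l x - indicator ?D x * dyadic_mean k (w n) x) \<partial>lborel)"
        by (intro nn_integral_cong) (auto simp: indicator_def)
      then show ?thesis using N[OF that] by (simp add: less_imp_le)
    qed
    have "(\<integral>\<^sup>+x. ennreal \<bar>w m x - w n x\<bar> \<partial>lborel) \<le> ennreal e" if mn: "N \<le> m" "N \<le> n" for m n
    proof -
      let ?a = "\<lambda>n x. ennreal \<bar>w n x - dyadic_mean k (w n) x\<bar> * indicator ?D x"
      let ?b = "\<lambda>n x. ennreal \<bar>dyadic_mean k (w n) x - l x\<bar> * indicator ?D x"
      have "(\<integral>\<^sup>+x. ennreal \<bar>w m x - w n x\<bar> \<partial>lborel) \<le> (\<integral>\<^sup>+x. (?a m x + ?b m x) + (?a n x + ?b n x) \<partial>lborel)"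
      proof (rule nn_integral_mono)
        fix x
        have "\<bar>w m x - w n x\<bar> \<le> (\<bar>w m x - dyadic_mean k (w m) x\<bar> + \<bar>dyadic_mean k (w m) x - l x\<bar>)
            + (\<bar>w n x - dyadic_mean k (w n) x\<bar> + \<bar>dyadic_mean k (w n) x - l x\<bar>)" by linarith
        then show "ennreal \<bar>w m x - w n x\<bar> \<le> (?a m x + ?b m x) + (?a n x + ?b n x)"
          by (cases "x \<in> ?D") (auto simp: supp_w ennreal_plus[symmetric] ennreal_leI simp del: ennreal_plus mem_ball)
      qed
      also have "\<dots> = ((\<integral>\<^sup>+x. ?a m x \<partial>lborel) + (\<integral>\<^sup>+x. ?b m x \<partial>lborel)) +
          ((\<integral>\<^sup>+x. ?a n x \<partial>lborel) + (\<integral>\<^sup>+x. ?b n x \<partial>lborel))"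
        by (simp add: nn_integral_add)
      also have "\<dots> \<le> (ennreal (e / 4) + ennreal (e / 4)) + (ennreal (e / 4) + ennreal (e / 4))"
        by (intro add_mono k near mn)
      also have "\<dots> = ennreal e" using e by (simp add: ennreal_plus[symmetric] del: ennreal_plus)
      finally show ?thesis .
    qed
    then show ?thesis by blast
  qed
  from L1_Cauchy_AE_convergent_subseq[of w lborel, OF _ this]
  obtain r2 where r2: "strict_mono r2" and AE: "AE x in lborel. convergent (\<lambda>n. w (r2 n) x)"
    by auto
  define v where "v x = lim (\<lambda>n. w (r2 n) x)" for x
  show ?thesis
  proof (rule that[of "r1 \<circ> r2" v])
    show "strict_mono (r1 \<circ> r2)" using r1 r2 by (rule strict_mono_o)
    show "v \<in> borel_measurable borel" unfolding v_def[abs_def] by measurable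
    show "v x = 0" if "x \<notin> \<Omega>" for x
      using that supp by (simp add: v_def w_def)
    show "AE x in lborel. (\<lambda>n. u ((r1 \<circ> r2) n) x) \<longlonglongrightarrow> v x"
      using AE by eventually_elim (simp add: v_def w_def convergent_LIMSEQ_iff)
  qed
qed

section \<open>Existence of minimizers\<close>

lemma nn_integral_powr_le_liminf:
  fixes u :: "nat \<Rightarrow> 'a \<Rightarrow> real"
  assumes p: "0 < p" and [measurable]: "\<And>n. u n \<in> borel_measurable M"
    and lim: "AE x in M. (\<lambda>n. u n x) \<longlonglongrightarrow> v x"
  shows "(\<integral>\<^sup>+x. ennreal (\<bar>v x\<bar> powr p) \<partial>M) \<le> liminf (\<lambda>n. \<integral>\<^sup>+x. ennreal (\<bar>u n x\<bar> powr p) \<partial>M)"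
proof -
  have "(\<integral>\<^sup>+x. ennreal (\<bar>v x\<bar> powr p) \<partial>M) = (\<integral>\<^sup>+x. liminf (\<lambda>n. ennreal (\<bar>u n x\<bar> powr p)) \<partial>M)"
  proof (rule nn_integral_cong_AE)
    show "AE x in M. ennreal (\<bar>v x\<bar> powr p) = liminf (\<lambda>n. ennreal (\<bar>u n x\<bar> powr p))"
      using lim
    proof eventually_elim
      case (elim x)
      have "(\<lambda>n. ennreal (\<bar>u n x\<bar> powr p)) \<longlonglongrightarrow> ennreal (\<bar>v x\<bar> powr p)"
        using elim p by (intro tendsto_ennrealI tendsto_powr' tendsto_rabs tendsto_const) auto
      from lim_imp_Liminf[OF trivial_limit_sequentially this] show ?case by simp
    qed
  qed
  also have "\<dots> \<le> liminf (\<lambda>n. \<integral>\<^sup>+x. ennreal (\<bar>u n x\<bar> powr p) \<partial>M)"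
    by (rule nn_integral_liminf) measurable
  finally show ?thesis .
qed

text \<open>Fatou's lemma twice, as the energy is an iterated integral: in y for almost every x,
  then in x.\<close>

lemma energy_le_liminf:
  fixes u :: "nat \<Rightarrow> 'a::euclidean_space \<Rightarrow> real"
  assumes p: "0 < p" and [measurable]: "\<And>n. u n \<in> borel_measurable borel"
    and lim: "AE x in lborel. (\<lambda>n. u n x) \<longlonglongrightarrow> v x"
  shows "energy s p v \<le> liminf (\<lambda>n. energy s p (u n))"
proof -
  let ?Q = "\<lambda>u x y. ennreal (gagliardo_quotient s p u x y)"
  have "energy s p v \<le> (\<integral>\<^sup>+x. liminf (\<lambda>n. \<integral>\<^sup>+y. ?Q (u n) x y \<partial>lborel) \<partial>lborel)"
    unfolding energy_eq_quotient
  proof (rule nn_integral_mono_AE)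
    show "AE x in lborel. (\<integral>\<^sup>+y. ?Q v x y \<partial>lborel) \<le> liminf (\<lambda>n. \<integral>\<^sup>+y. ?Q (u n) x y \<partial>lborel)"
      using lim
    proof eventually_elim
      case (elim x)
      have "(\<integral>\<^sup>+y. ?Q v x y \<partial>lborel) = (\<integral>\<^sup>+y. liminf (\<lambda>n. ?Q (u n) x y) \<partial>lborel)"
      proof (rule nn_integral_cong_AE)
        show "AE y in lborel. ?Q v x y = liminf (\<lambda>n. ?Q (u n) x y)"
          using lim
        proof eventually_elim
          case y: (elim y)
          have "(\<lambda>n. \<bar>u n x - u n y\<bar> powr p) \<longlonglongrightarrow> \<bar>v x - v y\<bar> powr p"
            using elim y p by (intro tendsto_powr' tendsto_rabs tendsto_diff tendsto_const) auto
          then have "(\<lambda>n. ?Q (u n) x y) \<longlonglongrightarrow> ?Q v x y"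
            unfolding gagliardo_quotient_def divide_inverse
            by (intro tendsto_ennrealI tendsto_mult_right)
          from lim_imp_Liminf[OF trivial_limit_sequentially this] show ?case by simp
        qed
      qed
      also have "\<dots> \<le> liminf (\<lambda>n. \<integral>\<^sup>+y. ?Q (u n) x y \<partial>lborel)"
        by (rule nn_integral_liminf) measurable
      finally show ?case .
    qed
  qed
  also have "\<dots> \<le> liminf (\<lambda>n. energy s p (u n))"
    unfolding energy_eq_quotient by (rule nn_integral_liminf) measurable
  finally show ?thesis .
qed

text \<open>Fatou's lemma bounds the norm of the limit only from above. Truncating at height
  \<open>T\<close> restores dominated convergence on a bounded set, and the part cut off has
  integral at most \<open>e\<close>.\<close>

lemma nn_integral_powr_limit_ge:
  fixes u :: "nat \<Rightarrow> 'a::euclidean_space \<Rightarrow> real"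
  assumes q: "0 < q" and \<Omega>: "bounded \<Omega>" and T: "0 \<le> T"
    and [measurable]: "\<And>n. u n \<in> borel_measurable borel" "v \<in> borel_measurable borel"
    and supp: "\<And>n x. x \<notin> \<Omega> \<Longrightarrow> u n x = 0"
    and norm: "\<And>n. (\<integral>\<^sup>+x. ennreal (\<bar>u n x\<bar> powr q) \<partial>lborel) = 1"
    and tail: "\<And>n. (\<integral>\<^sup>+x. ennreal (\<bar>u n x\<bar> powr q) * indicator {x. T < \<bar>u n x\<bar>} x \<partial>lborel) \<le> e"
    and lim: "AE x in lborel. (\<lambda>n. u n x) \<longlonglongrightarrow> v x"
  shows "1 \<le> (\<integral>\<^sup>+x. ennreal (\<bar>v x\<bar> powr q) \<partial>lborel) + e"
proof -
  obtain R where R: "\<Omega> \<subseteq> ball 0 R" using bounded_subset_ballD[OF \<Omega>, of 0] by auto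
  let ?D = "ball (0::'a) R"
  have [measurable]: "?D \<in> sets borel" by simp
  let ?g = "\<lambda>u x. ennreal (min \<bar>u x\<bar> T powr q)"
  have "(\<lambda>n. \<integral>\<^sup>+x. ?g (u n) x \<partial>lborel) \<longlonglongrightarrow> (\<integral>\<^sup>+x. ?g v x \<partial>lborel)"
  proof (rule nn_integral_dominated_convergence[where w = "\<lambda>x. ennreal (T powr q) * indicator ?D x"])
    show "(\<integral>\<^sup>+x. ennreal (T powr q) * indicator ?D x \<partial>lborel) < \<infinity>"
      using emeasure_lborel_ball_finite[of "0::'a" R]
      by (simp add: nn_integral_cmult_indicator ennreal_mult_less_top)
    show "AE x in lborel. ?g (u n) x \<le> ennreal (T powr q) * indicator ?D x" for n
    proof (rule AE_I2)
      fix x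
      show "?g (u n) x \<le> ennreal (T powr q) * indicator ?D x"
      proof (cases "x \<in> ?D")
        case True
        then show ?thesis using T q by (auto intro!: ennreal_leI powr_mono2)
      next
        case False
        then have "u n x = 0" using supp R by blast
        then show ?thesis using T q by simp
      qed
    qed
    show "AE x in lborel. (\<lambda>n. ?g (u n) x) \<longlonglongrightarrow> ?g v x"
      using lim
    proof eventually_elim
      case (elim x)
      then show ?case using q T
        by (intro tendsto_ennrealI tendsto_powr' tendsto_min tendsto_rabs tendsto_const) auto
    qed
  qed measurable
  moreover have "1 \<le> (\<integral>\<^sup>+x. ?g (u n) x \<partial>lborel) + e" for n
  proof -
    have [measurable]: "{x. T < \<bar>u n x\<bar>} \<in> sets borel" by measurable
    have "1 \<le> (\<integral>\<^sup>+x. ?g (u n) x + ennreal (\<bar>u n x\<bar> powr q) * indicator {x. T < \<bar>u n x\<bar>} x \<partial>lborel)"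
      unfolding norm[of n, symmetric] by (intro nn_integral_mono) (auto simp: indicator_def min_def)
    also have "\<dots> = (\<integral>\<^sup>+x. ?g (u n) x \<partial>lborel) +
        (\<integral>\<^sup>+x. ennreal (\<bar>u n x\<bar> powr q) * indicator {x. T < \<bar>u n x\<bar>} x \<partial>lborel)"
      by (rule nn_integral_add) measurable
    finally show ?thesis using tail[of n] by (meson add_left_mono order.trans)
  qed
  ultimately have "1 \<le> (\<integral>\<^sup>+x. ?g v x \<partial>lborel) + e"
    by (intro LIMSEQ_le_const[OF tendsto_add[OF _ tendsto_const]]) auto
  also have "\<dots> \<le> (\<integral>\<^sup>+x. ennreal (\<bar>v x\<bar> powr q) \<partial>lborel) + e"
    using T q by (intro add_right_mono nn_integral_mono ennreal_leI powr_mono2) auto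
  finally show ?thesis .
qed

lemma energy_abs_le:
  assumes "0 < p"
  shows "energy s p (\<lambda>x. \<bar>u x\<bar>) \<le> energy s p u"
  unfolding energy_eq_quotient gagliardo_quotient_def using assms
  by (intro nn_integral_mono ennreal_leI divide_right_mono powr_mono2) auto

text \<open>The direct method. The energy passes to the limit by Fatou's lemma, the constraint by
  the uniform tails, and the p-th moment is controlled by the energy. At the end |v| replaces v
  without raising the energy.\<close>

lemma energy_minimizer:
  fixes \<Omega> :: "'a::euclidean_space set" and s p q :: real
  assumes p: "1 < p" and s: "0 < s" and q: "0 < q" "ereal q < critical_exponent DIM('a) s p"
    and \<Omega>: "bounded \<Omega>" and ne: "admissible s p q \<Omega> \<noteq> {}"
  obtains v where "v \<in> admissible s p q \<Omega>" "\<And>x. 0 \<le> v x"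
    and "\<And>u. u \<in> admissible s p q \<Omega> \<Longrightarrow> energy s p v \<le> energy s p u"
proof -
  define m where "m = (INF u\<in>admissible s p q \<Omega>. energy s p u)"
  have "m < top" using ne by (auto simp: m_def INF_less_iff admissible_def)
  then obtain l where l: "m = ennreal l" "0 \<le> l" by (cases m) auto
  have "\<exists>u\<in>admissible s p q \<Omega>. energy s p u < ennreal (l + 1 / real (Suc n))" for n
  proof -
    have "m < ennreal (l + 1 / real (Suc n))" using l by (simp add: ennreal_less_iff)
    then show ?thesis by (simp only: m_def INF_less_iff)
  qed
  then obtain u where u: "\<And>n. u n \<in> admissible s p q \<Omega>"
    and eu: "\<And>n. energy s p (u n) < ennreal (l + 1 / real (Suc n))"
    by metis
  have um [measurable]: "u n \<in> borel_measurable borel" and supp: "\<And>x. x \<notin> \<Omega> \<Longrightarrow> u n x = 0"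
    and un: "(\<integral>\<^sup>+x. ennreal (\<bar>u n x\<bar> powr q) \<partial>lborel) = 1" for n
    using u[of n] by (auto simp: admissible_def)
  define M where "M = l + 1"
  have M: "0 \<le> M" using l by (simp add: M_def)
  have uM: "energy s p (u n) \<le> ennreal M" for n
  proof (rule less_imp_le[OF order.strict_trans2[OF eu]])
    show "ennreal (l + 1 / real (Suc n)) \<le> ennreal M"
      unfolding M_def by (intro ennreal_leI add_left_mono) (simp add: field_simps)
  qed
  obtain C where C: "0 \<le> C" and poincare: "\<And>u. u \<in> borel_measurable borel \<Longrightarrow> (\<And>x. x \<notin> \<Omega> \<Longrightarrow> u x = 0) \<Longrightarrow>
      (\<integral>\<^sup>+x. ennreal (\<bar>u x\<bar> powr p) \<partial>lborel) \<le> ennreal C * energy s p u"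
    using nn_integral_powr_le_energy[OF p s \<Omega>] by blast
  have up: "(\<integral>\<^sup>+x. ennreal (\<bar>u n x\<bar> powr p) \<partial>lborel) \<le> ennreal (C * M)" for n
  proof -
    have "(\<integral>\<^sup>+x. ennreal (\<bar>u n x\<bar> powr p) \<partial>lborel) \<le> ennreal C * energy s p (u n)"
      by (intro poincare um supp)
    also have "\<dots> \<le> ennreal C * ennreal M" by (intro mult_left_mono uM) auto
    finally show ?thesis using C by (simp add: ennreal_mult')
  qed
  have CM: "0 \<le> C * M" using C M by simp
  obtain r v where r: "strict_mono r" and v [measurable]: "v \<in> borel_measurable borel"
    and v0: "\<And>x. x \<notin> \<Omega> \<Longrightarrow> v x = 0" and lim: "AE x in lborel. (\<lambda>n. u (r n) x) \<longlonglongrightarrow> v x"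
    by (rule bounded_energy_AE_convergent_subseq[OF p s \<Omega> um supp up uM CM M]) (assumption | (erule that; assumption))+
  have ev: "energy s p v \<le> m"
  proof -
    have "energy s p v \<le> liminf (\<lambda>n. energy s p (u (r n)))"
      using p lim by (intro energy_le_liminf) auto
    also have "\<dots> \<le> liminf (\<lambda>n. ennreal (l + 1 / real (Suc (r n))))"
      by (intro Liminf_mono always_eventually allI less_imp_le eu)
    also have "\<dots> = ennreal l"
    proof -
      have "(\<lambda>n. l + 1 / real (Suc (r n))) \<longlonglongrightarrow> l + 0"
        using LIMSEQ_subseq_LIMSEQ[OF LIMSEQ_Suc[OF lim_1_over_n] r]
        by (intro tendsto_add tendsto_const) (simp add: o_def)
      then have "(\<lambda>n. ennreal (l + 1 / real (Suc (r n)))) \<longlonglongrightarrow> ennreal l"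
        by (intro tendsto_ennrealI) simp
      from lim_imp_Liminf[OF trivial_limit_sequentially this] show ?thesis by simp
    qed
    finally show ?thesis using l by simp
  qed
  have vp: "(\<integral>\<^sup>+x. ennreal (\<bar>v x\<bar> powr p) \<partial>lborel) < top"
  proof -
    have "(\<integral>\<^sup>+x. ennreal (\<bar>v x\<bar> powr p) \<partial>lborel) \<le> ennreal C * energy s p v" by (intro poincare v v0)
    also have "\<dots> \<le> ennreal C * m" by (intro mult_left_mono ev) auto
    also have "\<dots> < top" using l by (simp add: ennreal_mult_less_top)
    finally show ?thesis .
  qed
  have vq: "(\<integral>\<^sup>+x. ennreal (\<bar>v x\<bar> powr q) \<partial>lborel) = 1"
  proof (rule antisym)
    have "(\<integral>\<^sup>+x. ennreal (\<bar>v x\<bar> powr q) \<partial>lborel) \<le> liminf (\<lambda>n. \<integral>\<^sup>+x. ennreal (\<bar>u (r n) x\<bar> powr q) \<partial>lborel)"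
      using q(1) lim by (intro nn_integral_powr_le_liminf) auto
    then show "(\<integral>\<^sup>+x. ennreal (\<bar>v x\<bar> powr q) \<partial>lborel) \<le> 1" by (simp add: un Liminf_const)
    show "1 \<le> (\<integral>\<^sup>+x. ennreal (\<bar>v x\<bar> powr q) \<partial>lborel)"
    proof (rule ennreal_le_epsilon)
      fix e :: real assume e: "0 < e"
      obtain T where T: "0 \<le> T" and tail: "\<And>u. u \<in> borel_measurable borel \<Longrightarrow>
        (\<integral>\<^sup>+x. ennreal (\<bar>u (x::'a)\<bar> powr p) \<partial>lborel) \<le> ennreal (C * M) \<Longrightarrow>
        energy s p u \<le> ennreal M \<Longrightarrow>
        (\<integral>\<^sup>+x. ennreal (\<bar>u x\<bar> powr q) * indicator {x. T < \<bar>u x\<bar>} x \<partial>lborel) \<le> ennreal e"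
        using uniform_tail[OF p s less_imp_le[OF q(1)] q(2) M e, of "C * M"] by blast
      show "1 \<le> (\<integral>\<^sup>+x. ennreal (\<bar>v x\<bar> powr q) \<partial>lborel) + ennreal e"
        by (rule nn_integral_powr_limit_ge[OF q(1) \<Omega> T um v supp un tail[OF um up uM] lim])
    qed
  qed
  show ?thesis
  proof (rule that[of "\<lambda>x. \<bar>v x\<bar>"])
    have "energy s p (\<lambda>x. \<bar>v x\<bar>) \<le> m" using energy_abs_le[of p s v] ev p by simp
    then show "energy s p (\<lambda>x. \<bar>v x\<bar>) \<le> energy s p w" if "w \<in> admissible s p q \<Omega>" for w
      using that by (auto simp: m_def intro: order.trans INF_lower)
    have "energy s p (\<lambda>x. \<bar>v x\<bar>) < top"
      using \<open>energy s p (\<lambda>x. \<bar>v x\<bar>) \<le> m\<close> \<open>m < top\<close> by (rule order.strict_trans1)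
    then show "(\<lambda>x. \<bar>v x\<bar>) \<in> admissible s p q \<Omega>"
      using v0 vp vq by (simp add: admissible_def)
  qed simp
qed

section \<open>Finite energy of tent functions\<close>

text \<open>Comparison with a series of multiples of ball indicators. Full balls in place of shells
  count points repeatedly, but their volume is explicit and for geometric radii only a constant
  factor is lost.\<close>

lemma nn_integral_dyadic_shells_finite:
  fixes f :: "'a::euclidean_space \<Rightarrow> ennreal" and c r :: "nat \<Rightarrow> real"
  assumes c: "\<And>k. 0 \<le> c k" and r: "\<And>k. 0 \<le> r k"
    and sum: "summable (\<lambda>k. c k * r k ^ DIM('a))"
    and f: "\<And>x. f x \<noteq> 0 \<Longrightarrow> \<exists>k. norm x \<le> r k \<and> f x \<le> ennreal (c k)"
  shows "(\<integral>\<^sup>+x. f x \<partial>lborel) < top"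
proof -
  have [measurable]: "cball (0::'a) t \<in> sets borel" for t by simp
  let ?V = "unit_ball_vol (real DIM('a))"
  have pt: "f x \<le> (\<Sum>k. ennreal (c k) * indicator (cball 0 (r k)) x)" for x
  proof (cases "f x = 0")
    case False
    then obtain k where k: "norm x \<le> r k" "f x \<le> ennreal (c k)" using f by blast
    then have "f x \<le> (\<Sum>k\<in>{k}. ennreal (c k) * indicator (cball 0 (r k)) x)" by simp
    also have "\<dots> \<le> (\<Sum>k. ennreal (c k) * indicator (cball 0 (r k)) x)"
      by (intro sum_le_suminf) auto
    finally show ?thesis .
  qed simp
  have "(\<integral>\<^sup>+x. f x \<partial>lborel) \<le> (\<integral>\<^sup>+x. (\<Sum>k. ennreal (c k) * indicator (cball 0 (r k)) (x::'a)) \<partial>lborel)"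
    by (intro nn_integral_mono pt)
  also have "\<dots> = (\<Sum>k. \<integral>\<^sup>+x. ennreal (c k) * indicator (cball 0 (r k)) (x::'a) \<partial>lborel)"
    by (rule nn_integral_suminf) measurable
  also have "\<dots> = (\<Sum>k. ennreal (?V * (c k * r k ^ DIM('a))))"
    using c r by (simp add: nn_integral_cmult_indicator emeasure_cball ennreal_mult'[symmetric] mult_ac)
  also have "\<dots> = ennreal (\<Sum>k. ?V * (c k * r k ^ DIM('a)))"
    using c r sum by (intro suminf_ennreal2 summable_mult) auto
  also have "\<dots> < top" by simp
  finally show ?thesis .
qed

text \<open>Near 0 the shell of radius 2^-k contributes about 2^(-k p (1 - s)), which sums because s
  < 1; far out the shell of radius 2^k contributes about 2^(-k s p). At z = 0 the quotient is 0/0 =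
  0.\<close>

lemma truncated_kernel_integrable:
  fixes s p R :: real
  assumes p: "0 < p" and s: "0 < s" "s < 1" and R: "0 < R"
  shows "(\<integral>\<^sup>+z. ennreal (min (norm z) R powr p / norm (z::'a::euclidean_space) powr (real DIM('a) + s * p)) \<partial>lborel) < top"
    (is "(\<integral>\<^sup>+z. ennreal (?g z) \<partial>_) < _")
proof -
  let ?n = "real DIM('a)" and ?\<gamma> = "real DIM('a) + s * p"
  have [measurable]: "cball (0::'a) t \<in> sets borel" for t by simp
  have \<gamma>: "0 \<le> ?\<gamma>" using p s by simp
  have half: "((1/2::real) ^ j) powr t = 2 powr (- (real j * t))" for j t
    by (simp add: power_one_over powr_realpow[symmetric] powr_minus_divide powr_powr powr_divide)
  have two: "((2::real) ^ j) powr t = 2 powr (real j * t)" for j t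
    by (simp add: powr_realpow[symmetric] powr_powr)
  have nat_pow: "(2 powr t) ^ k = 2 powr (real k * t)" for k t
    by (simp add: powr_realpow[symmetric] powr_powr mult_ac)
  have inner: "(\<integral>\<^sup>+z. ennreal (?g z) * indicator (cball 0 1) z \<partial>lborel) < top"
  proof (rule nn_integral_dyadic_shells_finite[of "\<lambda>k. ((1/2) ^ k) powr p / ((1/2) ^ Suc k) powr ?\<gamma>" "\<lambda>k. (1/2) ^ k"])
    have "((1/2) ^ k) powr p / ((1/2) ^ Suc k) powr ?\<gamma> * ((1/2) ^ k) ^ DIM('a)
        = 2 powr ?\<gamma> * (2 powr (- (p * (1 - s)))) ^ k" for k :: nat
    proof -
      have "((1/2::real) ^ k) ^ DIM('a) = ((1/2) ^ k) powr ?n" by (rule powr_realpow[symmetric]) simp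
      then show ?thesis
        unfolding half nat_pow by (simp only: powr_add[symmetric] powr_diff[symmetric]) (simp add: algebra_simps)
    qed
    moreover have "summable (\<lambda>k. 2 powr ?\<gamma> * (2 powr (- (p * (1 - s)))) ^ k)"
      using p s by (intro summable_mult summable_geometric) (auto simp: powr_less_one)
    ultimately show "summable (\<lambda>k. ((1/2) ^ k) powr p / ((1/2) ^ Suc k) powr ?\<gamma> * ((1/2) ^ k) ^ DIM('a))"
      by simp
    fix z :: 'a
    assume "ennreal (?g z) * indicator (cball 0 1) z \<noteq> 0"
    then have z: "0 < norm z" "norm z \<le> 1" by (cases "z = 0"; auto simp: indicator_def split: if_splits)+
    \<comment> \<open>With n = k + 1 this places |z| between (1/2)^(k + 1) and (1/2)^k; the lower
      bound goes into the denominator, the upper one into the numerator.\<close>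
    define n where "n = (LEAST n. (1/2) ^ n < norm z)"
    obtain m where "(1/2) ^ m < norm z" using real_arch_pow_inv[of "norm z" "1/2"] z by auto
    then have n: "(1/2) ^ n < norm z" unfolding n_def by (rule LeastI)
    then have "n \<noteq> 0" using z by (intro notI) auto
    then obtain k where k: "n = Suc k" using not0_implies_Suc by blast
    then have up: "norm z \<le> (1/2) ^ k" using not_less_Least[of k "\<lambda>n. (1/2) ^ n < norm z"] by (auto simp: n_def)
    have "?g z \<le> ((1/2) ^ k) powr p / ((1/2) ^ Suc k) powr ?\<gamma>"
      using up n k p R \<gamma> z by (intro frac_le powr_mono2) auto
    then show "\<exists>k. norm z \<le> (1/2) ^ k \<and> ennreal (?g z) * indicator (cball 0 1) z
      \<le> ennreal (((1/2) ^ k) powr p / ((1/2) ^ Suc k) powr ?\<gamma>)"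
      using up by (intro exI[of _ k]) (auto simp: indicator_def intro: ennreal_leI)
  qed auto
  have outer: "(\<integral>\<^sup>+z. ennreal (?g z) * indicator (- cball 0 1) z \<partial>lborel) < top"
  proof (rule nn_integral_dyadic_shells_finite[of "\<lambda>k. R powr p / (2 ^ k) powr ?\<gamma>" "\<lambda>k. 2 ^ Suc k"])
    have "R powr p / (2 ^ k) powr ?\<gamma> * (2 ^ Suc k) ^ DIM('a)
        = R powr p * 2 powr ?n * (2 powr (- (s * p))) ^ k" for k :: nat
    proof -
      have "((2::real) ^ Suc k) ^ DIM('a) = (2 ^ Suc k) powr ?n" by (rule powr_realpow[symmetric]) simp
      moreover have "2 powr (real (Suc k) * ?n) / 2 powr (real k * ?\<gamma>) = 2 powr ?n * 2 powr (real k * (- (s * p)))"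
        by (simp only: powr_add[symmetric] powr_diff[symmetric]) (simp add: algebra_simps)
      ultimately show ?thesis
        unfolding two nat_pow by (simp add: field_simps)
    qed
    moreover have "summable (\<lambda>k. R powr p * 2 powr ?n * (2 powr (- (s * p))) ^ k)"
      using p s by (intro summable_mult summable_geometric) (auto simp: powr_less_one)
    ultimately show "summable (\<lambda>k. R powr p / (2 ^ k) powr ?\<gamma> * (2 ^ Suc k) ^ DIM('a))"
      by simp
    fix z :: 'a
    assume "ennreal (?g z) * indicator (- cball 0 1) z \<noteq> 0"
    then have z: "1 < norm z" by (auto simp: indicator_def split: if_splits)
    define n where "n = (LEAST n. norm z \<le> 2 ^ n)"
    obtain m where "norm z < 2 ^ m" using real_arch_pow[of 2 "norm z"] by auto
    then have "norm z \<le> 2 ^ m" by simp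
    then have n: "norm z \<le> 2 ^ n" unfolding n_def by (rule LeastI)
    then have "n \<noteq> 0" using z by (intro notI) auto
    then obtain k where k: "n = Suc k" using not0_implies_Suc by blast
    then have low: "2 ^ k \<le> norm z" using not_less_Least[of k "\<lambda>n. norm z \<le> 2 ^ n"] by (auto simp: n_def)
    have "?g z \<le> R powr p / (2 ^ k) powr ?\<gamma>"
      using low p R \<gamma> z by (intro frac_le powr_mono2) auto
    then show "\<exists>k. norm z \<le> 2 ^ Suc k \<and> ennreal (?g z) * indicator (- cball 0 1) z
      \<le> ennreal (R powr p / (2 ^ k) powr ?\<gamma>)"
      using n k by (intro exI[of _ k]) (auto simp: indicator_def intro: ennreal_leI)
  qed auto
  have "(\<integral>\<^sup>+z. ennreal (?g z) \<partial>lborel) =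
    (\<integral>\<^sup>+z. ennreal (?g z) * indicator (cball 0 1) z + ennreal (?g z) * indicator (- cball 0 1) z \<partial>lborel)"
    by (intro nn_integral_cong) (auto simp: indicator_def)
  also have "\<dots> < top"
    using inner outer by (subst nn_integral_add) auto
  finally show ?thesis .
qed

definition tent :: "'a::euclidean_space \<Rightarrow> real \<Rightarrow> 'a \<Rightarrow> real" where
  "tent z \<rho> x = max 0 (\<rho> - norm (x - z))"

lemma tent_nonneg [simp]: "0 \<le> tent z \<rho> x"
  by (simp add: tent_def)

lemma tent_le: "0 \<le> \<rho> \<Longrightarrow> tent z \<rho> x \<le> \<rho>"
  by (simp add: tent_def)

lemma tent_eq_0: "x \<notin> ball z \<rho> \<Longrightarrow> tent z \<rho> x = 0"
  by (auto simp: tent_def dist_norm norm_minus_commute)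

lemma measurable_tent [measurable]: "tent z \<rho> \<in> borel_measurable borel"
  unfolding tent_def[abs_def] by measurable

lemma tent_Lipschitz: "\<bar>tent z \<rho> x - tent z \<rho> y\<bar> \<le> norm (x - y)"
  using norm_triangle_ineq3[of "x - z" "y - z"] by (simp add: tent_def max_def abs_le_iff)

text \<open>The tent is Lipschitz and bounded by \<open>\<rho>\<close>, so its quotient is at most
  the truncated kernel in y - x, and it is zero unless x or y lies in the ball. Either case
  integrates to the volume of the ball times the finite integral of the kernel.\<close>

lemma energy_tent_finite:
  fixes z :: "'a::euclidean_space"
  assumes p: "0 < p" and s: "0 < s" "s < 1" and \<rho>: "0 < \<rho>"
  shows "energy s p (tent z \<rho>) < top"
proof -
  let ?B = "ball z \<rho>"
  define g where "g v = ennreal (min (norm v) \<rho> powr p / norm (v::'a) powr (real DIM('a) + s * p))" for v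
  have [measurable]: "g \<in> borel_measurable borel" unfolding g_def[abs_def] by measurable
  have [measurable]: "?B \<in> sets borel" by simp
  define I where "I = (\<integral>\<^sup>+v. g v \<partial>lborel)"
  have I: "I < top" unfolding I_def g_def by (rule truncated_kernel_integrable[OF p s \<rho>])
  have shift: "(\<integral>\<^sup>+y. g (y - x) \<partial>lborel) = I" for x
    using nn_integral_distr[of "(+) (- x)" lborel borel g] by (simp add: lborel_distr_plus I_def)
  have pt: "ennreal (gagliardo_quotient s p (tent z \<rho>) x y) \<le> indicator ?B x * g (y - x) + indicator ?B y * g (y - x)" for x y
  proof (cases "x \<in> ?B \<or> y \<in> ?B")
    case True
    have "\<bar>tent z \<rho> x - tent z \<rho> y\<bar> \<le> min (norm (x - y)) \<rho>"
      using tent_Lipschitz[of z \<rho> x y] tent_le[of \<rho> z x] tent_le[of \<rho> z y] tent_nonneg[of z \<rho> x] tent_nonneg[of z \<rho> y] \<rho>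
      by (auto simp: abs_le_iff simp del: tent_nonneg)
    then have "gagliardo_quotient s p (tent z \<rho>) x y
        \<le> min (norm (x - y)) \<rho> powr p / norm (x - y) powr (real DIM('a) + s * p)"
      unfolding gagliardo_quotient_def using p by (intro divide_right_mono powr_mono2) auto
    then have "ennreal (gagliardo_quotient s p (tent z \<rho>) x y) \<le> g (y - x)"
      unfolding g_def by (intro ennreal_leI) (simp add: norm_minus_commute)
    then show ?thesis using True by (auto simp: indicator_def add_increasing add_increasing2)
  next
    case False
    then show ?thesis by (simp add: gagliardo_quotient_def tent_eq_0 del: mem_ball)
  qed
  have "energy s p (tent z \<rho>) \<le> (\<integral>\<^sup>+x. (\<integral>\<^sup>+y. indicator ?B x * g (y - x) + indicator ?B y * g (y - x) \<partial>lborel) \<partial>lborel)"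
    unfolding energy_eq_quotient by (intro nn_integral_mono pt)
  also have "\<dots> = (\<integral>\<^sup>+x. indicator ?B x * I \<partial>lborel) + (\<integral>\<^sup>+x. (\<integral>\<^sup>+y. indicator ?B y * g (y - x) \<partial>lborel) \<partial>lborel)"
    by (simp add: nn_integral_add nn_integral_cmult shift)
  also have "(\<integral>\<^sup>+x. (\<integral>\<^sup>+y. indicator ?B y * g (y - x) \<partial>lborel) \<partial>lborel)
      = (\<integral>\<^sup>+y. (\<integral>\<^sup>+x. indicator ?B y * g (y - x) \<partial>lborel) \<partial>lborel)"
    by (rule lborel_pair.Fubini') measurable
  also have "\<dots> = (\<integral>\<^sup>+y. indicator ?B y * I \<partial>lborel)"
  proof -
    have "(\<integral>\<^sup>+x. g (y - x) \<partial>lborel) = I" for y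
      unfolding shift[of y, symmetric] by (intro nn_integral_cong) (simp add: g_def norm_minus_commute)
    then show ?thesis by (simp add: nn_integral_cmult)
  qed
  also have "(\<integral>\<^sup>+x. indicator ?B x * I \<partial>lborel) = emeasure lborel ?B * I"
    by (simp add: nn_integral_multc)
  also have "emeasure lborel ?B * I + emeasure lborel ?B * I < top"
    using I emeasure_lborel_ball_finite[of z \<rho>] by (simp add: ennreal_mult_less_top)
  finally show ?thesis .
qed

lemma energy_scale: "energy s p (\<lambda>x. c * u x) = ennreal (\<bar>c\<bar> powr p) * energy s p u"
  if [measurable]: "u \<in> borel_measurable borel"
proof -
  have "gagliardo_quotient s p (\<lambda>x. c * u x) x y = \<bar>c\<bar> powr p * gagliardo_quotient s p u x y" for x y
    by (simp add: gagliardo_quotient_def right_diff_distrib[symmetric] abs_mult powr_mult)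
  then show ?thesis by (simp add: energy_eq_quotient ennreal_mult' nn_integral_cmult)
qed

text \<open>The finite p-th moment comes from the finite energy through
  \<open>nn_integral_powr_le_energy\<close>; the power of \<open>m\<close> makes the q-norm
  1.\<close>

lemma normalized_admissible:
  fixes u :: "'a::euclidean_space \<Rightarrow> real"
  assumes p: "1 < p" and s: "0 < s" and q: "0 < q" and \<Omega>: "bounded \<Omega>"
    and u [measurable]: "u \<in> borel_measurable borel" and supp: "\<And>x. x \<notin> \<Omega> \<Longrightarrow> u x = 0"
    and fin: "energy s p u < top"
    and m: "(\<integral>\<^sup>+x. ennreal (\<bar>u x\<bar> powr q) \<partial>lborel) = ennreal m" "0 < m"
  shows "(\<lambda>x. m powr (- 1 / q) * u x) \<in> admissible s p q \<Omega>"
proof -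
  let ?c = "m powr (- 1 / q)" and ?w = "\<lambda>x. m powr (- 1 / q) * u x"
  have "energy s p ?w < top"
    using fin by (simp add: energy_scale[OF u] ennreal_mult_less_top)
  moreover obtain C where C: "\<And>u. u \<in> borel_measurable borel \<Longrightarrow> (\<And>x. x \<notin> \<Omega> \<Longrightarrow> u x = 0) \<Longrightarrow>
      (\<integral>\<^sup>+x. ennreal (\<bar>u x\<bar> powr p) \<partial>lborel) \<le> ennreal C * energy s p u"
    using nn_integral_powr_le_energy[OF p s \<Omega>] by blast
  have "(\<integral>\<^sup>+x. ennreal (\<bar>?w x\<bar> powr p) \<partial>lborel) \<le> ennreal C * energy s p ?w"
    by (rule C) (use supp in auto)
  ultimately have "(\<integral>\<^sup>+x. ennreal (\<bar>?w x\<bar> powr p) \<partial>lborel) < top"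
    by (auto intro: order.strict_trans1 simp: ennreal_mult_less_top)
  moreover have "(\<integral>\<^sup>+x. ennreal (\<bar>?w x\<bar> powr q) \<partial>lborel) = ennreal (?c powr q) * ennreal m"
    unfolding m(1)[symmetric]
    by (subst nn_integral_cmult[symmetric]) (auto simp: abs_mult powr_mult ennreal_mult')
  moreover have "?c powr q = 1 / m"
    unfolding powr_powr using m(2) q by (simp add: powr_minus_divide)
  then have "ennreal (?c powr q) * ennreal m = 1"
    using m(2) by (simp add: ennreal_mult'[symmetric])
  ultimately show ?thesis
    using \<open>energy s p ?w < top\<close> supp by (simp add: admissible_def)
qed


lemma admissible_nonempty:
  fixes \<Omega> :: "'a::euclidean_space set"
  assumes p: "1 < p" and s: "0 < s" "s < 1" and q: "0 < q" and \<Omega>: "bounded \<Omega>"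
    and B: "0 < \<rho>" "ball z \<rho> \<subseteq> \<Omega>"
  shows "admissible s p q \<Omega> \<noteq> {}"
proof -
  let ?B = "ball z \<rho>"
  have [measurable]: "?B \<in> sets borel" by simp
  let ?I = "\<integral>\<^sup>+x. ennreal (\<bar>tent z \<rho> x\<bar> powr q) \<partial>lborel"
  have "?I \<le> (\<integral>\<^sup>+x. ennreal (\<rho> powr q) * indicator ?B x \<partial>lborel)"
  proof (rule nn_integral_mono)
    fix x show "ennreal (\<bar>tent z \<rho> x\<bar> powr q) \<le> ennreal (\<rho> powr q) * indicator ?B x"
      using tent_le[of \<rho> z x] tent_eq_0[of x z \<rho>] B q
      by (cases "x \<in> ?B") (auto intro!: ennreal_leI powr_mono2 simp del: mem_ball)
  qed
  also have "\<dots> < top"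
    using emeasure_lborel_ball_finite[of z \<rho>] by (simp add: nn_integral_cmult_indicator ennreal_mult_less_top)
  finally have "?I < top" .
  moreover have "?I \<noteq> 0"
  proof
    assume "?I = 0"
    then have "AE x in lborel. ennreal (\<bar>tent z \<rho> x\<bar> powr q) = 0"
      by (subst (asm) nn_integral_0_iff_AE) auto
    then have "AE x in lborel. x \<notin> ?B"
      by eventually_elim (auto simp: tent_def dist_norm norm_minus_commute)
    then have "emeasure lborel ?B = 0" by (subst (asm) AE_iff_measurable[of ?B]) auto
    then show False using B unit_ball_vol_pos[of "real DIM('a)"] by (simp add: emeasure_ball)
  qed
  ultimately obtain m where m: "?I = ennreal m" "0 < m" by (cases ?I) (auto simp: less_le)
  have supp: "tent z \<rho> x = 0" if "x \<notin> \<Omega>" for x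
    using that B(2) by (intro tent_eq_0) blast
  have "(\<lambda>x. m powr (- 1 / q) * tent z \<rho> x) \<in> admissible s p q \<Omega>"
    using p by (intro normalized_admissible[OF p s(1) q \<Omega> _ supp energy_tent_finite[OF _ s B(1)] m]) auto
  then show ?thesis by blast
qed

section \<open>First-order energy gain from a bump on a ball of zeros\<close>

lemma abs_diff_powr_le_add:
  fixes a t p :: real
  assumes "0 \<le> p" "0 \<le> a" "0 \<le> t"
  shows "\<bar>a - t\<bar> powr p \<le> a powr p + t powr p"
proof (cases "a \<le> t")
  case True
  then have "\<bar>a - t\<bar> powr p \<le> t powr p" using assms by (intro powr_mono2) auto
  then show ?thesis by (simp add: add_increasing)
next
  case False
  then have "\<bar>a - t\<bar> powr p \<le> a powr p" using assms by (intro powr_mono2) auto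
  then show ?thesis by (simp add: add_increasing2)
qed

text \<open>The tangent to the p-th power at t - a has slope at least p \<tau>^(p - 1), because t -
  a stays above \<open>\<tau>\<close>; lowering t by at least \<open>b\<close> thus gains linearly
  in \<open>b\<close>.\<close>

lemma powr_diff_gain:
  fixes a b t \<tau> p :: real
  assumes p: "1 < p" and "0 < b" "b \<le> a" "a \<le> \<tau>" "2 * \<tau> < t"
  shows "\<bar>t - a\<bar> powr p + p * b * \<tau> powr (p - 1) \<le> t powr p"
proof -
  have abs: "\<bar>t - a\<bar> = t - a" using assms by linarith
  have "(t - a) powr p + p * (t - a) powr (p - 1) * (t - (t - a)) < t powr p"
    using assms by (intro powr_above_tangent_scaled) auto
  moreover have "p * b * \<tau> powr (p - 1) \<le> p * a * (t - a) powr (p - 1)"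
    using assms by (intro mult_mono powr_mono2) auto
  moreover have "p * (t - a) powr (p - 1) * (t - (t - a)) = p * a * (t - a) powr (p - 1)" by simp
  ultimately show ?thesis unfolding abs by linarith
qed

text \<open>If a nonnegative minimizer vanished on a ball, adding \<open>\<epsilon>\<close> times a tent function there would
  lower the energy by an amount of order \<open>\<epsilon>\<close> at a cost of order \<open>\<epsilon>\<^sup>p\<close>, without lowering the norm.\<close>

lemma perturbed_energy_le:
  fixes u :: "'a::euclidean_space \<Rightarrow> real" and s p \<rho> \<tau> \<epsilon> :: real
  assumes p: "1 < p" and s: "0 < s" and \<rho>: "0 < \<rho>" and \<epsilon>: "0 < \<epsilon>" "\<epsilon> * \<rho> \<le> \<tau>"
    and u [measurable]: "u \<in> borel_measurable borel" and u0: "\<And>x. 0 \<le> u x"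
    and B: "\<And>x. x \<in> ball z \<rho> \<Longrightarrow> u x = 0"
  shows "energy s p (\<lambda>x. u x + \<epsilon> * tent z \<rho> x)
      + ennreal (p * (\<epsilon> * (\<rho> / 2)) * \<tau> powr (p - 1)) *
        (\<integral>\<^sup>+x. (\<integral>\<^sup>+y. ennreal (indicator (ball z (\<rho> / 2)) x * indicator {y. 2 * \<tau> < u y} y
           / norm (x - y) powr (real DIM('a) + s * p)) \<partial>lborel) \<partial>lborel)
    \<le> energy s p u + ennreal (\<epsilon> powr p) * energy s p (tent z \<rho>)"
proof -
  let ?w = "\<lambda>x. u x + \<epsilon> * tent z \<rho> x" and ?B = "ball z \<rho>" and ?B1 = "ball z (\<rho> / 2)" and ?G = "{y. 2 * \<tau> < u y}"
  \<comment> \<open>The gain of \<open>powr_diff_gain\<close> with b = \<epsilon> \<rho> / 2, a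
    lower bound for the scaled tent on the half-size ball \<open>?B1\<close>.\<close>
  let ?c = "p * (\<epsilon> * (\<rho> / 2)) * \<tau> powr (p - 1)" and ?\<gamma> = "real DIM('a) + s * p"
  have [measurable]: "?B1 \<in> sets borel" "?G \<in> sets borel" by auto
  have c: "0 \<le> ?c" using p \<epsilon> \<rho> by simp
  have \<tau>: "0 < \<tau>" using mult_pos_pos[OF \<epsilon>(1) \<rho>] \<epsilon>(2) by linarith
  have B1: "x \<in> ?B" "\<rho> / 2 \<le> tent z \<rho> x" if "x \<in> ?B1" for x
    using that \<rho> by (auto simp: tent_def dist_norm norm_minus_commute)
  have pt: "\<bar>?w x - ?w y\<bar> powr p + ?c * (indicator ?B1 x * indicator ?G y)
      \<le> \<bar>u x - u y\<bar> powr p + \<epsilon> powr p * \<bar>tent z \<rho> x - tent z \<rho> y\<bar> powr p" for x y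
  proof -
    have t: "0 \<le> \<epsilon> * tent z \<rho> x" "0 \<le> \<epsilon> * tent z \<rho> y" using \<epsilon> by auto
    have scale: "\<epsilon> powr p * r powr p = (\<epsilon> * r) powr p" if "0 \<le> r" for r
      using \<epsilon> that by (simp add: powr_mult)
    consider "x \<in> ?B" "y \<in> ?B" | "x \<in> ?B" "y \<notin> ?B" | "x \<notin> ?B" "y \<in> ?B" | "x \<notin> ?B" "y \<notin> ?B" by blast
    then show ?thesis
    proof cases
      case 1
      then have "indicator ?G y = (0::real)" using B \<tau> by simp
      moreover have "\<bar>?w x - ?w y\<bar> = \<epsilon> * \<bar>tent z \<rho> x - tent z \<rho> y\<bar>"
        using B 1 \<epsilon> by (simp add: abs_mult right_diff_distrib[symmetric])
      ultimately show ?thesis using B 1 scale p by simp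
    next
      case 2
      then have eq: "\<bar>?w x - ?w y\<bar> = \<bar>\<epsilon> * tent z \<rho> x - u y\<bar>" "\<bar>u x - u y\<bar> = u y"
        "\<epsilon> powr p * \<bar>tent z \<rho> x - tent z \<rho> y\<bar> powr p = (\<epsilon> * tent z \<rho> x) powr p"
        using B u0 \<epsilon> scale by (auto simp: tent_eq_0 simp del: mem_ball)
      show ?thesis
      proof (cases "x \<in> ?B1 \<and> y \<in> ?G")
        case True
        have "\<epsilon> * (\<rho> / 2) \<le> \<epsilon> * tent z \<rho> x" using B1(2)[of x] True \<epsilon> by (intro mult_left_mono) auto
        moreover have "\<epsilon> * tent z \<rho> x \<le> \<tau>"
          using tent_le[of \<rho> z x] \<rho> \<epsilon> by (intro order.trans[OF mult_left_mono \<epsilon>(2)]) auto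
        ultimately have "\<bar>u y - \<epsilon> * tent z \<rho> x\<bar> powr p + ?c \<le> u y powr p"
          using True \<epsilon> \<rho> by (intro powr_diff_gain[OF p]) auto
        then show ?thesis
          using True unfolding eq by (simp add: abs_minus_commute add_increasing2)
      next
        \<comment> \<open>Here no gain is recorded, and the loss is at most the p-th power of the
          bump, which is the tent's own term.\<close>
        case False
        then have ind: "indicator ?B1 x * indicator ?G y = (0::real)" by (auto simp: indicator_def)
        then show ?thesis
          using abs_diff_powr_le_add[OF _ t(1) u0[of y], of p] p unfolding eq ind by simp
      qed
    next
      \<comment> \<open>Pairs with x and y exchanged gain as well; the bound credits only x in
        \<open>?B1\<close>, which suffices for a positive gain.\<close>
      case 3
      then have eq: "\<bar>?w x - ?w y\<bar> = \<bar>\<epsilon> * tent z \<rho> y - u x\<bar>" "\<bar>u x - u y\<bar> = u x"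
        "\<epsilon> powr p * \<bar>tent z \<rho> x - tent z \<rho> y\<bar> powr p = (\<epsilon> * tent z \<rho> y) powr p"
        using B u0 \<epsilon> scale by (auto simp: tent_eq_0 abs_minus_commute simp del: mem_ball)
      have "indicator ?B1 x = (0::real)" using 3 B1(1)[of x] by (auto simp: indicator_def)
      then show ?thesis
        using abs_diff_powr_le_add[OF _ t(2) u0[of x], of p] p unfolding eq by simp
    next
      case 4
      have "indicator ?B1 x = (0::real)" using 4 B1(1)[of x] by (auto simp: indicator_def)
      then show ?thesis using 4 p by (simp add: tent_eq_0 del: mem_ball)
    qed
  qed
  have split: "ennreal (a + k * b) = ennreal a + ennreal k * ennreal b" if "0 \<le> a" "0 \<le> k" "0 \<le> b" for a k b
    using that by (simp add: ennreal_mult')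
  have "ennreal (gagliardo_quotient s p ?w x y)
      + ennreal ?c * ennreal (indicator ?B1 x * indicator ?G y / norm (x - y) powr ?\<gamma>)
    \<le> ennreal (gagliardo_quotient s p u x y) + ennreal (\<epsilon> powr p) * ennreal (gagliardo_quotient s p (tent z \<rho>) x y)" for x y
  proof -
    have "(\<bar>?w x - ?w y\<bar> powr p + ?c * (indicator ?B1 x * indicator ?G y)) / norm (x - y) powr ?\<gamma>
      \<le> (\<bar>u x - u y\<bar> powr p + \<epsilon> powr p * \<bar>tent z \<rho> x - tent z \<rho> y\<bar> powr p) / norm (x - y) powr ?\<gamma>"
      by (intro divide_right_mono pt) auto
    then have "ennreal (gagliardo_quotient s p ?w x y + ?c * (indicator ?B1 x * indicator ?G y / norm (x - y) powr ?\<gamma>))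
      \<le> ennreal (gagliardo_quotient s p u x y + \<epsilon> powr p * gagliardo_quotient s p (tent z \<rho>) x y)"
      unfolding gagliardo_quotient_def by (intro ennreal_leI) (simp add: add_divide_distrib)
    moreover have "ennreal (gagliardo_quotient s p ?w x y + ?c * (indicator ?B1 x * indicator ?G y / norm (x - y) powr ?\<gamma>))
      = ennreal (gagliardo_quotient s p ?w x y) + ennreal ?c * ennreal (indicator ?B1 x * indicator ?G y / norm (x - y) powr ?\<gamma>)"
      using c by (intro split) auto
    moreover have "ennreal (gagliardo_quotient s p u x y + \<epsilon> powr p * gagliardo_quotient s p (tent z \<rho>) x y)
      = ennreal (gagliardo_quotient s p u x y) + ennreal (\<epsilon> powr p) * ennreal (gagliardo_quotient s p (tent z \<rho>) x y)"
      by (intro split) auto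
    ultimately show ?thesis by simp
  qed
  then have "(\<integral>\<^sup>+x. (\<integral>\<^sup>+y. ennreal (gagliardo_quotient s p ?w x y)
      + ennreal ?c * ennreal (indicator ?B1 x * indicator ?G y / norm (x - y) powr ?\<gamma>) \<partial>lborel) \<partial>lborel)
    \<le> (\<integral>\<^sup>+x. (\<integral>\<^sup>+y. ennreal (gagliardo_quotient s p u x y)
      + ennreal (\<epsilon> powr p) * ennreal (gagliardo_quotient s p (tent z \<rho>) x y) \<partial>lborel) \<partial>lborel)"
    by (intro nn_integral_mono)
  then show ?thesis
    by (simp add: nn_integral_add nn_integral_cmult energy_eq_quotient)
qed

text \<open>Disjointness keeps x and y apart, so on the product of \<open>A\<close> and
  \<open>G\<close> the kernel is a positive number and never 1/0 = 0.\<close>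

lemma interaction_pos:
  fixes A G :: "'a::euclidean_space set"
  assumes [measurable]: "A \<in> sets borel" "G \<in> sets borel" and "A \<inter> G = {}"
    and A: "\<not> (AE x in lborel. x \<notin> A)" and G: "\<not> (AE x in lborel. x \<notin> G)"
  shows "(\<integral>\<^sup>+x. (\<integral>\<^sup>+y. ennreal (indicator A x * indicator G y / norm (x - y) powr \<gamma>) \<partial>lborel) \<partial>lborel) \<noteq> 0"
proof
  assume "(\<integral>\<^sup>+x. (\<integral>\<^sup>+y. ennreal (indicator A x * indicator G y / norm (x - y) powr \<gamma>) \<partial>lborel) \<partial>lborel) = 0"
  then have "AE x in lborel. (\<integral>\<^sup>+y. ennreal (indicator A x * indicator G y / norm (x - y) powr \<gamma>) \<partial>lborel) = 0"
    by (subst (asm) nn_integral_0_iff_AE) auto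
  then have "AE x in lborel. x \<notin> A"
  proof eventually_elim
    case (elim x)
    show ?case
    proof
      assume x: "x \<in> A"
      have "AE y in lborel. ennreal (indicator A x * indicator G y / norm (x - y) powr \<gamma>) = 0"
        using elim by (subst (asm) nn_integral_0_iff_AE) auto
      then have "AE y in lborel. y \<notin> G"
        by eventually_elim (use x assms(3) in \<open>auto simp: indicator_def ennreal_eq_0_iff split: if_splits\<close>)
      then show False using G by simp
    qed
  qed
  then show False using A by simp
qed

section \<open>Positivity of minimizers and strict polarization inequality\<close>

lemma minimizer_nonzero_on_ball:
  fixes \<Omega> :: "'a::euclidean_space set" and s p q :: real
  assumes p: "1 < p" and s: "0 < s" "s < 1" and q: "0 < q" and \<Omega>: "bounded \<Omega>"
    and v: "v \<in> admissible s p q \<Omega>" and v0: "\<And>x. 0 \<le> v x"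
    and min: "\<And>u. u \<in> admissible s p q \<Omega> \<Longrightarrow> energy s p v \<le> energy s p u"
    and \<rho>: "0 < \<rho>" and B: "ball z \<rho> \<subseteq> \<Omega>"
  shows "\<not> (AE x in lborel. x \<in> ball z \<rho> \<longrightarrow> v x = 0)"
proof
  assume AE: "AE x in lborel. x \<in> ball z \<rho> \<longrightarrow> v x = 0"
  let ?B = "ball z \<rho>" and ?B1 = "ball z (\<rho> / 2)" and ?\<gamma> = "real DIM('a) + s * p"
  have [measurable]: "?B \<in> sets borel" "?B1 \<in> sets borel" by auto
  have vm [measurable]: "v \<in> borel_measurable borel" and vs: "\<And>x. x \<notin> \<Omega> \<Longrightarrow> v x = 0"
    and vq: "(\<integral>\<^sup>+x. ennreal (\<bar>v x\<bar> powr q) \<partial>lborel) = 1" and ve: "energy s p v < top"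
    using v by (auto simp: admissible_def)
  \<comment> \<open>\<open>perturbed_energy_le\<close> wants zeros at every point of the ball, so
    \<open>v\<close> is changed on a null set.\<close>
  define u where "u x = (if x \<in> ?B then 0 else v x)" for x
  have uv: "AE x in lborel. u x = v x" using AE by eventually_elim (auto simp: u_def)
  have u [measurable]: "u \<in> borel_measurable borel" unfolding u_def[abs_def] by measurable
  have u0: "0 \<le> u x" for x using v0 by (simp add: u_def)
  have uB: "u x = 0" if "x \<in> ?B" for x using that by (simp add: u_def)
  have us: "u x = 0" if "x \<notin> \<Omega>" for x using that vs by (simp add: u_def)
  have uq: "(\<integral>\<^sup>+x. ennreal (\<bar>u x\<bar> powr q) \<partial>lborel) = 1"
    unfolding vq[symmetric] by (rule nn_integral_cong_AE) (use uv in eventually_elim, simp)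
  have ue: "energy s p u = energy s p v" by (rule energy_cong_AE[OF uv])
  \<comment> \<open>Some positive level is exceeded on a set of positive measure; otherwise u = 0
    almost everywhere, against the normalization.\<close>
  have "\<exists>\<tau>>0. \<not> (AE x in lborel. x \<notin> {x. 2 * \<tau> < u x})"
  proof (rule ccontr)
    assume "\<not> (\<exists>\<tau>>0. \<not> (AE x in lborel. x \<notin> {x. 2 * \<tau> < u x}))"
    then have "AE x in lborel. u x \<le> 2 * (1 / real (Suc n))" for n
      by (auto simp: not_less dest: spec[of _ "1 / real (Suc n)"])
    then have "AE x in lborel. \<forall>n. u x \<le> 2 * (1 / real (Suc n))" by (simp add: AE_all_countable)
    then have "AE x in lborel. ennreal (\<bar>u x\<bar> powr q) = 0"
    proof eventually_elim
      case (elim x)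
      have "u x \<le> 2 * 0"
        by (rule LIMSEQ_le_const[OF tendsto_mult_left[OF LIMSEQ_Suc[OF lim_1_over_n]]]) (use elim in auto)
      then show ?case using u0[of x] q by simp
    qed
    then have "(\<integral>\<^sup>+x. ennreal (\<bar>u x\<bar> powr q) \<partial>lborel) = 0"
      by (subst nn_integral_0_iff_AE) auto
    then show False using uq by simp
  qed
  then obtain \<tau> where \<tau>: "0 < \<tau>" and G: "\<not> (AE x in lborel. x \<notin> {x. 2 * \<tau> < u x})" by blast
  define \<kappa> where "\<kappa> = (\<integral>\<^sup>+x. (\<integral>\<^sup>+y. ennreal (indicator ?B1 x * indicator {y. 2 * \<tau> < u y} y
           / norm (x - y) powr ?\<gamma>) \<partial>lborel) \<partial>lborel)"
  have "\<kappa> \<noteq> 0"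
    unfolding \<kappa>_def
  proof (rule interaction_pos[OF _ _ _ _ G])
    show "?B1 \<inter> {x. 2 * \<tau> < u x} = {}"
    proof -
      have "u x = 0" if "x \<in> ?B1" for x using that \<rho> by (intro uB) auto
      then show ?thesis using \<tau> by fastforce
    qed
    show "\<not> (AE x in lborel. x \<notin> ?B1)"
    proof
      assume "AE x in lborel. x \<notin> ?B1"
      then have "emeasure lborel ?B1 = 0" by (subst (asm) AE_iff_measurable[of ?B1]) auto
      then show False using \<rho> unit_ball_vol_pos[of "real DIM('a)"] by (simp add: emeasure_ball)
    qed
  qed auto
  \<comment> \<open>Capping at 1 extracts a positive real below \<open>\<kappa>\<close> without
    first showing that \<open>\<kappa>\<close> is finite.\<close>
  define k where "k = enn2real (inf \<kappa> 1)"
  have "inf \<kappa> 1 \<noteq> 0" "inf \<kappa> 1 < top"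
    using \<open>\<kappa> \<noteq> 0\<close> by (auto simp: inf_min min_def intro: order.strict_trans1[of _ 1])
  then have k: "0 < k" "ennreal k \<le> \<kappa>"
    by (auto simp: k_def enn2real_positive_iff zero_less_iff_neq_zero)
  obtain E where E: "energy s p (tent z \<rho>) = ennreal E" "0 \<le> E"
    using energy_tent_finite[OF _ s \<rho>, of p z] p by (cases "energy s p (tent z \<rho>)") auto
  obtain l where l: "energy s p v = ennreal l" "0 \<le> l" using ve by (cases "energy s p v") auto
  define d where "d = p * (\<rho> / 2) * \<tau> powr (p - 1) * k"
  have d: "0 < d" using p \<rho> \<tau> k by (simp add: d_def)
  \<comment> \<open>The first entry keeps the bump below \<open>\<tau>\<close>. The second solves
    \<epsilon>^(p - 1) = d / (2 (E + 1)), which makes the cost \<epsilon>^p E smaller than the gain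
    \<epsilon> d.\<close>
  define \<epsilon> where "\<epsilon> = min (\<tau> / \<rho>) ((d / (2 * (E + 1))) powr (1 / (p - 1)))"
  have \<epsilon>: "0 < \<epsilon>" "\<epsilon> * \<rho> \<le> \<tau>" using \<tau> \<rho> d E by (auto simp: \<epsilon>_def min_def field_simps)
  have gain: "\<epsilon> powr p * E < \<epsilon> * d"
  proof -
    have "\<epsilon> powr (p - 1) \<le> ((d / (2 * (E + 1))) powr (1 / (p - 1))) powr (p - 1)"
      using \<epsilon> p by (intro powr_mono2) (auto simp: \<epsilon>_def)
    also have "\<dots> = d / (2 * (E + 1))" using p d E by (simp add: powr_powr)
    finally have "\<epsilon> powr (p - 1) * E \<le> d / (2 * (E + 1)) * E" using E by (intro mult_right_mono)
    also have "\<dots> < d" using d E by (simp add: field_simps add_strict_increasing)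
    finally have "\<epsilon> * (\<epsilon> powr (p - 1) * E) < \<epsilon> * d" using \<epsilon> by simp
    moreover have "\<epsilon> powr p = \<epsilon> * \<epsilon> powr (p - 1)" using \<epsilon> by (simp add: powr_diff)
    ultimately show ?thesis by (simp add: mult.assoc)
  qed
  let ?w = "\<lambda>x. u x + \<epsilon> * tent z \<rho> x"
  have wm [measurable]: "?w \<in> borel_measurable borel" by measurable
  have ws: "?w x = 0" if "x \<notin> \<Omega>" for x
  proof -
    have "x \<notin> ?B" using that B by blast
    then show ?thesis using us[OF that] by (simp add: tent_eq_0 del: mem_ball)
  qed
  have "energy s p ?w + ennreal (\<epsilon> * d) \<le> energy s p ?w + ennreal (p * (\<epsilon> * (\<rho> / 2)) * \<tau> powr (p - 1)) * \<kappa>"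
  proof (rule add_left_mono)
    have "\<epsilon> * d = p * (\<epsilon> * (\<rho> / 2)) * \<tau> powr (p - 1) * k" by (simp add: d_def)
    moreover have "0 \<le> p * (\<epsilon> * (\<rho> / 2)) * \<tau> powr (p - 1)" using p \<epsilon> \<rho> by simp
    ultimately have "ennreal (\<epsilon> * d) = ennreal (p * (\<epsilon> * (\<rho> / 2)) * \<tau> powr (p - 1)) * ennreal k"
      by (metis ennreal_mult')
    also have "\<dots> \<le> ennreal (p * (\<epsilon> * (\<rho> / 2)) * \<tau> powr (p - 1)) * \<kappa>"
      by (intro mult_left_mono k) auto
    finally show "ennreal (\<epsilon> * d) \<le> \<dots>" .
  qed
  also have "\<dots> \<le> energy s p u + ennreal (\<epsilon> powr p) * energy s p (tent z \<rho>)"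
    unfolding \<kappa>_def by (rule perturbed_energy_le[OF p s(1) \<rho> \<epsilon> u u0 uB])
  also have "\<dots> = ennreal (l + \<epsilon> powr p * E)"
    unfolding ue E(1) l(1) using E l by (simp add: ennreal_mult')
  finally have le: "energy s p ?w + ennreal (\<epsilon> * d) \<le> ennreal (l + \<epsilon> powr p * E)" .
  then have "energy s p ?w < top"
    by (auto simp: top_unique less_top[symmetric] intro: order.strict_trans1)
  then obtain e where e: "energy s p ?w = ennreal e" "0 \<le> e" by (cases "energy s p ?w") auto
  have "ennreal (e + \<epsilon> * d) \<le> ennreal (l + \<epsilon> powr p * E)"
    using le e \<epsilon> d by simp
  then have "e + \<epsilon> * d \<le> l + \<epsilon> powr p * E" using l E by (subst (asm) ennreal_le_iff) auto
  with gain have "e < l" by linarith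
  then have less: "energy s p ?w < energy s p v" using e l by (simp add: ennreal_less_iff)
  let ?I = "\<integral>\<^sup>+x. ennreal (\<bar>?w x\<bar> powr q) \<partial>lborel"
  have "?I \<le> (\<integral>\<^sup>+x. ennreal (\<bar>u x\<bar> powr q) + ennreal ((\<epsilon> * \<rho>) powr q) * indicator ?B x \<partial>lborel)"
  proof (rule nn_integral_mono)
    fix x
    show "ennreal (\<bar>?w x\<bar> powr q) \<le> ennreal (\<bar>u x\<bar> powr q) + ennreal ((\<epsilon> * \<rho>) powr q) * indicator ?B x"
    proof (cases "x \<in> ?B")
      case True
      have "\<bar>?w x\<bar> \<le> \<epsilon> * \<rho>" using uB[OF True] tent_le[of \<rho> z x] \<rho> \<epsilon> by (auto simp: abs_mult)
      then have "\<bar>?w x\<bar> powr q \<le> (\<epsilon> * \<rho>) powr q" using q by (intro powr_mono2) auto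
      then show ?thesis using True by (auto intro!: add_increasing ennreal_leI)
    qed (simp add: tent_eq_0 del: mem_ball)
  qed
  also have "\<dots> = 1 + ennreal ((\<epsilon> * \<rho>) powr q) * emeasure lborel ?B"
    by (simp add: nn_integral_add nn_integral_cmult_indicator uq)
  also have "\<dots> < top"
    using emeasure_lborel_ball_finite[of z \<rho>] by (simp add: ennreal_mult_less_top)
  finally have "?I < top" .
  then obtain m where m: "?I = ennreal m" "0 \<le> m" by (cases ?I) auto
  \<comment> \<open>The bump can only raise the q-norm, so the normalizing factor is at most 1 and
    does not raise the energy.\<close>
  have "1 \<le> ?I"
    unfolding uq[symmetric] using u0 \<epsilon> q by (intro nn_integral_mono ennreal_leI powr_mono2) auto
  then have m1: "1 \<le> m" using m by simp
  have "(\<lambda>x. m powr (- 1 / q) * ?w x) \<in> admissible s p q \<Omega>"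
    using m1 by (intro normalized_admissible[OF p s(1) q \<Omega> wm ws \<open>energy s p ?w < top\<close> m(1)]) auto
  then have "energy s p v \<le> energy s p (\<lambda>x. m powr (- 1 / q) * ?w x)" by (rule min)
  also have "\<dots> = ennreal (\<bar>m powr (- 1 / q)\<bar> powr p) * energy s p ?w" by (rule energy_scale[OF wm])
  also have "\<dots> \<le> 1 * energy s p ?w"
  proof (rule mult_right_mono)
    have "m powr (- 1 / q) \<le> 1" using m1 q powr_mono[of "- 1 / q" 0 m] by simp
    then have "(m powr (- 1 / q)) powr p \<le> 1" using powr_mono2[of p "m powr (- 1 / q)" 1] p by simp
    then show "ennreal (\<bar>m powr (- 1 / q)\<bar> powr p) \<le> 1" by simp
  qed simp
  finally show False using less by simp
qed

section \<open>Polarization of functions and of domains\<close>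

context
  fixes h :: "'a::euclidean_space" and a :: real
  assumes h: "norm h = 1"
begin

text \<open>Polarization at most swaps the two values on a mirror pair, so sums over the pair, and
  with them all norms, are kept.\<close>

lemma polarize_pair:
  "(polarize h a u x = u x \<and> polarize h a u (reflection h a x) = u (reflection h a x)) \<or>
   (polarize h a u x = u (reflection h a x) \<and> polarize h a u (reflection h a x) = u x)"
proof (cases "x \<bullet> h \<le> a")
  case True
  then show ?thesis using polarize_half_space[OF h True, of u] by (auto simp: max_def min_def)
next
  case False
  then have "reflection h a x \<bullet> h \<le> a" by (simp add: reflection_inner[OF h])
  from polarize_half_space[OF h this, of u] show ?thesis
    by (auto simp: max_def min_def reflection_involution[OF h])
qed

lemma nn_integral_polarize:
  assumes [measurable]: "u \<in> borel_measurable borel"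
  shows "(\<integral>\<^sup>+x. ennreal (\<bar>polarize h a u x\<bar> powr r) \<partial>lborel) = (\<integral>\<^sup>+x. ennreal (\<bar>u x\<bar> powr r) \<partial>lborel)"
proof -
  let ?r = "reflection h a"
  have two: "(\<integral>\<^sup>+x. ennreal (\<bar>w x\<bar> powr r) + ennreal (\<bar>w (?r x)\<bar> powr r) \<partial>lborel)
      = 2 * (\<integral>\<^sup>+x. ennreal (\<bar>w x\<bar> powr r) \<partial>lborel)" if [measurable]: "w \<in> borel_measurable borel" for w
    using nn_integral_reflection[OF h, of "\<lambda>x. ennreal (\<bar>w x\<bar> powr r)" a]
    by (simp add: nn_integral_add mult_2)
  have "2 * (\<integral>\<^sup>+x. ennreal (\<bar>polarize h a u x\<bar> powr r) \<partial>lborel) = 2 * (\<integral>\<^sup>+x. ennreal (\<bar>u x\<bar> powr r) \<partial>lborel)"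
    unfolding two[OF assms, symmetric] two[OF measurable_polarize[OF h assms], symmetric]
  proof (rule nn_integral_cong)
    fix x
    show "ennreal (\<bar>polarize h a u x\<bar> powr r) + ennreal (\<bar>polarize h a u (?r x)\<bar> powr r)
      = ennreal (\<bar>u x\<bar> powr r) + ennreal (\<bar>u (?r x)\<bar> powr r)"
      using polarize_pair[of u x] by (auto simp: add.commute)
  qed
  then show ?thesis by (simp add: ennreal_mult_cancel_left)
qed

lemma mem_reflection_image: "x \<in> reflection h a ` \<Omega> \<longleftrightarrow> reflection h a x \<in> \<Omega>"
  by (simp add: image_reflection_eq_vimage[OF h])

text \<open>Nonnegativity is essential: outside the half-space a nonzero minimum then forces both
  values to be nonzero, which places x and its mirror image in \<open>\<Omega>\<close>.\<close>

lemma polarize_admissible: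
  assumes p: "1 < p" and s: "0 < s" and u: "u \<in> admissible s p q \<Omega>" and u0: "\<And>x. 0 \<le> u x"
  shows "polarize h a u \<in> admissible s p q (polarization h a \<Omega>)"
proof -
  have um: "u \<in> borel_measurable borel" and us: "\<And>x. u x \<noteq> 0 \<Longrightarrow> x \<in> \<Omega>"
    using u by (auto simp: admissible_def)
  have "x \<in> polarization h a \<Omega>" if "polarize h a u x \<noteq> 0" for x
  proof (cases "x \<bullet> h < a")
    case True
    then have "u x \<noteq> 0 \<or> u (reflection h a x) \<noteq> 0" using that by (auto simp: polarize_def max_def)
    then show ?thesis using True us by (auto simp: polarization_def polarizer_def mem_reflection_image)
  next
    case False
    then have "u x \<noteq> 0 \<and> u (reflection h a x) \<noteq> 0"
      using that u0[of x] u0[of "reflection h a x"] by (auto simp: polarize_def min_def split: if_splits)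
    then show ?thesis using us by (auto simp: polarization_def mem_reflection_image)
  qed
  moreover have "energy s p (polarize h a u) < top"
    using energy_polarize_le[OF h p s um, of a] u by (auto simp: admissible_def intro: order.strict_trans1)
  ultimately show ?thesis
    using u measurable_polarize[OF h um, of a] by (auto simp: admissible_def nn_integral_polarize[OF um])
qed

lemma open_polarization:
  assumes "open \<Omega>" shows "open (polarization h a \<Omega>)"
proof -
  have r: "open (reflection h a ` \<Omega>)" by (rule open_reflection_image[OF h assms])
  have "open (polarizer h a)"
    unfolding polarizer_def using open_halfspace_lt[of h a] by (simp add: inner_commute)
  then show ?thesis unfolding polarization_def using assms r by (intro open_Un open_Int)
qed

lemma eigenvalue_polarization_le:
  assumes p: "1 < p" and s: "0 < s" and q: "0 < q" and \<Omega>: "open \<Omega>"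
  shows "eigenvalue s p q (polarization h a \<Omega>) \<le> eigenvalue s p q \<Omega>"
proof -
  have p0: "0 < p" using p by simp
  have b: "\<Omega> \<in> sets borel" "polarization h a \<Omega> \<in> sets borel"
    using \<Omega> open_polarization[OF \<Omega>] by auto
  show ?thesis
    unfolding eigenvalue_eq_INF_energy[OF p0 q b(1)] eigenvalue_eq_INF_energy[OF p0 q b(2)]
  proof (rule INF_mono)
    fix u assume u: "u \<in> admissible s p q \<Omega>"
    then have [measurable]: "u \<in> borel_measurable borel" by (simp add: admissible_def)
    have le: "energy s p (\<lambda>x. \<bar>u x\<bar>) \<le> energy s p u" by (rule energy_abs_le[OF p0])
    then have "energy s p (\<lambda>x. \<bar>u x\<bar>) < top"
      using u by (auto simp: admissible_def intro: order.strict_trans1)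
    then have "(\<lambda>x. \<bar>u x\<bar>) \<in> admissible s p q \<Omega>"
      using u by (auto simp: admissible_def)
    then have "polarize h a (\<lambda>x. \<bar>u x\<bar>) \<in> admissible s p q (polarization h a \<Omega>)"
      by (intro polarize_admissible[OF p s]) auto
    moreover have "energy s p (polarize h a (\<lambda>x. \<bar>u x\<bar>)) \<le> energy s p u"
      using le by (intro order.trans[OF energy_polarize_le[OF h p s]]) auto
    ultimately show "\<exists>w\<in>admissible s p q (polarization h a \<Omega>). energy s p w \<le> energy s p u" by blast
  qed
qed

lemma AE_reflection:
  assumes "AE x in lborel. P x"
  shows "AE x in lborel. P (reflection h a x)"
proof -
  have "distr lborel lborel (reflection h a) = distr lborel borel (reflection h a)"
    by (rule distr_cong) simp_all
  then have D: "distr lborel lborel (reflection h a) = lborel" by (simp only: distr_lborel_reflection[OF h])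
  have "AE x in distr lborel lborel (reflection h a). P x"
    by (subst D) (rule assms)
  then show ?thesis by (rule AE_distrD[rotated]) simp
qed

lemma polarization_ne_imp:
  assumes "\<Omega> \<noteq> polarization h a \<Omega>"
  shows "\<exists>x. x \<bullet> h < a \<and> x \<notin> \<Omega> \<and> reflection h a x \<in> \<Omega>"
proof (rule ccontr)
  assume neg: "\<not> ?thesis"
  have "x \<in> \<Omega> \<longleftrightarrow> x \<in> polarization h a \<Omega>" for x
  proof (cases "x \<bullet> h < a")
    case True
    then show ?thesis using neg by (auto simp: polarization_def polarizer_def mem_reflection_image)
  next
    case False
    have "reflection h a x \<in> \<Omega>" if "x \<in> \<Omega>"
    proof (cases "x \<bullet> h = a")
      case True
      then show ?thesis using that by (simp add: reflection_def)
    next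
      case F: False
      then have "reflection h a x \<bullet> h < a" using False by (simp add: reflection_inner[OF h])
      then show ?thesis using neg that reflection_involution[OF h, of a x] by metis
    qed
    then show ?thesis using False by (auto simp: polarization_def polarizer_def mem_reflection_image)
  qed
  then show False using assms by blast
qed

lemma polarization_ne_reflection_imp:
  assumes "polarization h a \<Omega> \<noteq> reflection h a ` \<Omega>"
  shows "\<exists>x. x \<bullet> h < a \<and> x \<in> \<Omega> \<and> reflection h a x \<notin> \<Omega>"
proof (rule ccontr)
  assume neg: "\<not> ?thesis"
  have "x \<in> polarization h a \<Omega> \<longleftrightarrow> reflection h a x \<in> \<Omega>" for x
  proof (cases "x \<bullet> h < a")
    case True
    then show ?thesis using neg by (auto simp: polarization_def polarizer_def mem_reflection_image)
  next
    case False
    have "x \<in> \<Omega>" if "reflection h a x \<in> \<Omega>"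
    proof (cases "x \<bullet> h = a")
      case True
      then show ?thesis using that by (simp add: reflection_def)
    next
      case F: False
      then have "reflection h a x \<bullet> h < a" using False by (simp add: reflection_inner[OF h])
      then show ?thesis using neg that reflection_involution[OF h, of a x] by metis
    qed
    then show ?thesis using False by (auto simp: polarization_def polarizer_def mem_reflection_image)
  qed
  then show False using assms mem_reflection_image by blast
qed

text \<open>Regularity of \<open>\<Omega>\<close> makes the sets \<open>(H \<inter> \<sigma>\<^sub>H(\<Omega>)) - \<Omega>\<close> and \<open>(H \<inter> \<Omega>) - \<sigma>\<^sub>H(\<Omega>)\<close> contain balls as soon as
  they are nonempty. A minimizer exceeds its reflection on a part of one and is exceeded on a part of the other.\<close>

lemma eigenvalue_polarization_less:
  assumes p: "1 < p" and s: "0 < s" "s < 1" and q: "0 < q" "ereal q < critical_exponent DIM('a) s p"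
    and \<Omega>: "open \<Omega>" "bounded \<Omega>" and regular: "interior (closure \<Omega>) \<subseteq> \<Omega>"
    and ne: "\<Omega> \<noteq> polarization h a \<Omega>" "polarization h a \<Omega> \<noteq> reflection h a ` \<Omega>"
  shows "eigenvalue s p q (polarization h a \<Omega>) < eigenvalue s p q \<Omega>"
proof -
  let ?r = "reflection h a"
  have p0: "0 < p" using p by simp
  have H: "open {x. x \<bullet> h < a}" using open_halfspace_lt[of h a] by (simp add: inner_commute)
  have r: "open (?r ` S)" if "open S" for S by (rule open_reflection_image[OF h that])
  have inside: "x \<in> \<Omega>" if "open U" "x \<in> U" "U \<subseteq> closure \<Omega>" for x U
    using that regular interior_maximal by blast
  have closure_r: "?r ` closure S \<subseteq> closure (?r ` S)" for S
    by (intro image_closure_subset continuous_on_reflection closure_subset) auto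
  obtain x where x: "x \<bullet> h < a" "x \<notin> \<Omega>" "?r x \<in> \<Omega>" using polarization_ne_imp[OF ne(1)] by blast
  \<comment> \<open>Otherwise this open set, which contains \<open>x\<close>, would lie in
    \<open>closure \<Omega>\<close>, and regularity would put \<open>x\<close> into
    \<open>\<Omega>\<close>.\<close>
  have "\<not> {x. x \<bullet> h < a} \<inter> ?r ` \<Omega> \<subseteq> closure \<Omega>"
    using inside[of "{x. x \<bullet> h < a} \<inter> ?r ` \<Omega>" x] x H r \<Omega> by (auto simp: mem_reflection_image)
  then obtain y where y: "y \<in> {x. x \<bullet> h < a} \<inter> ?r ` \<Omega> - closure \<Omega>" by blast
  have "open ({x. x \<bullet> h < a} \<inter> ?r ` \<Omega> - closure \<Omega>)" using H r[OF \<Omega>(1)] by auto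
  from openE[OF this y] obtain \<rho> where \<rho>: "0 < \<rho>" "ball y \<rho> \<subseteq> {x. x \<bullet> h < a} \<inter> ?r ` \<Omega> - closure \<Omega>" .
  obtain x' where x': "x' \<bullet> h < a" "x' \<in> \<Omega>" "?r x' \<notin> \<Omega>"
    using polarization_ne_reflection_imp[OF ne(2)] by blast
  \<comment> \<open>The analogue for the reflected domain; reflecting the inclusion reduces it to
    the regularity of \<open>\<Omega>\<close> itself.\<close>
  have "\<not> {x. x \<bullet> h < a} \<inter> \<Omega> \<subseteq> closure (?r ` \<Omega>)"
  proof
    assume sub: "{x. x \<bullet> h < a} \<inter> \<Omega> \<subseteq> closure (?r ` \<Omega>)"
    have "?r ` ({x. x \<bullet> h < a} \<inter> \<Omega>) \<subseteq> ?r ` closure (?r ` \<Omega>)" using sub by (rule image_mono)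
    also have "\<dots> \<subseteq> closure (?r ` ?r ` \<Omega>)" by (rule closure_r)
    also have "?r ` ?r ` \<Omega> = \<Omega>" by (simp add: image_image reflection_involution[OF h])
    finally have "?r x' \<in> \<Omega>"
      using x' H \<Omega> by (intro inside[OF r[of "{x. x \<bullet> h < a} \<inter> \<Omega>"]]) auto
    then show False using x' by simp
  qed
  then obtain y' where y': "y' \<in> {x. x \<bullet> h < a} \<inter> \<Omega> - closure (?r ` \<Omega>)" by blast
  have "open ({x. x \<bullet> h < a} \<inter> \<Omega> - closure (?r ` \<Omega>))" using H \<Omega> by auto
  from openE[OF this y'] obtain \<rho>' where \<rho>': "0 < \<rho>'" "ball y' \<rho>' \<subseteq> {x. x \<bullet> h < a} \<inter> \<Omega> - closure (?r ` \<Omega>)" .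
  have sub': "ball y' \<rho>' \<subseteq> \<Omega>" using \<rho>' by blast
  obtain v where v: "v \<in> admissible s p q \<Omega>" and v0: "\<And>x. 0 \<le> v x"
    and min: "\<And>u. u \<in> admissible s p q \<Omega> \<Longrightarrow> energy s p v \<le> energy s p u"
    using energy_minimizer[OF p s(1) q \<Omega>(2) admissible_nonempty[OF p s q(1) \<Omega>(2) \<rho>'(1) sub']] by blast
  have vm: "v \<in> borel_measurable borel" and vs: "\<And>x. x \<notin> \<Omega> \<Longrightarrow> v x = 0" and ve: "energy s p v < top"
    using v by (auto simp: admissible_def)
  have nonzero: "\<not> (AE x in lborel. x \<in> ball z \<rho> \<longrightarrow> v x = 0)" if "0 < \<rho>" "ball z \<rho> \<subseteq> \<Omega>" for z \<rho>
    by (rule minimizer_nonzero_on_ball[OF p s q(1) \<Omega>(2) v v0 _ that]) (rule min)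
  have "energy s p (polarize h a v) < energy s p v"
  proof (rule energy_polarize_less[OF h p s(1) vm ve])
    show "\<not> (AE x in lborel. \<not> (x \<bullet> h < a \<and> v (?r x) < v x))"
    proof
      assume "AE x in lborel. \<not> (x \<bullet> h < a \<and> v (?r x) < v x)"
      then have "AE x in lborel. x \<in> ball y' \<rho>' \<longrightarrow> v x = 0"
      proof eventually_elim
        case (elim x)
        show ?case
        proof
          assume "x \<in> ball y' \<rho>'"
          then have "x \<bullet> h < a" "x \<notin> ?r ` \<Omega>" using \<rho>'(2) closure_subset by blast+
          then have "x \<bullet> h < a" "v (?r x) = 0" using vs by (auto simp: mem_reflection_image)
          then show "v x = 0" using elim v0[of x] by auto
        qed
      qed
      then show False using nonzero[OF \<rho>'(1) sub'] by simp
    qed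
    show "\<not> (AE x in lborel. \<not> (x \<bullet> h < a \<and> v x < v (?r x)))"
    proof
      assume "AE x in lborel. \<not> (x \<bullet> h < a \<and> v x < v (?r x))"
      \<comment> \<open>The assumption concerns \<open>ball y \<rho>\<close> in the half-space,
        outside \<open>\<Omega>\<close>. Reflecting transfers it to the ball about
        \<open>?r y\<close>, which lies in \<open>\<Omega>\<close>, where the minimizer cannot
        vanish.\<close>
      then have "AE x in lborel. \<not> (?r x \<bullet> h < a \<and> v (?r x) < v (?r (?r x)))" by (rule AE_reflection)
      then have "AE x in lborel. x \<in> ball (?r y) \<rho> \<longrightarrow> v x = 0"
      proof eventually_elim
        case (elim x)
        show ?case
        proof
          assume "x \<in> ball (?r y) \<rho>"
          then have "?r x \<in> ball y \<rho>"
            by (simp flip: reflection_image_ball[OF h] add: mem_reflection_image)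
          then have "?r x \<bullet> h < a" "?r x \<notin> \<Omega>" using \<rho>(2) closure_subset by blast+
          then show "v x = 0" using elim v0[of x] vs[of "?r x"] by (auto simp: reflection_involution[OF h])
        qed
      qed
      moreover have "ball (?r y) \<rho> \<subseteq> \<Omega>"
      proof
        fix x assume "x \<in> ball (?r y) \<rho>"
        then have "?r x \<in> ball y \<rho>"
          by (simp flip: reflection_image_ball[OF h] add: mem_reflection_image)
        then have "?r x \<in> ?r ` \<Omega>" using \<rho>(2) by blast
        then show "x \<in> \<Omega>" by (simp add: mem_reflection_image reflection_involution[OF h])
      qed
      ultimately show False using nonzero[OF \<rho>(1)] by blast
    qed
  qed
  moreover have "eigenvalue s p q \<Omega> = energy s p v"
    unfolding eigenvalue_eq_INF_energy[OF p0 q(1) borel_open[OF \<Omega>(1)]]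
    by (rule antisym) (auto intro: INF_lower v INF_greatest min)
  moreover have "eigenvalue s p q (polarization h a \<Omega>) \<le> energy s p (polarize h a v)"
    unfolding eigenvalue_eq_INF_energy[OF p0 q(1) borel_open[OF open_polarization[OF \<Omega>(1)]]]
    by (intro INF_lower polarize_admissible[OF p s(1) v v0])
  ultimately show ?thesis by (metis order.strict_trans1)
qed

end

section \<open>Regular domains and annuli\<close>

text \<open>The open region strictly below the local graph misses \<open>\<Omega>\<close> and hence
  its closure. A boundary point lies on or below the graph, so a small step along -n enters that
  region and leaves the closure.\<close>

lemma C11_boundary_regular:
  fixes \<Omega> :: "'a::euclidean_space set"
  assumes "open \<Omega>" and C: "C11_boundary \<Omega>"
  shows "interior (closure \<Omega>) \<subseteq> \<Omega>"
proof (rule subsetI, rule ccontr)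
  fix x assume x: "x \<in> interior (closure \<Omega>)" "x \<notin> \<Omega>"
  then have "x \<in> frontier \<Omega>"
    using interior_subset[of "closure \<Omega>"] assms(1) by (auto simp: frontier_def interior_open)
  with C obtain \<rho> n g where \<rho>: "0 < \<rho>" and n: "norm n = 1" and g: "C11_function g"
    and graph: "\<Omega> \<inter> ball x \<rho> = {y \<in> ball x \<rho>. y \<bullet> n > g (y - (y \<bullet> n) *\<^sub>R n)}"
    unfolding C11_boundary_def by blast
  from g obtain G where G: "\<And>x. (g has_derivative (\<lambda>v. G x \<bullet> v)) (at x)"
    unfolding C11_function_def by blast
  have cont: "continuous_on UNIV g"
    by (rule has_derivative_continuous_on[where f' = "\<lambda>x v. G x \<bullet> v"]) (rule G)
  have "continuous_on UNIV (\<lambda>y. g (y - (y \<bullet> n) *\<^sub>R n))"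
    by (rule continuous_on_compose2[OF cont]) (auto intro!: continuous_intros)
  moreover have "continuous_on UNIV (\<lambda>y. y \<bullet> n)" by (intro continuous_intros)
  ultimately have "open {y. y \<bullet> n < g (y - (y \<bullet> n) *\<^sub>R n)}" by (intro open_Collect_less)
  then have op: "open ({y. y \<bullet> n < g (y - (y \<bullet> n) *\<^sub>R n)} \<inter> ball x \<rho>)" by auto
  moreover have "({y. y \<bullet> n < g (y - (y \<bullet> n) *\<^sub>R n)} \<inter> ball x \<rho>) \<inter> \<Omega> = {}"
  proof -
    have "y \<bullet> n > g (y - (y \<bullet> n) *\<^sub>R n)" if "y \<in> \<Omega>" "y \<in> ball x \<rho>" for y
      using graph that by blast
    then show ?thesis by fastforce
  qed
  ultimately have out: "({y. y \<bullet> n < g (y - (y \<bullet> n) *\<^sub>R n)} \<inter> ball x \<rho>) \<inter> closure \<Omega> = {}"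
    by (simp only: open_Int_closure_eq_empty)
  have "x \<in> ball x \<rho>" using \<rho> by simp
  then have xg: "x \<bullet> n \<le> g (x - (x \<bullet> n) *\<^sub>R n)" using graph x(2) by (auto simp: not_less[symmetric])
  have "open (interior (closure \<Omega>) \<inter> ball x \<rho>)" "x \<in> interior (closure \<Omega>) \<inter> ball x \<rho>" using x \<rho> by auto
  then obtain e where e: "0 < e" "ball x e \<subseteq> interior (closure \<Omega>) \<inter> ball x \<rho>" by (rule openE)
  \<comment> \<open>Moving along \<open>n\<close> keeps the projection, and with it the graph value,
    unchanged.\<close>
  define y where "y = x - (e / 2) *\<^sub>R n"
  have "y \<in> ball x e" using e n by (simp add: y_def dist_norm)
  then have y: "y \<in> closure \<Omega>" "y \<in> ball x \<rho>" using e interior_subset by blast+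
  have nn: "n \<bullet> n = 1" using n by (simp add: norm_eq_1)
  have "y - (y \<bullet> n) *\<^sub>R n = x - (x \<bullet> n) *\<^sub>R n"
    by (simp add: y_def inner_diff_left nn scaleR_left_diff_distrib)
  moreover have "y \<bullet> n < x \<bullet> n" using e by (simp add: y_def inner_diff_left nn)
  ultimately have "y \<bullet> n < g (y - (y \<bullet> n) *\<^sub>R n)" using xg by simp
  then show False using out y by blast
qed

lemma annulus_regular:
  fixes c :: "'a::euclidean_space"
  assumes "0 < r"
  shows "interior (closure (ball 0 R - cball c r)) \<subseteq> ball 0 R - cball c r"
proof -
  have "closure (ball 0 R - cball c r) \<subseteq> cball 0 R \<inter> - ball c r"
    by (intro closure_minimal closed_Int) auto
  then have "interior (closure (ball 0 R - cball c r)) \<subseteq> interior (cball 0 R \<inter> - ball c r)"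
    by (rule interior_mono)
  also have "\<dots> = ball 0 R - cball c r"
    using assms by (simp add: interior_complement Diff_eq)
  finally show ?thesis .
qed

section \<open>Moving the hole of an annulus by polarization\<close>

context
  fixes e :: "'a::euclidean_space" and r R t t' :: real
  assumes e: "norm e = 1" and r: "0 < r" "r < R" and t: "0 \<le> t" "t < t'" "t' < R - r"
begin

lemma reflection_axis: "reflection e a (b *\<^sub>R e) = (2 * a - b) *\<^sub>R e"
proof -
  have "e \<bullet> e = 1" using e by (simp add: norm_eq_1)
  then have "reflection e a (b *\<^sub>R e) = b *\<^sub>R e - (2 * (b - a)) *\<^sub>R e" by (simp add: reflection_def)
  also have "\<dots> = (b - 2 * (b - a)) *\<^sub>R e" by (simp only: scaleR_left_diff_distrib)
  also have "b - 2 * (b - a) = 2 * a - b" by simp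
  finally show ?thesis .
qed

text \<open>The reflection exchanges the two centres, and the half-space contains the origin and the
  first centre. The delicate point is that the old hole gets filled: its mirror image must lie in
  the big ball, which holds because t' < R - r.\<close>

lemma polarization_annulus:
  "polarization e ((t + t') / 2) (ball 0 R - cball (t *\<^sub>R e) r) = ball 0 R - cball (t' *\<^sub>R e) r"
proof (rule set_eqI)
  fix x
  define a where "a = (t + t') / 2"
  let ?r = "reflection e a" and ?c = "t *\<^sub>R e" and ?c' = "t' *\<^sub>R e"
  have a: "0 < a" "t < a" using t by (auto simp: a_def)
  have ee: "e \<bullet> e = 1" using e by (simp add: norm_eq_1)
  have hole: "?r ?c = ?c'" unfolding a_def reflection_axis by (simp add: field_simps)
  have cH: "?c \<bullet> e \<le> a" "(0::'a) \<bullet> e \<le> a" using a ee by auto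
  have far: "norm (?r y - ?c) = norm (y - ?c')" for y
    using norm_reflection_diff[OF e, of a y ?c] by (simp add: hole)
  have mem: "y \<in> ball 0 R - cball d r \<longleftrightarrow> norm y < R \<and> r < norm (y - d)" for y d :: 'a
    by (auto simp: dist_norm norm_minus_commute)
  have image: "y \<in> ?r ` (ball 0 R - cball ?c r) \<longleftrightarrow> norm (?r y) < R \<and> r < norm (y - ?c')" for y
    unfolding mem_reflection_image[OF e] mem far ..
  show "x \<in> polarization e ((t + t') / 2) (ball 0 R - cball ?c r) \<longleftrightarrow> x \<in> ball 0 R - cball ?c' r"
  proof (cases "x \<bullet> e < a")
    case True
    have n1: "norm x \<le> norm (?r x)"
      using norm_diff_le_reflection[OF e, of x a 0] norm_reflection_diff[OF e, of a x 0] True cH by simp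
    have n2: "norm (x - ?c) \<le> norm (x - ?c')"
      using norm_diff_le_reflection[OF e, of x a ?c] True cH by (simp add: hole)
    have n3: "norm (?r x) < R" if "norm (x - ?c) \<le> r"
    proof -
      have "norm (?r x - ?c') \<le> r"
        using that norm_reflection_diff_reflection[OF e, of a x ?c] by (simp add: hole)
      moreover have "norm (?r x) \<le> norm (?r x - ?c') + norm ?c'" using norm_triangle_ineq[of "?r x - ?c'" ?c'] by simp
      ultimately show ?thesis using t e by simp
    qed
    have "x \<in> polarization e a (ball 0 R - cball ?c r) \<longleftrightarrow>
      (norm x < R \<and> r < norm (x - ?c)) \<or> (norm (?r x) < R \<and> r < norm (x - ?c'))"
      using True unfolding polarization_def polarizer_def Un_iff Int_iff image mem by blast
    also have "\<dots> \<longleftrightarrow> norm x < R \<and> r < norm (x - ?c')"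
      using n1 n2 n3 by force
    finally show ?thesis unfolding mem a_def .
  next
    case False
    then have H: "?r x \<bullet> e \<le> a" by (simp add: reflection_inner[OF e])
    have n1: "norm (?r x) \<le> norm x"
      using norm_diff_le_reflection[OF e H cH(2)] norm_reflection_diff_reflection[OF e, of a x 0] by simp
    have n2: "norm (x - ?c') \<le> norm (x - ?c)"
      using norm_diff_le_reflection[OF e H cH(1)] norm_reflection_diff_reflection[OF e, of a x ?c] far[of x] by simp
    have "x \<in> polarization e a (ball 0 R - cball ?c r) \<longleftrightarrow>
      (norm x < R \<and> r < norm (x - ?c)) \<and> (norm (?r x) < R \<and> r < norm (x - ?c'))"
      using False unfolding polarization_def polarizer_def Un_iff Int_iff image mem by blast
    also have "\<dots> \<longleftrightarrow> norm x < R \<and> r < norm (x - ?c')"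
      using n1 n2 by force
    finally show ?thesis unfolding mem a_def .
  qed
qed

lemma annulus_shift_ne: "ball 0 R - cball (t *\<^sub>R e) r \<noteq> ball 0 R - cball (t' *\<^sub>R e) r"
proof -
  \<comment> \<open>The point of the first hole farthest from the second centre, at distance r + (t'
    - t) from it.\<close>
  have "(t - r) *\<^sub>R e \<in> cball (t *\<^sub>R e) r"
    using e r by (simp add: dist_norm scaleR_left_diff_distrib[symmetric])
  moreover have "(t - r) *\<^sub>R e \<notin> cball (t' *\<^sub>R e) r" "(t - r) *\<^sub>R e \<in> ball 0 R"
    using e r t by (auto simp: dist_norm scaleR_left_diff_distrib[symmetric])
  ultimately show ?thesis by blast
qed

lemma annulus_shift_ne_reflection:
  "ball 0 R - cball (t' *\<^sub>R e) r \<noteq> reflection e ((t + t') / 2) ` (ball 0 R - cball (t *\<^sub>R e) r)"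
proof -
  let ?r = "reflection e ((t + t') / 2)"
  \<comment> \<open>The witness lies near the end of the diameter opposite to the displacement of
    the hole. The bound \<open>\<delta> \<le> t + t'\<close> pushes its mirror image out of the big
    ball, and \<open>r + \<delta> < R\<close> keeps it off the hole.\<close>
  define \<delta> where "\<delta> = min (t + t') ((R - r) / 2)"
  have "0 < \<delta>" using t r by (simp add: \<delta>_def)
  moreover have "\<delta> \<le> t + t'" "\<delta> \<le> (R - r) / 2"
    unfolding \<delta>_def by (rule min.cobounded1, rule min.cobounded2)
  ultimately have \<delta>: "0 < \<delta>" "\<delta> \<le> t + t'" "r + \<delta> < R" using r by (auto simp: field_simps)
  define x where "x = (- (R - \<delta>)) *\<^sub>R e"
  have "t' *\<^sub>R e - x = (t' + (R - \<delta>)) *\<^sub>R e" by (simp add: x_def algebra_simps)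
  then have "dist (t' *\<^sub>R e) x = \<bar>t' + (R - \<delta>)\<bar>" using e by (simp add: dist_norm)
  moreover have "norm x = R - \<delta>" using e \<delta> r by (simp add: x_def)
  ultimately have "x \<in> ball 0 R - cball (t' *\<^sub>R e) r" using \<delta> t r by simp
  moreover have "?r x = (R - \<delta> + (t + t')) *\<^sub>R e"
  proof -
    have "2 * ((t + t') / 2) - - (R - \<delta>) = R - \<delta> + (t + t')" by (simp add: field_simps)
    then show ?thesis unfolding x_def reflection_axis by (simp only:)
  qed
  then have "norm (?r x) = R - \<delta> + (t + t')" using e \<delta> r by simp
  then have "?r x \<notin> ball 0 R" using \<delta> by simp
  then have "x \<notin> ?r ` (ball 0 R - cball (t *\<^sub>R e) r)" by (simp add: mem_reflection_image[OF e])
  ultimately show ?thesis by blast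
qed

lemma eigenvalue_annulus_less:
  assumes p: "1 < p" and s: "0 < s" "s < 1" and q: "0 < q" "ereal q < critical_exponent DIM('a) s p"
  shows "eigenvalue s p q (ball 0 R - cball (t' *\<^sub>R e) r) < eigenvalue s p q (ball 0 R - cball (t *\<^sub>R e) r)"
proof -
  let ?\<Omega> = "ball 0 R - cball (t *\<^sub>R e) r"
  have "bounded ?\<Omega>" by (rule bounded_subset[OF bounded_ball]) auto
  from eigenvalue_polarization_less[OF e p s q _ this annulus_regular[OF r(1)], of "(t + t') / 2", unfolded polarization_annulus]
  show ?thesis
    using annulus_shift_ne annulus_shift_ne_reflection by blast
qed

end

theorem theorem1p1:
  fixes p s q :: real
  assumes "1 < p" and "0 < s" and "s < 1"
    and "1 \<le> q" and "ereal q < critical_exponent CARD('n::finite) s p"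
  shows
    "(\<forall>(h :: real ^ 'n) (a :: real) (\<Omega> :: (real ^ 'n) set).
        norm h = 1 \<longrightarrow> bounded \<Omega> \<longrightarrow> open \<Omega> \<longrightarrow> C11_boundary \<Omega> \<longrightarrow>
          eigenvalue s p q (polarization h a \<Omega>) \<le> eigenvalue s p q \<Omega> \<and>
          (\<Omega> \<noteq> polarization h a \<Omega> \<longrightarrow> polarization h a \<Omega> \<noteq> reflection h a ` \<Omega> \<longrightarrow>
             eigenvalue s p q (polarization h a \<Omega>) < eigenvalue s p q \<Omega>))
     \<and>
     (\<forall>(k :: 'n) (r :: real) (R :: real). 0 < r \<longrightarrow> r < R \<longrightarrow>
        (let e\<^sub>1 = (axis k 1 :: real ^ 'n);
             f = (\<lambda>t. eigenvalue s p q (ball 0 R - cball (t *\<^sub>R e\<^sub>1) r))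
         in strict_antimono_on {0..<R - r} f \<and>
            eigenvalue s p q (ball (0 :: real ^ 'n) R - cball 0 r) \<in> f ` {0..<R - r} \<and>
            (\<forall>t\<in>{0..<R - r}.
               f t \<le> eigenvalue s p q (ball (0 :: real ^ 'n) R - cball 0 r))))"
proof (intro conjI allI impI)
  have q: "0 < q" using assms by simp
  have crit: "ereal q < critical_exponent DIM(real ^ 'n) s p" using assms by simp
  fix h :: "real ^ 'n" and a and \<Omega> :: "(real ^ 'n) set"
  assume h: "norm h = 1" and \<Omega>: "bounded \<Omega>" "open \<Omega>" "C11_boundary \<Omega>"
  show "eigenvalue s p q (polarization h a \<Omega>) \<le> eigenvalue s p q \<Omega>"
    by (rule eigenvalue_polarization_le[OF h assms(1,2) q \<Omega>(2)])
  assume "\<Omega> \<noteq> polarization h a \<Omega>" "polarization h a \<Omega> \<noteq> reflection h a ` \<Omega>"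
  then show "eigenvalue s p q (polarization h a \<Omega>) < eigenvalue s p q \<Omega>"
    by (rule eigenvalue_polarization_less[OF h assms(1-3) q crit \<Omega>(2,1) C11_boundary_regular[OF \<Omega>(2,3)]])
next
  have q: "0 < q" using assms by simp
  have crit: "ereal q < critical_exponent DIM(real ^ 'n) s p" using assms by simp
  fix k :: 'n and r R :: real
  assume r: "0 < r" "r < R"
  define f where "f t = eigenvalue s p q (ball (0 :: real ^ 'n) R - cball (t *\<^sub>R axis k 1) r)" for t
  have less: "f t' < f t" if "0 \<le> t" "t < t'" "t' < R - r" for t t'
    unfolding f_def by (rule eigenvalue_annulus_less[OF _ r that assms(1-3) q crit]) (simp add: norm_axis_1)
  have f0: "eigenvalue s p q (ball (0 :: real ^ 'n) R - cball 0 r) = f 0" by (simp add: f_def)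
  have "f t \<le> f 0" if "t \<in> {0..<R - r}" for t
    using less[of 0 t] that by (cases "t = 0") (auto intro: less_imp_le)
  then have "strict_antimono_on {0..<R - r} f \<and> f 0 \<in> f ` {0..<R - r} \<and> (\<forall>t\<in>{0..<R - r}. f t \<le> f 0)"
    using less r by (auto simp: monotone_on_def)
  then show "let e\<^sub>1 = (axis k 1 :: real ^ 'n);
             f = (\<lambda>t. eigenvalue s p q (ball 0 R - cball (t *\<^sub>R e\<^sub>1) r))
         in strict_antimono_on {0..<R - r} f \<and>
            eigenvalue s p q (ball (0 :: real ^ 'n) R - cball 0 r) \<in> f ` {0..<R - r} \<and>
            (\<forall>t\<in>{0..<R - r}. f t \<le> eigenvalue s p q (ball (0 :: real ^ 'n) R - cball 0 r))"
    unfolding f0 Let_def f_def[abs_def] .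
qed

end
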